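(* Let $d\ge 2$ and suppose $F(0)\geq p_{\mathrm c}(\mathbb Z^d)$. Then almost surely the following holds for any sequence $(x_k)_{k\geq1}$ in $\mathbb Z^d$ such that $\|x_k\|_2\to\infty$: $$\hat\nu_{\gamma_k}\Rightarrow\delta_0\quad\text{as }k\to\infty,\quad\text{for any choice of }\gamma_k\in\mathrm{Geo}(0,x_k),$$ where $\Rightarrow$ denotes weak convergence of measures on $[0,\infty)$.
   Context: First-passage percolation on $\mathbb Z^d$, $d\ge2$: $E(\mathbb Z^d)$ is the set of undirected nearest-neighbor edges, and $(\tau_e)_{e\in E(\mathbb Z^d)}$ are i.i.d. nonnegative random variables (edge-weights) on a complete probability space $(\Omega,\mathcal F,\mathbb P)$, with distribution function $F(t)=\mathbb P(\tau_e\le t)$. $p_{\mathrm c}(\mathbb Z^d)$ is the critical probability of Bernoulli bond percolation on $\mathbb Z^d$. For $x,y\in\mathbb Z^d$, $\mathcal P(x,y)$ is the set of self-avoiding nearest-neighbor paths from $x$ to $y$ (a path is viewed as a set of edges); $T(\gamma)=\sum_{e\in\gamma}\tau_e$, $T(x,y)=\inf_{\gamma\in\mathcal P(x,y)}T(\gamma)$, and $\mathrm{Geo}(x,y)=\{\gamma\in\mathcal P(x,y): T(\gamma)=T(x,y)\}$ is the set of geodesics. $|\gamma|$ is the number of edges of $\gamma$. For a nonempty finite path $\gamma$, the empirical measure is $\hat\nu_\gamma=\frac1{|\gamma|}\sum_{e\in\gamma}\delta_{\tau_e}$. (In the cases where existence of geodesics is not known, the statement is read as conditional on their existence.) *)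

theory Defs
  imports "HOL-Probability.Probability"
begin

section \<open>The lattice and its paths\<close>

text \<open>The lattice of dimension \<open>d\<close> is the type \<open>int ^ 'd\<close> with \<open>d = CARD('d)\<close>; an undirected edge
  is the set of its two endpoints.\<close>

definition lattice_adj :: "int ^ 'd::finite \<Rightarrow> int ^ 'd \<Rightarrow> bool" where
  "lattice_adj x y \<longleftrightarrow> (\<Sum>i\<in>UNIV. \<bar>x $ i - y $ i\<bar>) = 1"

definition lattice_edges :: "(int ^ 'd::finite) set set" where
  "lattice_edges = {{x, y} | x y. lattice_adj x y}"

definition lattice_norm :: "int ^ 'd::finite \<Rightarrow> real" where
  "lattice_norm x = norm (\<chi> i. real_of_int (x $ i))"

definition path_edges :: "'v list \<Rightarrow> 'v set set" where
  "path_edges vs = {{vs ! i, vs ! Suc i} | i. Suc i < length vs}"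

definition saw :: "int ^ 'd::finite \<Rightarrow> int ^ 'd \<Rightarrow> (int ^ 'd) list \<Rightarrow> bool" where
  "saw x y vs \<longleftrightarrow> vs \<noteq> [] \<and> hd vs = x \<and> last vs = y \<and> successively lattice_adj vs \<and> distinct vs"

text \<open>A path is identified with its set of edges, so the only path from a vertex to itself
  is the empty set.\<close>

definition saw_paths :: "int ^ 'd::finite \<Rightarrow> int ^ 'd \<Rightarrow> (int ^ 'd) set set set" where
  "saw_paths x y = {path_edges vs | vs. saw x y vs}"

section \<open>Bernoulli bond percolation\<close>

definition open_cluster :: "((int ^ 'd::finite) set \<Rightarrow> bool) \<Rightarrow> (int ^ 'd) set" where
  "open_cluster \<eta> = {y. \<exists>\<gamma>\<in>saw_paths 0 y. \<forall>e\<in>\<gamma>. \<eta> e}"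

definition bond_percolation :: "real \<Rightarrow> ((int ^ 'd::finite) set \<Rightarrow> bool) measure" where
  "bond_percolation p = Pi\<^sub>M lattice_edges (\<lambda>_. measure_pmf (bernoulli_pmf p))"

definition percolation_prob :: "'d::finite itself \<Rightarrow> real \<Rightarrow> real" where
  "percolation_prob _ p =
     measure (bond_percolation p)
       {\<eta> \<in> space (bond_percolation p). infinite (open_cluster \<eta> :: (int ^ 'd) set)}"

definition critical_prob :: "'d::finite itself \<Rightarrow> real" where
  "critical_prob d = Sup {p \<in> {0..1}. percolation_prob d p = 0}"

section \<open>First-passage percolation\<close>

text \<open>Here \<open>t\<close> is a deterministic assignment of weights to the edges, to be instantiated by
  \<open>\<lambda>e. \<tau> e \<omega>\<close>.\<close>

definition path_time :: "((int ^ 'd::finite) set \<Rightarrow> real) \<Rightarrow> (int ^ 'd) set set \<Rightarrow> real" where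
  "path_time t \<gamma> = (\<Sum>e\<in>\<gamma>. t e)"

definition passage_time ::
    "((int ^ 'd::finite) set \<Rightarrow> real) \<Rightarrow> int ^ 'd \<Rightarrow> int ^ 'd \<Rightarrow> real" where
  "passage_time t x y = (INF \<gamma>\<in>saw_paths x y. path_time t \<gamma>)"

definition geodesics ::
    "((int ^ 'd::finite) set \<Rightarrow> real) \<Rightarrow> int ^ 'd \<Rightarrow> int ^ 'd \<Rightarrow> (int ^ 'd) set set set" where
  "geodesics t x y = {\<gamma> \<in> saw_paths x y. path_time t \<gamma> = passage_time t x y}"

text \<open>The empirical measure is a measure on the real line, as required by the library's notion
  of weak convergence. For nonnegative weights it is carried by the closed half-line
  \<open>{0..}\<close>, so weak convergence on the half-line and on the line agree. For an empty path it is
  the null measure.\<close>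

definition empirical_measure ::
    "((int ^ 'd::finite) set \<Rightarrow> real) \<Rightarrow> (int ^ 'd) set set \<Rightarrow> real measure" where
  "empirical_measure t \<gamma> = distr (uniform_count_measure \<gamma>) borel t"

lemma finite_path_edges: "finite (path_edges vs)"
proof -
  have "path_edges vs = (\<lambda>i. {vs ! i, vs ! Suc i}) ` {i. Suc i < length vs}"
    by (auto simp: path_edges_def)
  moreover have "finite {i. Suc i < length vs}"
    by (rule finite_subset[of _ "{..<length vs}"]) auto
  ultimately show ?thesis by simp
qed

text \<open>The empirical measure is the average of the Dirac measures at the weights of the path.\<close>

lemma measure_empirical_measure:
  assumes "finite \<gamma>" "A \<in> sets borel"
  shows "measure (empirical_measure t \<gamma>) A =
    (1 / card \<gamma>) * (\<Sum>e\<in>\<gamma>. measure (return borel (t e)) A)"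
proof -
  have "t \<in> measurable (uniform_count_measure \<gamma>) borel"
    by (simp add: measurable_def sets_uniform_count_measure space_uniform_count_measure)
  then have "measure (empirical_measure t \<gamma>) A = card (t -` A \<inter> \<gamma>) / card \<gamma>"
    using assms
    by (simp add: empirical_measure_def measure_distr space_uniform_count_measure
        measure_uniform_count_measure)
  moreover have "(\<Sum>e\<in>\<gamma>. measure (return borel (t e)) A) = card (t -` A \<inter> \<gamma>)"
  proof -
    have "(\<Sum>e\<in>\<gamma>. measure (return borel (t e)) A) = (\<Sum>e\<in>\<gamma>. indicator (t -` A) e)"
      using assms by (intro sum.cong refl) (simp add: measure_return indicator_def)
    also have "\<dots> = card (t -` A \<inter> \<gamma>)"
      using assms by (simp add: indicator_def Int_def vimage_def conj_commute)
    finally show ?thesis .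
  qed
  ultimately show ?thesis by simp
qed

lemma path_edges_subset_lattice_edges: "saw x y vs \<Longrightarrow> path_edges vs \<subseteq> lattice_edges"
  by (fastforce simp: saw_def path_edges_def lattice_edges_def successively_conv_nth)

text \<open>The percolation event is measurable, so \<open>percolation_prob\<close> is a genuine probability.\<close>

lemma sets_percolation_event:
  "{\<eta> \<in> space (bond_percolation p). infinite (open_cluster \<eta> :: (int ^ 'd::finite) set)}
     \<in> sets (bond_percolation p)"
proof -
  let ?M = "bond_percolation p :: ((int ^ 'd) set \<Rightarrow> bool) measure"
  have fin: "finite C \<longleftrightarrow> (\<exists>n. \<forall>y. y \<in> C \<longrightarrow> to_nat y \<le> n)" for C :: "(int ^ 'd) set"
  proof -
    have "finite C \<longleftrightarrow> finite (to_nat ` C)"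
      by (metis finite_imageI finite_imageD inj_on_subset inj_to_nat subset_UNIV)
    then show ?thesis by (auto simp: finite_nat_set_iff_bounded_le)
  qed
  have clus: "y \<in> open_cluster \<eta> \<longleftrightarrow>
      (\<exists>vs. saw 0 y vs \<and> (\<forall>e\<in>path_edges vs. \<eta> e))" for y and \<eta> :: "(int ^ 'd) set \<Rightarrow> bool"
    by (auto simp: open_cluster_def saw_paths_def)
  have comp: "Measurable.pred ?M (\<lambda>\<eta>. \<eta> e)" if "e \<in> lattice_edges" for e
  proof -
    have "measurable ?M (measure_pmf (bernoulli_pmf p)) = measurable ?M (count_space UNIV)"
      by (rule measurable_cong_sets) simp_all
    then show ?thesis
      using measurable_component_singleton[OF that, of "\<lambda>_. measure_pmf (bernoulli_pmf p)"]
      by (simp add: bond_percolation_def)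
  qed
  have "Measurable.pred ?M (\<lambda>\<eta>. saw 0 y vs \<and> (\<forall>e\<in>path_edges vs. \<eta> e))" for y vs
  proof (cases "saw 0 y vs")
    case True
    have "Measurable.pred ?M (\<lambda>\<eta>. \<forall>e\<in>path_edges vs. \<eta> e)"
      by (rule pred_intros_finite(3)[OF finite_path_edges])
        (use comp path_edges_subset_lattice_edges[OF True] in blast)
    with True show ?thesis by simp
  qed simp
  then have "Measurable.pred ?M (\<lambda>\<eta>. y \<in> open_cluster \<eta>)" for y
    unfolding clus by (rule pred_intros_countable)
  then have "Measurable.pred ?M (\<lambda>\<eta>. \<not> (\<exists>n. \<forall>y. y \<in> open_cluster \<eta> \<longrightarrow> to_nat y \<le> n))"
    by measurable
  then show ?thesis
    unfolding fin[symmetric] by (simp add: pred_def)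
qed

end

theory Submission
  imports Defs "HOL-Real_Asymp.Real_Asymp"
begin

text \<open>Call a site bad if one of its edges is heavier than a large constant \<open>K\<close>. An edge heavier than
  \<open>K\<close> can be avoided by walking along the boundary of the bad cluster surrounding it, and this
  boundary is connected because the first cohomology of the lattice mod 2 vanishes. Hence passage
  times are controlled by those for the detour weights, in which a heavy edge costs a multiple of
  the size of its bad cluster. By a Peierls argument these weights are nearly independent at a
  distance, so the passage times between blocks concentrate (Hoeffding) and have a time constant.

  Since \<open>F 0\<close> is at least the critical probability, a finite-size criterion bounds from below, at
  all scales, the probability that edges of weight 0 cross an annulus. Together with concentration
  this bounds the time constant in some direction vector of arbitrary length, so by reflection and
  homogeneity the time constant vanishes on the axes. By Borel-Cantelli the detour passage times
  are then \<open>o(n)\<close> at distance \<open>n\<close>, whereas a geodesic has at least \<open>n\<close> edges. A geodesic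
  leaves the bad clusters at its endpoints after a polylogarithmic number of steps, and in between
  it is as fast as the detours, so it has only \<open>o(n)\<close> edges heavier than any \<open>\<epsilon> > 0\<close>.\<close>

section \<open>Walks and passage times\<close>

text \<open>No moment of the weights is assumed, so a passage time may have infinite mean. For large
  \<open>K\<close> the bad clusters have exponentially thin tails, and the detour weights have
  finite means, bounded uniformly in the cut-off. When \<open>F 0\<close> equals the critical
  probability, an infinite cluster of edges of weight 0 need not exist. The substitute is that the
  crossing probability of a fixed annulus is a polynomial in the density of open edges: if it were
  too small at \<open>F 0\<close>, it would be too small at a slightly larger density as well, and
  percolation would be excluded there, against the definition of the critical probability as a
  supremum. A crossing from radius d h to radius A d h is free, and joining its ends to the points 0
  and h w costs O(h) with a constant that does not depend on A. The number of candidates w does not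
  depend on h, so at a large scale one of them is reached this fast with probability bounded below.
  As slow travel to h w is unlikely, a large time constant of w would then exceed the mean that it
  is supposed to bound from below.\<close>

definition l1 :: "int ^ 'd::finite \<Rightarrow> nat" where
  "l1 x = (\<Sum>i\<in>UNIV. nat \<bar>x $ i\<bar>)"

definition lball :: "int ^ 'd::finite \<Rightarrow> nat \<Rightarrow> (int ^ 'd) set" where
  "lball x r = {y. l1 (y - x) \<le> r}"

lemma int_l1: "int (l1 x) = (\<Sum>i\<in>UNIV. \<bar>x $ i\<bar>)"
  by (simp add: l1_def)

lemma l1_zero [simp]: "l1 0 = 0"
  by (simp add: l1_def)

lemma l1_eq_0_iff [simp]: "l1 x = 0 \<longleftrightarrow> x = 0"
  by (simp add: l1_def vec_eq_iff)

lemma l1_minus [simp]: "l1 (- x) = l1 x"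
  by (simp add: l1_def)

lemma l1_minus_commute: "l1 (x - y) = l1 (y - x)"
  by (simp add: l1_def abs_minus_commute)

lemma l1_triangle: "l1 (x + y) \<le> l1 x + l1 y"
  unfolding l1_def sum.distrib[symmetric] by (intro sum_mono) simp

lemma l1_diff_triangle: "l1 (x - z) \<le> l1 (x - y) + l1 (y - z)"
  using l1_triangle[of "x - y" "y - z"] by simp

lemma l1_scale: "l1 (c *s x) = nat \<bar>c\<bar> * l1 x"
  by (simp add: l1_def sum_distrib_left abs_mult nat_mult_distrib)

lemma l1_axis: "l1 (axis i c) = nat \<bar>c\<bar>"
  by (simp add: l1_def axis_def if_distrib[of abs] if_distrib[of nat] cong: if_cong)

lemma component_le_l1: "nat \<bar>x $ i\<bar> \<le> l1 x"
  unfolding l1_def by (rule member_le_sum) auto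

lemma abs_component_le_l1: "\<bar>x $ i\<bar> \<le> int (l1 x)"
  using component_le_l1[of x i] by linarith

lemma lattice_adj_iff_l1: "lattice_adj x y \<longleftrightarrow> l1 (x - y) = 1"
proof -
  have "(\<Sum>i\<in>UNIV. \<bar>x $ i - y $ i\<bar>) = int (l1 (x - y))" by (simp add: int_l1)
  then show ?thesis unfolding lattice_adj_def by linarith
qed

lemma lattice_adj_sym: "lattice_adj x y \<longleftrightarrow> lattice_adj y x"
  by (simp add: lattice_adj_iff_l1 l1_minus_commute)

lemma lattice_adj_irrefl [simp]: "\<not> lattice_adj x x"
  by (simp add: lattice_adj_iff_l1)

lemma l1_axis_le:
  assumes "x $ i \<noteq> 0"
  shows "l1 (x - axis i (sgn (x $ i))) = l1 x - 1" "l1 x \<ge> 1"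
proof -
  have a: "l1 y = nat \<bar>y $ i\<bar> + (\<Sum>j\<in>UNIV - {i}. nat \<bar>y $ j\<bar>)" for y :: "int ^ 'a"
    unfolding l1_def by (rule sum.remove) auto
  have "(\<Sum>j\<in>UNIV - {i}. nat \<bar>(x - axis i (sgn (x $ i))) $ j\<bar>) = (\<Sum>j\<in>UNIV - {i}. nat \<bar>x $ j\<bar>)"
    by (intro sum.cong) (auto simp: axis_def)
  moreover have "nat \<bar>(x - axis i (sgn (x $ i))) $ i\<bar> = nat \<bar>x $ i\<bar> - 1" "nat \<bar>x $ i\<bar> \<ge> 1"
    using assms by (auto simp: axis_def sgn_if)
  ultimately show "l1 (x - axis i (sgn (x $ i))) = l1 x - 1" "l1 x \<ge> 1"
    using a[of x] a[of "x - axis i (sgn (x $ i))"] by linarith+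
qed

lemma lattice_adj_iff_axis:
  "lattice_adj x y \<longleftrightarrow> (\<exists>i s. (s = 1 \<or> s = -1) \<and> y = x + axis i s)"
proof
  assume a: "lattice_adj x y"
  then have l: "l1 (y - x) = 1" by (simp add: lattice_adj_iff_l1 l1_minus_commute)
  then have "y - x \<noteq> 0" by auto
  then obtain i where i: "(y - x) $ i \<noteq> 0" by (auto simp: vec_eq_iff)
  from l1_axis_le[OF this] l have "y - x - axis i (sgn ((y - x) $ i)) = 0" by simp
  then have "y = x + axis i (sgn ((y - x) $ i))" by (simp add: algebra_simps)
  moreover have "sgn ((y - x) $ i) = 1 \<or> sgn ((y - x) $ i) = -1" using i by (simp add: sgn_if)
  ultimately show "\<exists>i s. (s = 1 \<or> s = -1) \<and> y = x + axis i s" by blast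
next
  assume "\<exists>i s. (s = 1 \<or> s = -1) \<and> y = x + axis i s"
  then show "lattice_adj x y"
    by (auto simp: lattice_adj_iff_l1 l1_minus_commute[of x] l1_axis)
qed

lemma lattice_adj_add [simp]: "lattice_adj (z + x) (z + y) \<longleftrightarrow> lattice_adj x y"
  by (simp add: lattice_adj_iff_l1)

lemma neighbours:
  "finite {y :: int ^ 'd::finite. lattice_adj x y}"
  "card {y :: int ^ 'd. lattice_adj x y} \<le> 2 * CARD('d)"
proof -
  have sub: "{y. lattice_adj x y} \<subseteq> (\<lambda>(i, s). x + axis i s) ` (UNIV \<times> {1, -1})"
    by (auto simp: lattice_adj_iff_axis)
  then show "finite {y. lattice_adj x y}" by (rule finite_subset) simp
  have "card {y. lattice_adj x y} \<le> card ((\<lambda>(i, s). x + axis i s) ` ((UNIV :: 'd set) \<times> {1, -1 :: int}))"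
    using sub by (intro card_mono) auto
  also have "\<dots> \<le> card ((UNIV :: 'd set) \<times> {1, -1 :: int})" by (rule card_image_le) simp
  finally show "card {y. lattice_adj x y} \<le> 2 * CARD('d)" by (simp add: card_cartesian_product)
qed

text \<open>The ball sits in the cube of side \<open>2 * r + 1\<close>; polynomial growth in
  \<open>r\<close> is all that the later union bounds ask for.\<close>

lemma finite_lball [simp]: "finite (lball x r)"
  and card_lball: "card (lball (x :: int ^ 'd::finite) r) \<le> (2 * r + 1) ^ CARD('d)"
proof -
  let ?B = "PiE (UNIV :: 'd set) (\<lambda>i. {x $ i - int r .. x $ i + int r})"
  have sub: "lball x r \<subseteq> vec_lambda ` ?B"
  proof
    fix y assume "y \<in> lball x r"
    then have "l1 (y - x) \<le> r" by (simp add: lball_def)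
    then have "\<bar>(y - x) $ i\<bar> \<le> int r" for i using abs_component_le_l1[of "y - x" i] by linarith
    then have "(\<lambda>i. y $ i) \<in> ?B" by (auto simp: abs_le_iff algebra_simps)
    moreover have "y = vec_lambda (\<lambda>i. y $ i)" by (simp add: vec_eq_iff)
    ultimately show "y \<in> vec_lambda ` ?B" by blast
  qed
  have finB: "finite ?B" by (intro finite_PiE) auto
  from sub finB show "finite (lball x r)" by (metis finite_imageI finite_subset)
  have "card (lball x r) \<le> card ?B"
    using sub finB by (meson card_image_le card_mono finite_imageI le_trans)
  also have "\<dots> = (\<Prod>i\<in>(UNIV :: 'd set). 2 * r + 1)" by (subst card_PiE) (auto simp: nat_add_distrib nat_mult_distrib intro!: prod.cong)
  finally show "card (lball x r) \<le> (2 * r + 1) ^ CARD('d)" by simp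
qed

lemma centre_in_lball [simp]: "x \<in> lball x r"
  by (simp add: lball_def)

lemma lball_mono: "r \<le> s \<Longrightarrow> lball x r \<subseteq> lball x s"
  by (auto simp: lball_def)

lemma lball_subset: "l1 (y - x) + r \<le> s \<Longrightarrow> lball y r \<subseteq> lball x s"
  proof
  fix z assume "l1 (y - x) + r \<le> s" "z \<in> lball y r"
  then show "z \<in> lball x s" using l1_diff_triangle[of z x y] by (auto simp: lball_def)
qed

lemma lattice_edge_iff: "{x, y} \<in> lattice_edges \<longleftrightarrow> lattice_adj x y"
  by (auto simp: lattice_edges_def doubleton_eq_iff lattice_adj_sym)

lemma lattice_edge_cases:
  assumes "e \<in> lattice_edges"
  obtains x y where "e = {x, y}" "lattice_adj x y"
  using assms by (auto simp: lattice_edges_def)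

lemma finite_lattice_edge: "e \<in> lattice_edges \<Longrightarrow> finite e \<and> card e = 2"
  by (auto elim!: lattice_edge_cases simp: card_insert_if)

section \<open>Walks and their costs\<close>

text \<open>Vertices may repeat, unlike in \<open>saw\<close>, so that walks can be concatenated
  freely. The set \<open>S\<close> confines them; confinement to a ball is what later makes passage
  times local.\<close>

definition walks :: "(int ^ 'd::finite) set \<Rightarrow> int ^ 'd \<Rightarrow> int ^ 'd \<Rightarrow> (int ^ 'd) list set" where
  "walks S x y = {vs. vs \<noteq> [] \<and> hd vs = x \<and> last vs = y \<and> successively lattice_adj vs \<and> set vs \<subseteq> S}"

text \<open>A walk that repeats an edge pays for it each time, whereas \<open>path_time\<close> sums
  over a set of edges; the two agree on walks without repeated vertices.\<close>

fun cost :: "('v set \<Rightarrow> real) \<Rightarrow> 'v list \<Rightarrow> real" where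
  "cost w (x # y # vs) = w {x, y} + cost w (y # vs)"
| "cost w _ = 0"


lemma path_edges_Nil [simp]: "path_edges [] = {}"
  and path_edges_single [simp]: "path_edges [x] = {}"
  by (auto simp: path_edges_def)

lemma path_edges_Cons [simp]: "path_edges (x # y # vs) = insert {x, y} (path_edges (y # vs))"
proof
  show "path_edges (x # y # vs) \<subseteq> insert {x, y} (path_edges (y # vs))"
  proof
    fix e assume "e \<in> path_edges (x # y # vs)"
    then obtain i where i: "Suc i < length (x # y # vs)"
      "e = {(x # y # vs) ! i, (x # y # vs) ! Suc i}" by (auto simp: path_edges_def)
    then show "e \<in> insert {x, y} (path_edges (y # vs))"
      by (cases i) (auto simp: path_edges_def)
  qed
next
  have "{x, y} \<in> path_edges (x # y # vs)"
    unfolding path_edges_def by (rule CollectI, rule exI[of _ 0]) simp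
  moreover have "path_edges (y # vs) \<subseteq> path_edges (x # y # vs)"
  proof
    fix e assume "e \<in> path_edges (y # vs)"
    then obtain i where i: "Suc i < length (y # vs)" "e = {(y # vs) ! i, (y # vs) ! Suc i}"
      by (auto simp: path_edges_def)
    then show "e \<in> path_edges (x # y # vs)"
      unfolding path_edges_def by (intro CollectI exI[of _ "Suc i"]) simp
  qed
  ultimately show "insert {x, y} (path_edges (y # vs)) \<subseteq> path_edges (x # y # vs)" by simp
qed

lemma path_edges_subset_set: "e \<in> path_edges vs \<Longrightarrow> e \<subseteq> set vs"
  by (auto simp: path_edges_def)

lemma cost_nonneg: "(\<And>e. e \<in> path_edges vs \<Longrightarrow> 0 \<le> w e) \<Longrightarrow> 0 \<le> cost w vs"
  by (induction vs rule: cost.induct[where ?a0.0 = w]) auto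

lemma cost_mono: "(\<And>e. e \<in> path_edges vs \<Longrightarrow> w e \<le> w' e) \<Longrightarrow> cost w vs \<le> cost w' vs"
  by (induction vs rule: cost.induct[where ?a0.0 = w]) (auto simp: add_mono)

lemma cost_cong: "(\<And>e. e \<in> path_edges vs \<Longrightarrow> w e = w' e) \<Longrightarrow> cost w vs = cost w' vs"
  by (intro antisym cost_mono) auto

lemma cost_le_length:
  "(\<And>e. e \<in> path_edges vs \<Longrightarrow> w e \<le> B) \<Longrightarrow> cost w vs \<le> real (length vs - 1) * B"
proof (induction vs rule: cost.induct[where ?a0.0 = w])
  case (1 w x y vs)
  have "cost w (y # vs) \<le> real (length (y # vs) - 1) * B" "w {x, y} \<le> B" using 1 by auto
  then show ?case by (simp add: algebra_simps)
qed auto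

lemma cost_append: "cost w (vs @ x # ws) = cost w (vs @ [x]) + cost w (x # ws)"
  by (induction vs rule: induct_list012) auto

lemma path_edges_append: "path_edges (vs @ x # ws) = path_edges (vs @ [x]) \<union> path_edges (x # ws)"
  by (induction vs rule: induct_list012) auto

lemma sum_path_edges_le_cost:
  "(\<And>e. e \<in> path_edges vs \<Longrightarrow> 0 \<le> w e) \<Longrightarrow> sum w (path_edges vs) \<le> cost w vs"
proof (induction vs rule: cost.induct[where ?a0.0 = w])
  case (1 w x y vs)
  have "sum w (path_edges (x # y # vs)) \<le> w {x, y} + sum w (path_edges (y # vs))"
    using 1(2)[of "{x, y}"] by (auto simp: sum.insert_if finite_path_edges)
  with 1 show ?case by fastforce
qed auto

lemma cost_distinct: "distinct vs \<Longrightarrow> cost w vs = sum w (path_edges vs)"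
proof (induction vs rule: cost.induct[where ?a0.0 = w])
  case (1 w x y vs)
  have "{x, y} \<notin> path_edges (y # vs)" using 1(2) path_edges_subset_set by fastforce
  then show ?case using 1 by (simp add: finite_path_edges)
qed auto

lemma card_path_edges_distinct: "distinct vs \<Longrightarrow> card (path_edges vs) = length vs - 1"
proof (induction vs rule: induct_list012)
  case (3 x y vs)
  have "{x, y} \<notin> path_edges (y # vs)" using 3(3) path_edges_subset_set by fastforce
  then show ?case using 3 by (simp add: finite_path_edges)
qed auto

lemma walk_path_edges: "successively lattice_adj vs \<Longrightarrow> path_edges vs \<subseteq> lattice_edges"
  by (induction vs rule: induct_list012) (auto simp: lattice_edge_iff)

lemma walks_single: "x \<in> S \<Longrightarrow> [x] \<in> walks S x x"
  by (simp add: walks_def)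

lemma walks_Cons: "vs \<in> walks S y z \<Longrightarrow> lattice_adj x y \<Longrightarrow> x \<in> S \<Longrightarrow> x # vs \<in> walks S x z"
  by (cases vs) (auto simp: walks_def)

lemma walks_mono: "S \<subseteq> S' \<Longrightarrow> walks S x y \<subseteq> walks S' x y"
  by (auto simp: walks_def)

lemma walks_join:
  assumes "vs \<in> walks S x y" "ws \<in> walks S y z"
  shows "vs @ tl ws \<in> walks S x z" "cost w (vs @ tl ws) = cost w vs + cost w ws"
    "length (vs @ tl ws) = length vs + length ws - 1"
    "path_edges (vs @ tl ws) = path_edges vs \<union> path_edges ws"
proof -
  from assms obtain vs' where vs: "vs = vs' @ [y]"
    by (auto simp: walks_def) (metis append_butlast_last_id)
  from assms obtain ws' where ws: "ws = y # ws'" by (cases ws) (auto simp: walks_def)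
  show "vs @ tl ws \<in> walks S x z"
    using assms by (auto simp: walks_def vs ws successively_append_iff successively_Cons hd_append)
  show "cost w (vs @ tl ws) = cost w vs + cost w ws"
    by (simp add: vs ws cost_append[symmetric])
  show "length (vs @ tl ws) = length vs + length ws - 1"
    by (simp add: vs ws)
  show "path_edges (vs @ tl ws) = path_edges vs \<union> path_edges ws"
    by (simp add: vs ws path_edges_append[symmetric])
qed

lemma cost_rev: "cost w (rev vs) = cost w vs"
proof (induction vs rule: induct_list012)
  case (3 x y vs)
  have "cost w (rev (x # y # vs)) = cost w (rev vs @ y # [x])" by simp
  also have "\<dots> = cost w (rev (y # vs)) + w {y, x}" by (subst cost_append) simp
  finally show ?case using 3 by (simp add: insert_commute)
qed auto

lemma walks_rev: "vs \<in> walks S x y \<Longrightarrow> rev vs \<in> walks S y x"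
  by (auto simp: walks_def hd_rev last_rev successively_rev lattice_adj_sym
      intro: successively_mono)

lemma walks_append_decomp:
  assumes "vs @ z # ws \<in> walks S x y"
  shows "vs @ [z] \<in> walks S x z" "z # ws \<in> walks S z y"
  using assms by (auto simp: walks_def successively_append_iff hd_append split: if_splits)

lemma walks_length: "vs \<in> walks S x y \<Longrightarrow> l1 (y - x) \<le> length vs - 1"
proof (induction vs arbitrary: x)
  case (Cons v vs)
  show ?case
  proof (cases vs)
    case Nil with Cons show ?thesis by (auto simp: walks_def)
  next
    case (Cons v' vs')
    then have "vs \<in> walks S v' y" "lattice_adj x v'" using Cons.prems by (auto simp: walks_def)
    with Cons.IH[of v'] l1_diff_triangle[of y x v'] Cons show ?thesis
      by (simp add: lattice_adj_iff_l1 l1_minus_commute[of x])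
  qed
qed (simp add: walks_def)

lemma exists_straight_walk:
  "\<exists>vs \<in> walks (lball x (l1 (y - x))) x y. length vs = Suc (l1 (y - x))"
proof (induction "l1 (y - x)" arbitrary: y)
  case 0
  then show ?case by (intro bexI[of _ "[x]"]) (auto simp: walks_single)
next
  case (Suc n)
  then have "y - x \<noteq> 0" by auto
  then obtain i where i: "(y - x) $ i \<noteq> 0" by (auto simp: vec_eq_iff)
  define y' where "y' = y - axis i (sgn ((y - x) $ i))"
  have e: "y' - x = (y - x) - axis i (sgn ((y - x) $ i))" by (simp add: y'_def)
  have l: "l1 (y' - x) = n" using l1_axis_le[OF i] Suc(2) unfolding e by simp
  from Suc(1)[OF l[symmetric]] obtain vs where
    vs: "vs \<in> walks (lball x (l1 (y' - x))) x y'" "length vs = Suc (l1 (y' - x))" by blast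
  have adj: "lattice_adj y' y"
    unfolding lattice_adj_iff_axis y'_def
    by (rule exI[of _ i], rule exI[of _ "sgn ((y - x) $ i)"]) (use i in \<open>auto simp: sgn_if\<close>)
  have "lball x (l1 (y' - x)) \<subseteq> lball x (l1 (y - x))" by (rule lball_mono) (use l Suc(2) in simp)
  then have "vs \<in> walks (lball x (l1 (y - x))) x y'" using vs(1) walks_mono by blast
  moreover have "[y', y] \<in> walks (lball x (l1 (y - x))) y' y"
    using adj l Suc(2) by (auto simp: walks_def lball_def)
  ultimately have "vs @ tl [y', y] \<in> walks (lball x (l1 (y - x))) x y" by (rule walks_join)
  then show ?case using vs(2) l Suc(2) by (intro bexI[of _ "vs @ [y]"]) auto
qed

lemma exists_straight_walk':
  assumes "l1 (y - x) \<le> r"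
  obtains vs where "vs \<in> walks (lball x r) x y" "length vs = Suc (l1 (y - x))"
  using exists_straight_walk[where x = x and y = y] walks_mono[OF lball_mono[OF assms]] by blast

text \<open>A step is prepended to a list without repetitions; if the new vertex already occurs, the
  list is cut back to that occurrence.\<close>

lemma rtranclp_imp_distinct_list:
  assumes "R\<^sup>*\<^sup>* x y"
  shows "\<exists>vs. vs \<noteq> [] \<and> hd vs = x \<and> last vs = y \<and> successively R vs \<and> distinct vs"
  using assms
proof (induction rule: converse_rtranclp_induct)
  case base
  show ?case by (rule exI[of _ "[y]"]) simp
next
  case (step x z)
  then obtain vs where vs: "vs \<noteq> []" "hd vs = z" "last vs = y" "successively R vs" "distinct vs"
    by blast
  show ?case
  proof (cases "x \<in> set vs")
    case True
    then obtain as bs where ab: "vs = as @ x # bs" by (auto simp: in_set_conv_decomp)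
    show ?thesis using vs by (intro exI[of _ "x # bs"]) (auto simp: ab successively_append_iff)
  next
    case False
    then show ?thesis using vs step(1)
      by (intro exI[of _ "x # vs"]) (auto simp: successively_Cons)
  qed
qed

lemma successively_imp_rtranclp:
  "vs \<noteq> [] \<Longrightarrow> successively R vs \<Longrightarrow> R\<^sup>*\<^sup>* (hd vs) (last vs)"
proof (induction vs rule: induct_list012)
  case (3 x y vs)
  then show ?case by (auto intro: converse_rtranclp_into_rtranclp)
qed auto

lemma successively_path_edges:
  "successively (\<lambda>u v. R u v \<and> {u, v} \<in> P) vs \<longleftrightarrow> successively R vs \<and> path_edges vs \<subseteq> P"
  by (induction vs rule: induct_list012) auto

text \<open>Reachability is taken along the edges of \<open>vs\<close> only, so the repetition-free
  list it yields uses no other edge. Vertices are controlled through edges, which is why the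
  edgeless case \<open>x = y\<close> is split off.\<close>

lemma loop_erasure:
  assumes "vs \<in> walks S x y"
  obtains vs' where "saw x y vs'" "path_edges vs' \<subseteq> path_edges vs" "set vs' \<subseteq> set vs"
proof (cases "x = y")
  case True
  have "x \<in> set vs" using assms by (auto simp: walks_def)
  then show ?thesis using True that[of "[x]"] by (simp add: saw_def)
next
  case False
  let ?R = "\<lambda>u v. lattice_adj u v \<and> {u, v} \<in> path_edges vs"
  have "?R\<^sup>*\<^sup>* (hd vs) (last vs)" using assms
    by (intro successively_imp_rtranclp) (auto simp: walks_def successively_path_edges)
  then obtain vs' where vs': "vs' \<noteq> []" "hd vs' = x" "last vs' = y" "distinct vs'"
      "successively ?R vs'"
    using rtranclp_imp_distinct_list[of ?R x y] assms by (auto simp: walks_def)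
  have pe: "path_edges vs' \<subseteq> path_edges vs" using vs'(5) by (simp add: successively_path_edges)
  have "set vs' \<subseteq> set vs"
  proof
    fix v assume v: "v \<in> set vs'"
    have "\<exists>e\<in>path_edges vs'. v \<in> e"
    proof -
      obtain as bs where ab: "vs' = as @ v # bs" using v by (auto simp: in_set_conv_decomp)
      show ?thesis
      proof (cases bs)
        case (Cons b bs')
        then show ?thesis using path_edges_append[of as v bs] by (simp add: ab)
      next
        case Nil
        with ab vs' False have "as \<noteq> []" by auto
        then obtain as' a where "as = as' @ [a]" by (metis append_butlast_last_id)
        then show ?thesis using path_edges_append[of as' a "[v]"] by (simp add: ab Nil)
      qed
    qed
    then show "v \<in> set vs" using pe path_edges_subset_set by blast
  qed
  then show ?thesis using vs' pe that by (simp add: saw_def successively_path_edges)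
qed

section \<open>Passage times restricted to a region\<close>

text \<open>For an empty set of walks the infimum is an unspecified real number, hence the
  nonemptiness conditions throughout.\<close>

definition ptime :: "(int ^ 'd::finite) set \<Rightarrow> ((int ^ 'd) set \<Rightarrow> real) \<Rightarrow> int ^ 'd \<Rightarrow> int ^ 'd \<Rightarrow> real" where
  "ptime S w x y = (INF vs\<in>walks S x y. cost w vs)"

definition nonneg_weight :: "((int ^ 'd::finite) set \<Rightarrow> real) \<Rightarrow> bool" where
  "nonneg_weight w \<longleftrightarrow> (\<forall>e\<in>lattice_edges. 0 \<le> w e)"

lemma walk_cost_nonneg:
  "nonneg_weight w \<Longrightarrow> vs \<in> walks S x y \<Longrightarrow> 0 \<le> cost w vs"
  using walk_path_edges by (intro cost_nonneg) (auto simp: nonneg_weight_def walks_def)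

lemma bdd_below_costs: "nonneg_weight w \<Longrightarrow> bdd_below (cost w ` walks S x y)"
  by (intro bdd_belowI[of _ 0]) (auto intro: walk_cost_nonneg)

lemma ptime_le: "nonneg_weight w \<Longrightarrow> vs \<in> walks S x y \<Longrightarrow> ptime S w x y \<le> cost w vs"
  unfolding ptime_def by (rule cINF_lower) (auto intro: bdd_below_costs)

lemma ptime_greatest:
  "walks S x y \<noteq> {} \<Longrightarrow> (\<And>vs. vs \<in> walks S x y \<Longrightarrow> c \<le> cost w vs) \<Longrightarrow> c \<le> ptime S w x y"
  unfolding ptime_def by (rule cINF_greatest)

lemma ptime_nonneg: "nonneg_weight w \<Longrightarrow> walks S x y \<noteq> {} \<Longrightarrow> 0 \<le> ptime S w x y"
  by (rule ptime_greatest) (auto intro: walk_cost_nonneg)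

lemma ptime_less_iff:
  "nonneg_weight w \<Longrightarrow> walks S x y \<noteq> {} \<Longrightarrow>
   ptime S w x y < c \<longleftrightarrow> (\<exists>vs\<in>walks S x y. cost w vs < c)"
  unfolding ptime_def by (rule cINF_less_iff) (auto intro: bdd_below_costs)

lemma ptime_triangle:
  assumes w: "nonneg_weight w" and S: "S1 \<subseteq> S" "S2 \<subseteq> S"
    and ne: "walks S1 x y \<noteq> {}" "walks S2 y z \<noteq> {}"
  shows "ptime S w x z \<le> ptime S1 w x y + ptime S2 w y z"
proof (rule field_le_epsilon)
  fix e :: real assume e: "e > 0"
  obtain vs where vs: "vs \<in> walks S1 x y" "cost w vs < ptime S1 w x y + e / 2"
    using ptime_less_iff[OF w ne(1), of "ptime S1 w x y + e / 2"] e by auto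
  obtain ws where ws: "ws \<in> walks S2 y z" "cost w ws < ptime S2 w y z + e / 2"
    using ptime_less_iff[OF w ne(2), of "ptime S2 w y z + e / 2"] e by auto
  have "vs \<in> walks S x y" "ws \<in> walks S y z" using vs ws walks_mono S by blast+
  from walks_join[OF this] ptime_le[OF w, of "vs @ tl ws" S x z]
  have "ptime S w x z \<le> cost w vs + cost w ws" by metis
  then show "ptime S w x z \<le> ptime S1 w x y + ptime S2 w y z + e" using vs ws by linarith
qed

lemma ptime_mono:
  assumes w: "nonneg_weight w" and "walks S x y \<noteq> {}"
    and "\<And>e. e \<in> lattice_edges \<Longrightarrow> e \<subseteq> S \<Longrightarrow> w e \<le> w' e" and S: "S \<subseteq> S'"
  shows "ptime S' w x y \<le> ptime S w' x y"
proof (rule ptime_greatest[OF assms(2)])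
  fix vs assume vs: "vs \<in> walks S x y"
  then have "ptime S' w x y \<le> cost w vs" using walks_mono[OF S] by (intro ptime_le[OF w]) auto
  also have "\<dots> \<le> cost w' vs"
    using vs walk_path_edges path_edges_subset_set
    by (intro cost_mono assms(3)) (fastforce simp: walks_def)+
  finally show "ptime S' w x y \<le> cost w' vs" .
qed

lemma ptime_sym: "ptime S w x y = ptime S w y x"
proof -
  have sub: "cost w ` walks S x y \<subseteq> cost w ` walks S y x" for x y
  proof
    fix c assume "c \<in> cost w ` walks S x y"
    then obtain vs where "vs \<in> walks S x y" "c = cost w vs" by auto
    then show "c \<in> cost w ` walks S y x" using walks_rev by (intro image_eqI[of _ _ "rev vs"]) (auto simp: cost_rev)
  qed
  show ?thesis unfolding ptime_def using sub[of x y] sub[of y x] by (metis subset_antisym)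
qed

lemma ptime_local:
  assumes "\<And>e. e \<in> lattice_edges \<Longrightarrow> e \<subseteq> S \<Longrightarrow> w e = w' e"
  shows "ptime S w x y = ptime S w' x y"
  unfolding ptime_def
proof (intro INF_cong refl cost_cong)
  fix vs e assume "vs \<in> walks S x y" "e \<in> path_edges vs"
  then have "e \<in> lattice_edges" "e \<subseteq> S"
    using walk_path_edges[of vs] path_edges_subset_set[of e vs] by (auto simp: walks_def)
  then show "w e = w' e" by (rule assms)
qed

section \<open>Connectedness of edge boundaries\<close>

definition conn :: "(int ^ 'd::finite) set \<Rightarrow> int ^ 'd \<Rightarrow> int ^ 'd \<Rightarrow> bool" where
  "conn S = (\<lambda>u v. lattice_adj u v \<and> u \<in> S \<and> v \<in> S)\<^sup>*\<^sup>*"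

lemma conn_refl [simp]: "conn S x x"
  by (simp add: conn_def)

lemma conn_step: "lattice_adj x y \<Longrightarrow> x \<in> S \<Longrightarrow> y \<in> S \<Longrightarrow> conn S x y"
  by (auto simp: conn_def)

lemma conn_trans: "conn S x y \<Longrightarrow> conn S y z \<Longrightarrow> conn S x z"
  by (auto simp: conn_def)

lemma conn_sym: "conn S x y \<Longrightarrow> conn S y x"
  unfolding conn_def
proof (induction rule: rtranclp_induct)
  case (step y z)
  then show ?case by (intro converse_rtranclp_into_rtranclp[of _ z y x]) (auto simp: lattice_adj_sym)
qed simp

lemma conn_mono: "conn S x y \<Longrightarrow> S \<subseteq> S' \<Longrightarrow> conn S' x y"
  unfolding conn_def by (erule rtranclp_mono[THEN predicate2D, rotated]) auto

lemma conn_in: "conn S x y \<Longrightarrow> x = y \<or> x \<in> S \<and> y \<in> S"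
  unfolding conn_def by (induction rule: rtranclp_induct) auto

lemma conn_walk:
  assumes "vs \<in> walks S x y"
  shows "conn S x y"
proof -
  have "successively (\<lambda>u v. lattice_adj u v \<and> u \<in> S \<and> v \<in> S) vs"
    using assms by (auto simp: walks_def intro: successively_mono)
  then show ?thesis
    using assms successively_imp_rtranclp[of vs] by (auto simp: walks_def conn_def)
qed

lemma conn_imp_saw:
  assumes "conn S x y" "x \<in> S"
  obtains vs where "vs \<in> walks S x y" "distinct vs"
proof -
  obtain vs where vs: "vs \<noteq> []" "hd vs = x" "last vs = y" "distinct vs"
      "successively (\<lambda>u v. lattice_adj u v \<and> u \<in> S \<and> v \<in> S) vs"
    using rtranclp_imp_distinct_list[OF assms(1)[unfolded conn_def]] by blast
  have "set vs \<subseteq> S" using vs(1,2,5) assms(2)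
    by (induction vs arbitrary: x rule: induct_list012) auto
  moreover have "successively lattice_adj vs" using vs(5) by (rule successively_mono) auto
  ultimately show ?thesis using vs that by (auto simp: walks_def)
qed

lemma conn_lball: "y \<in> lball x r \<Longrightarrow> conn (lball x r) x y"
  by (metis conn_walk exists_straight_walk' lball_def mem_Collect_eq)

lemma conn_UNIV: "conn UNIV x y"
  using conn_mono[OF conn_lball[of y x "l1 (y - x)"]] by (simp add: lball_def)

lemma walks_UNIV_nonempty [simp]: "walks UNIV x y \<noteq> {}"
  using conn_imp_saw[OF conn_UNIV[of x y]] by blast

text \<open>The first cohomology of the lattice with coefficients mod 2 vanishes: a mod 2 function on the
  edges whose sum over every unit square is zero is a coboundary. The function is given by its
  value \<open>f i x\<close> on the edge from \<open>x\<close> in direction \<open>i\<close>.\<close>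

lemma int_parity_primitive: "\<exists>S :: int \<Rightarrow> bool. \<not> S 0 \<and> (\<forall>n. S (n + 1) = (S n \<noteq> g n))"
proof -
  define P where "P n = {k. 0 \<le> k \<and> k < n \<and> g k}" for n :: int
  define Q where "Q n = {k. n \<le> k \<and> k < 0 \<and> g k}" for n :: int
  have fin: "finite (P n)" "finite (Q n)" for n
    by (rule finite_subset[of _ "{0..n}"], auto simp: P_def)
       (rule finite_subset[of _ "{n..0}"], auto simp: Q_def)
  \<comment> \<open>At most one of \<open>P n\<close> and \<open>Q n\<close> is nonempty:
    \<open>g\<close> is summed mod 2 between 0 and \<open>n\<close>, in whichever direction
    applies.\<close>
  let ?S = "\<lambda>n. odd (card (P n) + card (Q n))"
  have "?S (n + 1) = (?S n \<noteq> g n)" for n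
  proof (cases "n \<ge> 0")
    case True
    then have "P (n + 1) = (if g n then insert n (P n) else P n)" "Q n = {}" "Q (n + 1) = {}"
      by (auto simp: P_def Q_def order.order_iff_strict)
    moreover have "n \<notin> P n" by (simp add: P_def)
    ultimately show ?thesis using fin by simp
  next
    case False
    then have "Q n = (if g n then insert n (Q (n + 1)) else Q (n + 1))" "P n = {}" "P (n + 1) = {}"
      by (auto simp: P_def Q_def order.order_iff_strict)
    moreover have "n \<notin> Q (n + 1)" by (simp add: Q_def)
    ultimately show ?thesis using fin by simp
  qed
  moreover have "\<not> ?S 0" by (simp add: P_def Q_def)
  ultimately show ?thesis by (intro exI[of _ ?S]) simp
qed

text \<open>Directions are added one at a time. For a new direction \<open>j\<close>, the potential
  found so far is kept on the hyperplane where coordinate \<open>j\<close> vanishes and extended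
  along each \<open>j\<close>-line by summing \<open>f j\<close>; the square condition carries the
  old directions from the hyperplane to all heights.\<close>

lemma lattice_coboundary:
  fixes f :: "'d::finite \<Rightarrow> int ^ 'd \<Rightarrow> bool"
  assumes sq: "\<And>x i j. i \<noteq> j \<Longrightarrow> (f i x \<noteq> f j (x + axis i 1)) = (f j x \<noteq> f i (x + axis j 1))"
  shows "\<exists>\<psi>. \<forall>x i. \<psi> (x + axis i 1) = (\<psi> x \<noteq> f i x)"
proof -
  have "\<exists>\<psi>. \<forall>x. \<forall>i\<in>I. \<psi> (x + axis i 1) = (\<psi> x \<noteq> f i x)" if "finite I" for I
    using that
  proof induction
    case (insert j I)
    then obtain \<psi> where \<psi>: "\<And>x i. i \<in> I \<Longrightarrow> \<psi> (x + axis i 1) = (\<psi> x \<noteq> f i x)" by blast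
    have "\<exists>S :: int \<Rightarrow> bool. \<not> S 0 \<and> (\<forall>n. S (n + 1) = (S n \<noteq> f j (y + axis j n)))" for y
      by (rule int_parity_primitive)
    then obtain S where S0: "\<And>y. \<not> S y (0 :: int)"
      and S: "\<And>y n. S y (n + 1) = (S y n \<noteq> f j (y + axis j n))" by metis
    define base where "base x = x - axis j (x $ j)" for x :: "int ^ 'd"
    define \<psi>' where "\<psi>' x = (\<psi> (base x) \<noteq> S (base x) (x $ j))" for x
    have ax: "axis j (n + 1) = axis j n + axis j 1" for n :: int
      by (simp add: vec_eq_iff axis_def)
    have "\<psi>' (x + axis i 1) = (\<psi>' x \<noteq> f i x)" if "i \<in> insert j I" for x i
    proof (cases "i = j")
      case True
      have "base (x + axis j 1) = base x" by (simp add: base_def vec_eq_iff axis_def)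
      moreover have "base x + axis j (x $ j) = x" by (simp add: base_def)
      ultimately show ?thesis using S[of "base x" "x $ j"] True by (auto simp: \<psi>'_def)
    next
      case False
      then have i: "i \<in> I" using that by simp
      \<comment> \<open>\<open>P n\<close> is the required identity in the old direction
        \<open>i\<close> at height \<open>n\<close> above the hyperplane; the square spanned by
        \<open>i\<close> and \<open>j\<close> gives \<open>P (n + 1) = P n\<close>.\<close>
      define P where "P n \<longleftrightarrow> (\<psi> (base x + axis i 1) \<noteq> S (base x + axis i 1) n) =
        ((\<psi> (base x) \<noteq> S (base x) n) \<noteq> f i (base x + axis j n))" for n
      have step: "P (n + 1) = P n" for n
        using sq[OF False, of "base x + axis j n"] S[of "base x" n] S[of "base x + axis i 1" n]
        unfolding P_def ax by (auto simp: add_ac)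
      have "P n" for n :: int
      proof (induction n rule: int_induct[where k = 0])
        case base
        have ax0: "base x + axis j 0 = base x" by (simp add: vec_eq_iff axis_def)
        show ?case unfolding P_def ax0 using \<psi>[OF i] S0 by simp
      next
        case (step2 n)
        then show ?case using step[of "n - 1"] by simp
      qed (simp add: step)
      moreover have "base (x + axis i 1) = base x + axis i 1" "(x + axis i 1) $ j = x $ j"
        using False by (simp_all add: base_def axis_def vec_eq_iff)
      moreover have "base x + axis j (x $ j) = x" by (simp add: base_def)
      ultimately show ?thesis by (metis P_def \<psi>'_def)
    qed
    then show ?case by blast
  qed simp
  from this[of UNIV] show ?thesis by simp
qed

section \<open>Edge boundaries and the unit squares that link them\<close>

definition unit_square :: "int ^ 'd::finite \<Rightarrow> 'd \<Rightarrow> 'd \<Rightarrow> (int ^ 'd) set" where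
  "unit_square x i j = {x, x + axis i 1, x + axis j 1, x + axis i 1 + axis j 1}"

lemma unit_square_dist:
  assumes "u \<in> unit_square x i j" "v \<in> unit_square x i j"
  shows "l1 (v - u) \<le> 2"
proof -
  have "l1 (axis i 1 :: int ^ 'a) = 1" for i by (simp add: l1_axis)
  then have *: "l1 (axis i 1 + axis j 1 :: int ^ 'a) \<le> 2" "l1 (axis i 1 - axis j 1 :: int ^ 'a) \<le> 2"
     for i j
    using l1_triangle[of "axis i 1 :: int ^ 'a" "axis j 1"]
      l1_triangle[of "axis i 1 :: int ^ 'a" "- axis j 1"] by auto
  have **: "l1 (- axis i 1 - axis j 1 :: int ^ 'a) \<le> 2" for i j
    using *(1)[of i j] l1_minus[of "axis i 1 + axis j 1 :: int ^ 'a"] by simp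
  show ?thesis
    using assms *(1)[of i j] *(2)[of i j] *(2)[of j i] **[of i j]
    by (auto simp: unit_square_def l1_axis algebra_simps)
qed

text \<open>Pairs are oriented with the endpoint outside \<open>D\<close> first. For the sets
  \<open>D\<close> used below, exteriors of bad clusters, that endpoint is bad and the other one
  good.\<close>

definition edge_boundary :: "(int ^ 'd::finite) set \<Rightarrow> ((int ^ 'd) \<times> (int ^ 'd)) set" where
  "edge_boundary D = {(a, b). lattice_adj a b \<and> a \<notin> D \<and> b \<in> D}"

definition square_adj :: "(int ^ 'd::finite) set \<Rightarrow> (int ^ 'd) \<times> (int ^ 'd) \<Rightarrow> (int ^ 'd) \<times> (int ^ 'd) \<Rightarrow> bool" where
  "square_adj D p q \<longleftrightarrow> p \<in> edge_boundary D \<and> q \<in> edge_boundary D \<and>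
     (\<exists>x i j. i \<noteq> j \<and> {fst p, snd p, fst q, snd q} \<subseteq> unit_square x i j)"

text \<open>The boundary edges that can be reached from \<open>p\<close> form a mod 2 cocycle: a
  unit square has an even number of boundary edges of \<open>D\<close>, and either all or none of
  them are reached. So they are the coboundary of some \<psi>, which is constant on the connected
  sets \<open>D\<close> and \<open>- D\<close> because no edge inside either is reached. As \<psi>
  changes across \<open>p\<close>, it changes across every boundary edge.\<close>

lemma edge_boundary_connected:
  fixes D :: "(int ^ 'd::finite) set"
  assumes D: "\<And>u v. u \<in> D \<Longrightarrow> v \<in> D \<Longrightarrow> conn D u v"
    and D': "\<And>u v. u \<notin> D \<Longrightarrow> v \<notin> D \<Longrightarrow> conn (- D) u v"
    and pq: "p \<in> edge_boundary D" "q \<in> edge_boundary D"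
  shows "(square_adj D)\<^sup>*\<^sup>* p q"
proof -
  \<comment> \<open>The edges reached from \<open>p\<close>, with orientation forgotten so that
    \<open>f\<close> can be read off along the coordinate directions.\<close>
  define cut where "cut u v \<longleftrightarrow> (\<exists>a b. (square_adj D)\<^sup>*\<^sup>* p (a, b) \<and> {a, b} = {u, v})" for u v
  have bd: "r \<in> edge_boundary D" if "(square_adj D)\<^sup>*\<^sup>* p r" for r
    using that pq(1) by (cases rule: rtranclp.cases) (auto simp: square_adj_def)
  have cut_sym: "cut u v \<longleftrightarrow> cut v u" for u v by (auto simp: cut_def insert_commute)
  have cutD: "(u \<in> D) \<noteq> (v \<in> D)" if "cut u v" for u v
    using that bd by (fastforce simp: cut_def edge_boundary_def doubleton_eq_iff)
  have cut_square: "cut u' v'"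
    if c: "cut u v" and ij: "i \<noteq> j" and sq: "{u, v, u', v'} \<subseteq> unit_square x i j"
      and e: "lattice_adj u' v'" "(u' \<in> D) \<noteq> (v' \<in> D)" for u v u' v' x i j
  proof -
    obtain a b where ab: "(square_adj D)\<^sup>*\<^sup>* p (a, b)" "{a, b} = {u, v}" using c by (auto simp: cut_def)
    obtain a' b' where ab': "(a', b') \<in> edge_boundary D" "{a', b'} = {u', v'}"
    proof (cases "u' \<in> D")
      case True
      then show ?thesis using e that[of v' u'] lattice_adj_sym[of u' v']
        by (auto simp: edge_boundary_def insert_commute)
    next
      case False
      then show ?thesis using e that[of u' v'] by (auto simp: edge_boundary_def)
    qed
    have "{a, b, a', b'} \<subseteq> unit_square x i j" using ab(2) ab'(2) sq by blast
    then have "square_adj D (a, b) (a', b')"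
      using bd[OF ab(1)] ab'(1) ij unfolding square_adj_def by auto
    then show ?thesis using ab ab' unfolding cut_def by (meson rtranclp.rtrancl_into_rtrancl)
  qed
  define f where "f i x = cut x (x + axis i 1)" for i x
  have adj1: "lattice_adj y (y + axis i 1)" for y :: "int ^ 'd" and i
    by (auto simp: lattice_adj_iff_axis)
  have closed: "(f i x \<noteq> f j (x + axis i 1)) = (f j x \<noteq> f i (x + axis j 1))" if ij: "i \<noteq> j" for x i j
  proof -
    let ?a = "x" and ?b = "x + axis i 1" and ?c = "x + axis j 1" and ?d = "x + axis i 1 + axis j 1"
    have sq: "{?a, ?b, ?c, ?d} \<subseteq> unit_square x i j" by (simp add: unit_square_def)
    have adj: "lattice_adj ?a ?b" "lattice_adj ?a ?c" "lattice_adj ?b ?d" "lattice_adj ?c ?d"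
      using adj1[of ?c i] by (auto simp: adj1 add_ac)
    \<comment> \<open>Once one edge of this square is reached, the reached edges of the square are
      exactly its boundary edges, and the indicator of \<open>D\<close> is their potential.\<close>
    have all: "cut u' v' \<longleftrightarrow> (u' \<in> D) \<noteq> (v' \<in> D)"
      if "cut u v" "{u, v, u', v'} \<subseteq> {?a, ?b, ?c, ?d}" "lattice_adj u' v'" for u v u' v'
      using cut_square[OF that(1) ij order_trans[OF that(2) sq] that(3)] cutD[of u' v'] by blast
    have "(cut ?a ?b \<noteq> cut ?b ?d) = (cut ?a ?c \<noteq> cut ?c ?d)"
    proof (cases "cut ?a ?b \<or> cut ?b ?d \<or> cut ?a ?c \<or> cut ?c ?d")
      case True
      then obtain u v where uv: "cut u v" "{u, v} \<subseteq> {?a, ?b, ?c, ?d}" by blast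
      have "cut u' v' \<longleftrightarrow> (u' \<in> D) \<noteq> (v' \<in> D)"
        if "{u', v'} \<subseteq> {?a, ?b, ?c, ?d}" "lattice_adj u' v'" for u' v'
        by (rule all[OF uv(1)]) (use uv(2) that in auto)
      then have "cut ?a ?b \<longleftrightarrow> (?a \<in> D) \<noteq> (?b \<in> D)" "cut ?b ?d \<longleftrightarrow> (?b \<in> D) \<noteq> (?d \<in> D)"
        "cut ?a ?c \<longleftrightarrow> (?a \<in> D) \<noteq> (?c \<in> D)" "cut ?c ?d \<longleftrightarrow> (?c \<in> D) \<noteq> (?d \<in> D)"
        using adj by auto
      then show ?thesis by blast
    qed auto
    then show ?thesis by (simp add: f_def add_ac)
  qed
  have "\<exists>\<psi>. \<forall>x i. \<psi> (x + axis i 1) = (\<psi> x \<noteq> f i x)"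
    by (rule lattice_coboundary) (rule closed)
  then obtain \<psi> where "\<forall>x i. \<psi> (x + axis i 1) = (\<psi> x \<noteq> f i x)" ..
  then have \<psi>: "\<And>x i. \<psi> (x + axis i 1) = (\<psi> x \<noteq> f i x)" by simp
  have \<psi>_edge: "\<psi> u \<noteq> \<psi> v \<longleftrightarrow> cut u v" if uv: "lattice_adj u v" for u v
  proof -
    obtain i s where "(s = 1 \<or> s = -1) \<and> v = u + axis i s"
      using uv[unfolded lattice_adj_iff_axis] by (elim exE)
    then have s: "s = 1 \<or> s = -1" "v = u + axis i s" by simp_all
    from s(1) show ?thesis
    proof
      assume "s = 1"
      then show ?thesis using \<psi>[of u i] s(2) by (auto simp: f_def)
    next
      assume "s = -1"
      then have "u = v + axis i 1" using s(2) by (simp add: vec_eq_iff axis_def)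
      then show ?thesis using \<psi>[of v i] cut_sym[of u v] by (auto simp: f_def)
    qed
  qed
  have const: "\<psi> u = \<psi> v" if "conn S u v" "S = D \<or> S = - D" for u v S
    using that(1) unfolding conn_def
  proof (induction rule: rtranclp_induct)
    case (step y z)
    then show ?case using \<psi>_edge[of y z] cutD[of y z] that(2) by auto
  qed simp
  obtain a b where p: "p = (a, b)" by fastforce
  obtain a' b' where q: "q = (a', b')" by fastforce
  have ab: "lattice_adj a b" "a \<notin> D" "b \<in> D" "lattice_adj a' b'" "a' \<notin> D" "b' \<in> D"
    using pq by (auto simp: p q edge_boundary_def)
  have "cut a b" unfolding cut_def p by blast
  then have "\<psi> a \<noteq> \<psi> b" using \<psi>_edge ab by blast
  moreover have "\<psi> a = \<psi> a'" "\<psi> b = \<psi> b'" using const[OF D] const[OF D'] ab by blast+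
  ultimately have "cut a' b'" using \<psi>_edge[OF ab(4)] by blast
  then obtain a'' b'' where ab'': "(square_adj D)\<^sup>*\<^sup>* p (a'', b'')" "{a'', b''} = {a', b'}"
    by (auto simp: cut_def)
  have "(a'', b'') = (a', b')" using bd[OF ab''(1)] ab''(2) ab by (auto simp: edge_boundary_def doubleton_eq_iff)
  then show ?thesis using ab''(1) by (simp add: q)
qed

section \<open>The part of a complement that is connected to a far point\<close>

text \<open>With \<open>z\<close> far away this is the exterior of \<open>C\<close>: its complement
  is \<open>C\<close> with the holes filled in. It is empty when \<open>z\<close> lies in
  \<open>C\<close>.\<close>

definition co_comp :: "(int ^ 'd::finite) set \<Rightarrow> int ^ 'd \<Rightarrow> (int ^ 'd) set" where
  "co_comp C z = {y. y \<notin> C \<and> conn (- C) z y}"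

lemma co_comp_disjoint: "y \<in> co_comp C z \<Longrightarrow> y \<notin> C"
  by (simp add: co_comp_def)

lemma co_comp_adj: "y \<in> co_comp C z \<Longrightarrow> lattice_adj y x \<Longrightarrow> x \<notin> C \<Longrightarrow> x \<in> co_comp C z"
  using conn_trans[OF _ conn_step[of y x "- C"], of z] by (auto simp: co_comp_def)

lemma co_comp_closed: "y \<in> co_comp C z \<Longrightarrow> conn (- C) y x \<Longrightarrow> x \<in> co_comp C z"
  using conn_in[of "- C" y x] conn_trans[of "- C" z y x] by (auto simp: co_comp_def)

lemma conn_into_subset:
  assumes "conn S x y" "\<And>u v. lattice_adj u v \<Longrightarrow> u \<in> T \<Longrightarrow> v \<in> S \<Longrightarrow> v \<in> T" "x \<in> T"
  shows "conn T x y \<and> y \<in> T"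
  using assms(1) unfolding conn_def
proof (induction rule: rtranclp_induct)
  case (step y z)
  then have "z \<in> T" using assms(2)[of y z] by auto
  with step show ?case by (auto intro: rtranclp.rtrancl_into_rtrancl)
qed (simp add: assms(3))

lemma co_comp_conn:
  assumes "u \<in> co_comp C z" "v \<in> co_comp C z" "z \<notin> C"
  shows "conn (co_comp C z) u v"
proof -
  have *: "conn (co_comp C z) z y" if y: "y \<in> co_comp C z" for y
  proof -
    have "conn (- C) z y" using y by (simp add: co_comp_def)
    moreover have "v \<in> co_comp C z" if "lattice_adj u v" "u \<in> co_comp C z" "v \<in> - C" for u v
      by (rule co_comp_adj[OF that(2,1)]) (use that(3) in simp)
    moreover have "z \<in> co_comp C z" using assms(3) by (simp add: co_comp_def)
    ultimately show ?thesis by (rule conjunct1[OF conn_into_subset])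
  qed
  show ?thesis by (rule conn_trans[OF conn_sym[OF *[OF assms(1)]] *[OF assms(2)]])
qed

text \<open>A path that starts off the exterior and ends in \<open>C\<close> cannot enter the
  exterior before it has met \<open>C\<close>, since two adjacent points off \<open>C\<close> are
  both exterior or both not; and \<open>C\<close> itself is connected.\<close>

lemma co_comp_compl_conn:
  assumes C: "\<And>u v. u \<in> C \<Longrightarrow> v \<in> C \<Longrightarrow> conn C u v" "C \<noteq> {}"
    and uv: "u \<notin> co_comp C z" "v \<notin> co_comp C z"
  shows "conn (- co_comp C z) u v"
proof -
  obtain c where c: "c \<in> C" using C(2) by blast
  have sub: "C \<subseteq> - co_comp C z" by (auto simp: co_comp_def)
  have "a \<notin> co_comp C z \<longrightarrow> conn (- co_comp C z) a c" for a
    using conn_UNIV[of a c] unfolding conn_def[of UNIV]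
  proof (induction rule: converse_rtranclp_induct)
    case (step a a')
    show ?case
    proof
      assume a: "a \<notin> co_comp C z"
      show "conn (- co_comp C z) a c"
      proof (cases "a \<in> C")
        case True
        then show ?thesis using C(1)[OF True c] conn_mono sub by blast
      next
        case False
        then have "a' \<notin> co_comp C z" using a step(1) co_comp_adj[of a' C z a] lattice_adj_sym by blast
        then have "conn (- co_comp C z) a a'" "conn (- co_comp C z) a' c"
          using step a by (auto intro: conn_step)
        then show ?thesis by (rule conn_trans)
      qed
    qed
  qed simp
  then have *: "conn (- co_comp C z) a c" if "a \<notin> co_comp C z" for a using that by blast
  show ?thesis by (rule conn_trans[OF *[OF uv(1)] conn_sym[OF *[OF uv(2)]]])
qed

section \<open>Detours around clusters of bad sites\<close>

lemma successively_invariant: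
  assumes "successively R vs" "Q (hd vs)" "\<And>u v. R u v \<Longrightarrow> Q v"
  shows "\<forall>v\<in>set vs. Q v"
  using assms(1,2)
proof (induction vs rule: induct_list012)
  case (3 x y vs)
  have "R x y" "successively R (y # vs)" "Q x" using 3(3,4) by simp_all
  then show ?case using 3(2) assms(3)[of x y] by simp
qed simp_all

definition bad_sites :: "real \<Rightarrow> ((int ^ 'd::finite) set \<Rightarrow> real) \<Rightarrow> (int ^ 'd) set" where
  "bad_sites K t = {v. \<exists>e\<in>lattice_edges. v \<in> e \<and> K < t e}"

definition cluster :: "(int ^ 'd::finite) set \<Rightarrow> int ^ 'd \<Rightarrow> (int ^ 'd) set" where
  "cluster B v = {y. v \<in> B \<and> conn B v y}"

lemma cluster_subset: "cluster B v \<subseteq> B"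
  using conn_in by (fastforce simp: cluster_def)

lemma cluster_self: "v \<in> B \<Longrightarrow> v \<in> cluster B v"
  by (simp add: cluster_def)

lemma cluster_adj:
  assumes "y \<in> cluster B v" "lattice_adj y x" "x \<in> B"
  shows "x \<in> cluster B v"
proof -
  have "conn B v y" "v \<in> B" "y \<in> B" using assms(1) cluster_subset[of B v] by (auto simp: cluster_def)
  then show ?thesis using conn_trans[OF _ conn_step[OF assms(2)]] assms(3) by (simp add: cluster_def)
qed

lemma cluster_eq:
  assumes "y \<in> cluster B v"
  shows "cluster B y = cluster B v"
proof -
  have y: "conn B v y" "v \<in> B" "y \<in> B" using assms cluster_subset[of B v] by (auto simp: cluster_def)
  have "conn B y x \<longleftrightarrow> conn B v x" for x
    using conn_trans[OF y(1)] conn_trans[OF conn_sym[OF y(1)]] by (rule iffI)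
  then show ?thesis using y by (simp add: cluster_def)
qed

lemma cluster_conn:
  assumes "u \<in> cluster B w" "v \<in> cluster B w"
  shows "conn (cluster B w) u v"
proof -
  have *: "conn B w u" "conn B w v" using assms by (auto simp: cluster_def)
  have "conn B u v" by (rule conn_trans[OF conn_sym[OF *(1)] *(2)])
  then show ?thesis using conn_into_subset[of B u v "cluster B w"] assms(1) cluster_adj[of _ B w] by simp
qed

text \<open>A neighbour of the exterior that is not exterior must belong to the cluster. The
  exterior end is good, since a bad neighbour of the cluster would belong to it; detours therefore
  follow these exterior ends.\<close>

lemma boundary_co_comp:
  assumes "(a, b) \<in> edge_boundary (co_comp (cluster B p) z)"
  shows "a \<in> cluster B p" "b \<in> co_comp (cluster B p) z" "b \<notin> B" "lattice_adj a b"
proof -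
  show b: "b \<in> co_comp (cluster B p) z" and adj: "lattice_adj a b"
    using assms by (auto simp: edge_boundary_def)
  show a: "a \<in> cluster B p"
    using assms co_comp_adj[of b "cluster B p" z a] lattice_adj_sym by (auto simp: edge_boundary_def)
  show "b \<notin> B" using cluster_adj[OF a adj] b co_comp_disjoint by blast
qed

text \<open>Distinct clusters are disjoint and \<open>a\<close> touches \<open>b\<close>, so if
  \<open>b\<close> is hidden behind cluster \<open>q\<close>, then so is all of cluster
  \<open>p\<close>. The exterior of \<open>q\<close> thus avoids cluster \<open>p\<close> and stays
  connected to \<open>z\<close> off it.\<close>

lemma co_comp_nested:
  assumes ab: "(a, b) \<in> edge_boundary (co_comp (cluster B p) z)"
    and z: "z \<notin> cluster B q" and b: "b \<notin> co_comp (cluster B q) z"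
  shows "co_comp (cluster B q) z \<subseteq> co_comp (cluster B p) z"
proof (cases "cluster B p = cluster B q")
  case False
  note ab = boundary_co_comp[OF ab]
  have disj: "cluster B p \<inter> cluster B q = {}" using False cluster_eq by blast
  have bq: "b \<notin> cluster B q" using ab(3) cluster_subset by blast
  have "c \<notin> co_comp (cluster B q) z" if c: "c \<in> cluster B p" for c
  proof
    assume cc: "c \<in> co_comp (cluster B q) z"
    have "conn (- cluster B q) c a"
      using cluster_conn[OF c ab(1)] by (rule conn_mono) (use disj in auto)
    moreover have "conn (- cluster B q) a b" using ab bq disj by (intro conn_step) auto
    ultimately have "conn (- cluster B q) c b" by (rule conn_trans)
    then show False using co_comp_closed[OF cc] b by simp
  qed
  then have sub: "co_comp (cluster B q) z \<subseteq> - cluster B p" by blast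
  show ?thesis
  proof
    fix y assume y: "y \<in> co_comp (cluster B q) z"
    have "z \<in> co_comp (cluster B q) z" using z by (simp add: co_comp_def)
    from conn_mono[OF co_comp_conn[OF this y z] sub] sub y
    show "y \<in> co_comp (cluster B p) z" by (auto simp: co_comp_def)
  qed
qed simp

lemma good_site_edge: "b \<notin> bad_sites K t \<Longrightarrow> e \<in> lattice_edges \<Longrightarrow> b \<in> e \<Longrightarrow> t e \<le> K"
  by (force simp: bad_sites_def)

text \<open>A shortest walk has at most two edges, so each of them touches \<open>b\<close> or
  \<open>b'\<close>; the vertex between may be bad without harm.\<close>

lemma short_hop:
  fixes t :: "(int ^ 'd::finite) set \<Rightarrow> real" and K :: real
  assumes t: "nonneg_weight t" "0 \<le> K" and good: "b \<notin> bad_sites K t" "b' \<notin> bad_sites K t"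
    and l: "l1 (b' - b) \<le> 2"
  shows "ptime UNIV t b b' \<le> 2 * K"
proof -
  obtain vs where vs: "vs \<in> walks (lball b 2) b b'" "length vs = Suc (l1 (b' - b))"
    using exists_straight_walk'[OF l] .
  have e: "t e \<le> K" if e: "e \<in> path_edges vs" for e
  proof -
    have el: "e \<in> lattice_edges" using e vs walk_path_edges by (auto simp: walks_def)
    have "b \<in> e \<or> b' \<in> e"
    proof -
      have len: "length vs \<le> 3" using vs(2) l by simp
      consider x where "vs = [x]" | x y where "vs = [x, y]" | x y z where "vs = [x, y, z]"
        using vs(1) len by (cases vs; cases "tl vs"; cases "tl (tl vs)") (auto simp: walks_def)
      then show ?thesis using vs(1) e by cases (auto simp: walks_def)
    qed
    then show ?thesis using good_site_edge el good by blast
  qed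
  have "ptime UNIV t b b' \<le> cost t vs"
    using vs(1) walks_mono by (intro ptime_le t) blast
  also have "\<dots> \<le> real (length vs - 1) * K" using e by (rule cost_le_length)
  also have "\<dots> \<le> 2 * K" using vs(2) l t(2) by (intro mult_right_mono) auto
  finally show ?thesis .
qed

lemma chain_ptime:
  assumes t: "nonneg_weight t" and "successively R ps" "ps \<noteq> []"
    and R: "\<And>p q. R p q \<Longrightarrow> ptime UNIV t (h p) (h q) \<le> c"
  shows "ptime UNIV t (h (hd ps)) (h (last ps)) \<le> real (length ps - 1) * c"
  using assms(2,3)
proof (induction ps rule: induct_list012)
  case (2 p)
  have "ptime UNIV t (h p) (h p) \<le> cost t [h p]" by (intro ptime_le t walks_single) simp
  then show ?case by simp
next
  case (3 p q ps)
  have "ptime UNIV t (h p) (h (last (q # ps))) \<le> ptime UNIV t (h p) (h q) + ptime UNIV t (h q) (h (last (q # ps)))"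
    by (rule ptime_triangle[OF t]) simp_all
  also have "\<dots> \<le> c + real (length (q # ps) - 1) * c" using 3 R by (intro add_mono) auto
  finally show ?case by (simp add: algebra_simps)
qed simp

text \<open>There are at most \<open>2 * CARD('d) * card C\<close> boundary edges, and passing from
  one to the next within a unit square is a hop of cost at most \<open>2 * K\<close>. The product is
  the source of the factor in \<open>detour_weight\<close>.\<close>

lemma boundary_ptime:
  fixes t :: "(int ^ 'd::finite) set \<Rightarrow> real" and K :: real
  assumes t: "nonneg_weight t" "0 \<le> K"
    and C: "C = cluster (bad_sites K t) p" "finite C" "z \<notin> C"
    and ab: "(a, b) \<in> edge_boundary (co_comp C z)" "(a', b') \<in> edge_boundary (co_comp C z)"
  shows "ptime UNIV t b b' \<le> 4 * CARD('d) * K * card C"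
proof -
  let ?D = "co_comp C z"
  have aC: "a \<in> C" using boundary_co_comp(1) ab(1) C(1) by blast
  have "(square_adj ?D)\<^sup>*\<^sup>* (a, b) (a', b')"
  proof (rule edge_boundary_connected[OF _ _ ab])
    show "conn ?D u v" if "u \<in> ?D" "v \<in> ?D" for u v using co_comp_conn[OF that C(3)] .
    show "conn (- ?D) u v" if "u \<notin> ?D" "v \<notin> ?D" for u v
      by (rule co_comp_compl_conn[OF _ _ that]) (use cluster_conn C(1) aC in blast)+
  qed
  from rtranclp_imp_distinct_list[OF this] obtain ps where
    ps: "ps \<noteq> []" "hd ps = (a, b)" "last ps = (a', b')" "successively (square_adj ?D) ps" "distinct ps"
    by blast
  have bdset: "edge_boundary ?D \<subseteq> (SIGMA x:C. {y. lattice_adj x y})"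
    using boundary_co_comp[of _ _ "bad_sites K t" p z] C(1) by auto
  have "set ps \<subseteq> edge_boundary ?D"
    using successively_invariant[OF ps(4), of "\<lambda>r. r \<in> edge_boundary ?D"] ps(2) ab(1)
    by (auto simp: square_adj_def)
  then have sub: "set ps \<subseteq> (SIGMA x:C. {y. lattice_adj x y})" using bdset by blast
  have "length ps = card (set ps)" using ps(5) distinct_card by metis
  also have "\<dots> \<le> card (SIGMA x:C. {y. lattice_adj x y})"
    using sub C(2) neighbours(1) by (intro card_mono finite_SigmaI) auto
  also have "\<dots> = (\<Sum>x\<in>C. card {y. lattice_adj x y})" using C(2) neighbours(1) by (intro card_SigmaI) auto
  also have "\<dots> \<le> (\<Sum>x\<in>C. 2 * CARD('d))" by (intro sum_mono neighbours(2))
  finally have len: "length ps \<le> 2 * CARD('d) * card C" by (simp add: mult.commute)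
  have hop: "ptime UNIV t (snd p) (snd q) \<le> 2 * K" if pq: "square_adj ?D p q" for p q
  proof -
    obtain x i j where sq: "snd p \<in> unit_square x i j" "snd q \<in> unit_square x i j"
      using pq by (auto simp: square_adj_def)
    have "p \<in> edge_boundary ?D" "q \<in> edge_boundary ?D" using pq by (auto simp: square_adj_def)
    then have "snd p \<notin> bad_sites K t" "snd q \<notin> bad_sites K t"
      using boundary_co_comp(3) C(1) by (metis prod.collapse)+
    then show ?thesis using short_hop[OF t] unit_square_dist[OF sq] by blast
  qed
  have "ptime UNIV t (snd (hd ps)) (snd (last ps)) \<le> real (length ps - 1) * (2 * K)"
    by (rule chain_ptime[OF t(1) ps(4,1) hop])
  also have "\<dots> \<le> real (2 * CARD('d) * card C) * (2 * K)"
    using len t(2) by (intro mult_right_mono) (simp_all add: of_nat_mono del: of_nat_mult)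
  finally show ?thesis by (simp add: ps algebra_simps)
qed

lemma edge_weight_le_cost:
  "e \<in> path_edges vs \<Longrightarrow> (\<And>e. e \<in> path_edges vs \<Longrightarrow> 0 \<le> w e) \<Longrightarrow> w e \<le> cost w vs"
proof (induction vs rule: induct_list012)
  case (3 x y vs)
  have "0 \<le> cost w (y # vs)" using 3(4) by (intro cost_nonneg) auto
  moreover have "e = {x, y} \<or> w e \<le> cost w (y # vs)" using 3 by auto
  moreover have "0 \<le> w {x, y}" using 3(4)[of "{x, y}"] by simp
  ultimately show ?case by auto
qed auto

text \<open>Among the exteriors belonging to the heavy edges of the walk, a minimal one
  \<open>D\<close> is the exterior of a largest filled cluster. The stretch between the first and
  the last visit to the complement of \<open>D\<close> is replaced by a walk along the boundary,
  paid for by the weight of one heavy edge in that stretch. The two remaining pieces are shorter,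
  and minimality keeps their new ends exterior to every cluster concerned, so induction on the
  length applies.\<close>

lemma detour:
  fixes t w :: "(int ^ 'd::finite) set \<Rightarrow> real" and K :: real
  assumes t: "nonneg_weight t" "0 \<le> K" and w: "nonneg_weight w"
    and vs: "vs \<in> walks UNIV u v"
    and good: "\<And>e. e \<in> path_edges vs \<Longrightarrow> t e \<le> K \<Longrightarrow> t e \<le> w e"
    and bad: "\<And>e y. e \<in> path_edges vs \<Longrightarrow> K < t e \<Longrightarrow> y \<in> e \<Longrightarrow>
        finite (cluster (bad_sites K t) y) \<and>
        4 * CARD('d) * K * card (cluster (bad_sites K t) y) \<le> w e"
    and sep: "\<And>e y. e \<in> path_edges vs \<Longrightarrow> K < t e \<Longrightarrow> y \<in> e \<Longrightarrow>
        z \<notin> cluster (bad_sites K t) y \<and>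
        u \<in> co_comp (cluster (bad_sites K t) y) z \<and> v \<in> co_comp (cluster (bad_sites K t) y) z"
  shows "ptime UNIV t u v \<le> cost w vs"
  using vs good bad sep
proof (induction "length vs" arbitrary: vs u v rule: less_induct)
  case less
  let ?B = "bad_sites K t"
  let ?E = "{e \<in> path_edges vs. K < t e}"
  let ?out = "\<lambda>y. co_comp (cluster ?B y) z"
  note good = less(3) and bad = less(4) and sep = less(5)
  have edges: "path_edges vs \<subseteq> lattice_edges"
    using less.prems(1) walk_path_edges by (auto simp: walks_def)
  show ?case
  proof (cases "?E = {}")
    case True
    have "ptime UNIV t u v \<le> cost t vs" by (rule ptime_le[OF t(1) less.prems(1)])
    also have "\<dots> \<le> cost w vs" using True good by (intro cost_mono) force
    finally show ?thesis .
  next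
    case False
    let ?F = "?out ` (\<Union> ?E)"
    have fin: "finite ?F" using edges finite_lattice_edge
      by (intro finite_imageI finite_Union) (auto simp: finite_path_edges)
    obtain e0 where e0: "e0 \<in> path_edges vs" "K < t e0" using False by auto
    then have "e0 \<noteq> {}" using finite_lattice_edge[of e0] edges by auto
    then have "?F \<noteq> {}" using e0 by auto
    from finite_has_minimal[OF fin this]
    obtain D where DF: "D \<in> ?F" and min0: "\<forall>D'\<in>?F. D' \<subseteq> D \<longrightarrow> D = D'" by (elim bexE)
    have min: "D = D'" if "D' \<in> ?F" "D' \<subseteq> D" for D'
      by (rule min0[rule_format, OF that])
    from DF obtain e p where e: "e \<in> path_edges vs" "K < t e" "p \<in> e" and D: "D = ?out p" by auto
    let ?C = "cluster ?B p"
    have pB: "p \<in> ?B" using e edges by (auto simp: bad_sites_def)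
    then have pD: "p \<notin> D" using cluster_self co_comp_disjoint D by blast
    have eset: "e \<subseteq> set vs" using e(1) path_edges_subset_set by blast
    have uv: "u \<in> D" "v \<in> D" using sep[OF e] D by auto
    have hdl: "hd vs = u" "last vs = v" "vs \<noteq> []" using less.prems(1) by (auto simp: walks_def)
    have ex: "\<exists>x\<in>set vs. x \<notin> D" using e(3) eset pD by blast
    obtain as a rest where 1: "vs = as @ a # rest" "a \<notin> D" "\<forall>x\<in>set as. x \<in> D"
      using split_list_first_prop[OF ex] by auto
    have "as \<noteq> []" using 1 hdl uv by (cases as) auto
    then obtain as' b where as: "as = as' @ [b]" by (metis append_butlast_last_id)
    obtain fs a' gs where 2: "vs = fs @ a' # gs" "a' \<notin> D" "\<forall>x\<in>set gs. x \<in> D"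
      using split_list_last_prop[OF ex] by auto
    have "gs \<noteq> []" using 2 hdl uv by (cases gs) auto
    then obtain b' gs' where gs: "gs = b' # gs'" by (cases gs) auto
    \<comment> \<open>The first vertex off \<open>D\<close> does not come after the last one, so
      both cuts leave a middle stretch \<open>mid\<close>.\<close>
    have "\<exists>mid. fs @ [a'] = as @ mid \<and> a # rest = mid @ gs"
    proof -
      have "as @ a # rest = (fs @ [a']) @ gs" using 1 2 by simp
      from append_eq_append_conv2[THEN iffD1, OF this] obtain us where
        us: "as = (fs @ [a']) @ us \<and> us @ a # rest = gs \<or> as @ us = fs @ [a'] \<and> a # rest = us @ gs"
        by (elim exE)
      have "as \<noteq> (fs @ [a']) @ us" using 1(3) 2(2) by auto
      then have "fs @ [a'] = as @ us \<and> a # rest = us @ gs" using us by simp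
      then show ?thesis ..
    qed
    then obtain mid where mid: "fs @ [a'] = as @ mid" "a # rest = mid @ gs" by blast
    have "mid \<noteq> []" using mid(1) 1(3) 2(2) by (metis append_Nil2 in_set_conv_decomp)
    then obtain mid' where mid': "mid = mid' @ [a']" using mid(1) by (metis append_is_Nil_conv last_appendR last_snoc append_butlast_last_id)
    have vs: "vs = as' @ b # mid @ b' # gs'" using 1 mid as gs by simp
    let ?v1 = "as' @ [b]" and ?v2 = "b # mid @ [b']" and ?v3 = "b' # gs'"
    have costs: "cost f vs = cost f ?v1 + cost f ?v2 + cost f ?v3" for f
      unfolding vs by (subst cost_append) (simp add: cost_append[of f "b # mid" b' gs', simplified])
    have pes: "path_edges vs = path_edges ?v1 \<union> path_edges ?v2 \<union> path_edges ?v3"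
      unfolding vs by (subst path_edges_append)
        (simp add: path_edges_append[of "b # mid" b' gs', simplified] Un_assoc)
    have w1: "?v1 \<in> walks UNIV u b" and r: "b # mid @ b' # gs' \<in> walks UNIV b v"
      using walks_append_decomp[of as' b "mid @ b' # gs'"] less.prems(1) vs by auto
    have w3: "?v3 \<in> walks UNIV b' v" and w2: "?v2 \<in> walks UNIV b b'"
      using walks_append_decomp[of "b # mid" b' gs'] r by auto
    \<comment> \<open>\<open>e\<close> contains \<open>p\<close>, which is off \<open>D\<close>,
      whereas both outer pieces run inside \<open>D\<close>.\<close>
    have "e \<notin> path_edges ?v1" using e(3) pD 1(3) as path_edges_subset_set[of e ?v1] by auto
    moreover have "e \<notin> path_edges ?v3" using e(3) pD 2(3) gs path_edges_subset_set[of e ?v3] by auto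
    ultimately have e2: "e \<in> path_edges ?v2" using e(1) pes by blast
    have wnn: "0 \<le> w e'" if "e' \<in> path_edges vs" for e' using that edges w by (auto simp: nonneg_weight_def)
    have ab: "(a, b) \<in> edge_boundary D"
    proof -
      obtain mid2 where "mid = a # mid2" using mid(2) \<open>mid \<noteq> []\<close> by (cases mid) auto
      then have "lattice_adj b a" using w2 by (simp add: walks_def)
      then have "lattice_adj a b" using lattice_adj_sym[of a b] by simp
      then show ?thesis using 1(2,3) as by (simp add: edge_boundary_def)
    qed
    have ab': "(a', b') \<in> edge_boundary D"
    proof -
      have "successively lattice_adj (fs @ a' # b' # gs')" using less.prems(1) 2(1) gs by (auto simp: walks_def)
      then have "lattice_adj a' b'" by (auto simp: successively_append_iff)
      then show ?thesis using 2(2,3) gs by (auto simp: edge_boundary_def)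
    qed
    have "ptime UNIV t b b' \<le> 4 * CARD('d) * K * card ?C"
      by (rule boundary_ptime[OF t refl]) (use bad[OF e] sep[OF e] ab ab' D in auto)
    also have "\<dots> \<le> w e" using bad[OF e] by simp
    also have "\<dots> \<le> cost w ?v2" using e2 wnn pes by (intro edge_weight_le_cost) auto
    finally have mid_le: "ptime UNIV t b b' \<le> cost w ?v2" .
    \<comment> \<open>Were the boundary point \<open>c\<close> hidden behind the cluster of
      \<open>y\<close>, then \<open>co_comp_nested\<close> and minimality would make that exterior
      equal to \<open>D\<close>, which contains \<open>c\<close>.\<close>
    have inside: "c \<in> ?out y" if c: "(a'', c) \<in> edge_boundary D" and e': "e' \<in> path_edges vs" "K < t e'" "y \<in> e'"
      for c a'' e' y
    proof (rule ccontr)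
      assume n: "c \<notin> ?out y"
      have "?out y \<subseteq> D" unfolding D
        by (rule co_comp_nested[OF _ _ n]) (use c D sep[OF e'] in auto)
      then have "D = ?out y" using e' by (intro min) auto
      then show False using n c by (auto simp: edge_boundary_def)
    qed
    have len: "length ?v1 < length vs" "length ?v3 < length vs" using vs by auto
    have "ptime UNIV t u b \<le> cost w ?v1"
    proof (rule less.hyps[OF len(1) w1])
      fix e' assume "e' \<in> path_edges ?v1" "t e' \<le> K" then show "t e' \<le> w e'" using good pes by blast
    next
      fix e' y assume e': "e' \<in> path_edges ?v1" "K < t e'" "y \<in> e'"
      then have "e' \<in> path_edges vs" using pes by blast
      then show "finite (cluster ?B y) \<and> 4 * CARD('d) * K * card (cluster ?B y) \<le> w e'"
        "z \<notin> cluster ?B y \<and> u \<in> ?out y \<and> b \<in> ?out y"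
        using bad sep inside[OF ab] e' by auto
    qed
    moreover have "ptime UNIV t b' v \<le> cost w ?v3"
    proof (rule less.hyps[OF len(2) w3])
      fix e' assume "e' \<in> path_edges ?v3" "t e' \<le> K" then show "t e' \<le> w e'" using good pes by blast
    next
      fix e' y assume e': "e' \<in> path_edges ?v3" "K < t e'" "y \<in> e'"
      then have "e' \<in> path_edges vs" using pes by blast
      then show "finite (cluster ?B y) \<and> 4 * CARD('d) * K * card (cluster ?B y) \<le> w e'"
        "z \<notin> cluster ?B y \<and> b' \<in> ?out y \<and> v \<in> ?out y"
        using bad sep inside[OF ab'] e' by auto
    qed
    moreover have "ptime UNIV t u v \<le> ptime UNIV t u b + ptime UNIV t b v"
      "ptime UNIV t b v \<le> ptime UNIV t b b' + ptime UNIV t b' v"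
      by (rule ptime_triangle[OF t(1)]; simp)+
    ultimately show ?thesis using mid_le costs[of w] by linarith
  qed
qed

section \<open>Connectedness of the outside of a ball\<close>

lemma conn_line:
  fixes y :: "int ^ 'd::finite"
  assumes "\<And>c. min a b \<le> c \<Longrightarrow> c \<le> max a b \<Longrightarrow> (\<chi> k. if k = i then c else y $ k) \<in> S"
  shows "conn S (\<chi> k. if k = i then a else y $ k) (\<chi> k. if k = i then b else y $ k)"
proof -
  let ?p = "\<lambda>c. (\<chi> k. if k = i then c else y $ k) :: int ^ 'd"
  have adj: "lattice_adj (?p c) (?p (c + 1))" for c
  proof -
    have "?p (c + 1) = ?p c + axis i 1" by (simp add: vec_eq_iff axis_def)
    then show ?thesis unfolding lattice_adj_iff_axis by blast
  qed
  have *: "conn S (?p a) (?p b)" if "a \<le> b" "\<And>c. a \<le> c \<Longrightarrow> c \<le> b \<Longrightarrow> ?p c \<in> S" for a b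
    using that
  proof (induction b rule: int_ge_induct)
    case (step b)
    have "conn S (?p a) (?p b)" using step.IH step.prems by simp
    moreover have "conn S (?p b) (?p (b + 1))"
      using adj step.prems[of b] step.prems[of "b + 1"] step.hyps by (intro conn_step) auto
    ultimately show ?case by (rule conn_trans)
  qed simp
  show ?thesis
  proof (cases "a \<le> b")
    case True
    then show ?thesis using * assms by simp
  next
    case False
    then have "conn S (?p b) (?p a)" using *[of b a] assms by simp
    then show ?thesis by (rule conn_sym)
  qed
qed

lemma conn_set_coordinates:
  fixes y w :: "int ^ 'd::finite"
  assumes "finite F" "j \<notin> F" "\<And>x. x $ j = y $ j \<Longrightarrow> x \<in> S"
  shows "conn S y (\<chi> k. if k \<in> F then w $ k else y $ k)"
  using assms(1,2)
proof induction
  case (insert i F)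
  let ?y = "(\<chi> k. if k \<in> F then w $ k else y $ k) :: int ^ 'd"
  have "conn S (\<chi> k. if k = i then ?y $ i else ?y $ k) (\<chi> k. if k = i then w $ i else ?y $ k)"
    by (rule conn_line) (use insert.prems assms(3) in simp)
  moreover have "(\<chi> k. if k = i then ?y $ i else ?y $ k) = ?y" by (simp add: vec_eq_iff)
  moreover have "(\<chi> k. if k = i then w $ i else ?y $ k) = (\<chi> k. if k \<in> insert i F then w $ k else y $ k)"
    by (simp add: vec_eq_iff)
  ultimately have "conn S ?y (\<chi> k. if k \<in> insert i F then w $ k else y $ k)" by simp
  then show ?case using insert conn_trans[of S y ?y] by simp
qed simp

text \<open>In dimension at least 2 there is a second coordinate to rely on. Moving coordinate
  \<open>i\<close> away from the centre never comes closer; once it alone keeps the point outside,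
  coordinate \<open>j\<close> is moved to \<open>c $ j + int r + 1\<close>, which in turn lets all
  the others return to the centre. Every starting point ends at the same \<open>w\<close>.\<close>

lemma conn_co_lball:
  fixes y z c :: "int ^ 'd::finite"
  assumes d: "CARD('d) \<ge> 2" and y: "y \<notin> lball c r" and z: "z \<notin> lball c r"
  shows "conn (- lball c r) y z"
proof -
  have "\<not> card (UNIV :: 'd set) \<le> Suc 0" using d by simp
  then obtain i j :: 'd where ij: "i \<noteq> j" by (auto simp: card_le_Suc0_iff_eq)
  define w where "w = (\<chi> k. if k = j then c $ j + int r + 1 else c $ k)"
  have out: "x \<in> - lball c r" if x: "\<bar>x $ k - c $ k\<bar> > int r" for x k
    using component_le_l1[of "x - c" k] x by (auto simp: lball_def)
  have "conn (- lball c r) y w" if y: "y \<notin> lball c r" for y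
  proof -
    define v where "v = (if y $ i \<ge> c $ i then y $ i + int r + 1 else y $ i - int r - 1)"
    define y1 where "y1 = (\<chi> k. if k = i then v else y $ k)"
    define y2 where "y2 = (\<chi> k. if k = j then c $ j + int r + 1 else y1 $ k)"
    have "conn (- lball c r) (\<chi> k. if k = i then y $ i else y $ k) y1"
      unfolding y1_def
    proof (rule conn_line)
      fix a assume a: "min (y $ i) v \<le> a" "a \<le> max (y $ i) v"
      let ?x = "(\<chi> k. if k = i then a else y $ k) :: int ^ 'd"
      have "\<bar>a - c $ i\<bar> \<ge> \<bar>y $ i - c $ i\<bar>" using a by (auto simp: v_def split: if_splits)
      then have "l1 (y - c) \<le> l1 (?x - c)" unfolding l1_def by (intro sum_mono) auto
      then show "?x \<in> - lball c r" using y by (simp add: lball_def)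
    qed
    moreover have "(\<chi> k. if k = i then y $ i else y $ k) = y" by (simp add: vec_eq_iff)
    ultimately have 1: "conn (- lball c r) y y1" by simp
    have y1i: "\<bar>y1 $ i - c $ i\<bar> > int r" by (auto simp: y1_def v_def)
    have "conn (- lball c r) (\<chi> k. if k = j then y1 $ j else y1 $ k) y2"
      unfolding y2_def by (rule conn_line, rule out[of _ i]) (use y1i ij in simp)
    moreover have "(\<chi> k. if k = j then y1 $ j else y1 $ k) = y1" by (simp add: vec_eq_iff)
    ultimately have 2: "conn (- lball c r) y1 y2" by simp
    have "conn (- lball c r) y2 (\<chi> k. if k \<in> UNIV - {j} then c $ k else y2 $ k)"
    proof (rule conn_set_coordinates[where j = j])
      fix x assume "x $ j = y2 $ j"
      then show "x \<in> - lball c r" by (intro out[of _ j]) (simp add: y2_def)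
    qed auto
    moreover have "(\<chi> k. if k \<in> UNIV - {j} then c $ k else y2 $ k) = w"
      by (simp add: vec_eq_iff w_def y2_def)
    ultimately have 3: "conn (- lball c r) y2 w" by simp
    show ?thesis by (rule conn_trans[OF conn_trans[OF 1 2] 3])
  qed
  from this[OF y] this[OF z] show ?thesis by (meson conn_sym conn_trans)
qed

text \<open>The cut-off after \<open>r\<close> steps makes the detour weights local functions of the edge weights.\<close>

definition local_cluster :: "(int ^ 'd::finite) set \<Rightarrow> nat \<Rightarrow> int ^ 'd \<Rightarrow> (int ^ 'd) set" where
  "local_cluster B r v = {y. \<exists>vs\<in>walks B v y. length vs \<le> Suc r}"

text \<open>The factor is the cost per site of the boundary walk in \<open>boundary_ptime\<close>.
  Both endpoints of a heavy edge contribute, so the weight pays for the detour whichever endpoint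
  \<open>detour\<close> picks.\<close>

definition detour_weight :: "real \<Rightarrow> nat \<Rightarrow> ((int ^ 'd::finite) set \<Rightarrow> real) \<Rightarrow> (int ^ 'd) set \<Rightarrow> real" where
  "detour_weight K r t e = (if t e \<le> K then t e
     else real (4 * CARD('d)) * K * (\<Sum>v\<in>e. real (card (local_cluster (bad_sites K t) r v))))"

lemma local_cluster_subset: "local_cluster B r v \<subseteq> lball v r \<inter> cluster B v"
proof
  fix y assume "y \<in> local_cluster B r v"
  then obtain vs where vs: "vs \<in> walks B v y" "length vs \<le> Suc r" by (auto simp: local_cluster_def)
  then have "v \<in> B" by (auto simp: walks_def)
  then show "y \<in> lball v r \<inter> cluster B v"
    using vs walks_length[OF vs(1)] conn_walk[OF vs(1)] by (auto simp: lball_def cluster_def)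
qed

lemma finite_local_cluster [simp]: "finite (local_cluster B r v)"
  using local_cluster_subset finite_lball by (metis finite_Int finite_subset)

lemma card_local_cluster: "card (local_cluster B r (v :: int ^ 'd::finite)) \<le> (2 * r + 1) ^ CARD('d)"
  using card_mono[OF finite_lball, of "local_cluster B r v" v r] local_cluster_subset[of B r v] card_lball[of v r]
  by auto

lemma local_cluster_mono: "r \<le> s \<Longrightarrow> local_cluster B r v \<subseteq> local_cluster B s v"
  unfolding local_cluster_def by (intro Collect_mono) (meson Suc_le_mono le_trans)

text \<open>A deterministic bound for \<open>detour_weight\<close>: \<open>K\<close> for a light
  edge, plus the cost of two full balls of radius \<open>r\<close>, one per endpoint of a heavy
  edge.\<close>

definition detour_bound :: "'d::finite itself \<Rightarrow> real \<Rightarrow> nat \<Rightarrow> real" where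
  "detour_bound _ K r = K + 8 * real CARD('d) * K * (2 * r + 1) ^ CARD('d)"

lemma detour_weight_nonneg: "nonneg_weight t \<Longrightarrow> 0 \<le> K \<Longrightarrow> nonneg_weight (detour_weight K r t)"
  by (auto simp: nonneg_weight_def detour_weight_def intro!: mult_nonneg_nonneg sum_nonneg)

lemma detour_weight_mono:
  assumes "r \<le> s" "0 \<le> K"
  shows "detour_weight K r t e \<le> detour_weight K s t e"
proof -
  have "card (local_cluster (bad_sites K t) r v) \<le> card (local_cluster (bad_sites K t) s v)" for v
    by (intro card_mono local_cluster_mono assms(1)) simp
  then show ?thesis using assms(2) by (auto simp: detour_weight_def intro!: mult_left_mono sum_mono)
qed

lemma detour_weight_le:
  fixes t :: "(int ^ 'd::finite) set \<Rightarrow> real"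
  assumes "e \<in> lattice_edges" "0 \<le> K"
  shows "detour_weight K r t e \<le> detour_bound TYPE('d) K r"
proof (cases "t e \<le> K")
  case True
  have "K \<le> detour_bound TYPE('d) K r"
    using assms(2) by (auto simp: detour_bound_def intro!: mult_nonneg_nonneg)
  then show ?thesis using True by (simp add: detour_weight_def)
next
  case False
  have "(\<Sum>v\<in>e. real (card (local_cluster (bad_sites K t) r v))) \<le> (\<Sum>v\<in>e. real ((2 * r + 1) ^ CARD('d)))"
    by (intro sum_mono of_nat_mono card_local_cluster)
  also have "\<dots> = 2 * (2 * real r + 1) ^ CARD('d)" using finite_lattice_edge[OF assms(1)] by (simp add: add.commute)
  finally have "real (4 * CARD('d)) * K * (\<Sum>v\<in>e. real (card (local_cluster (bad_sites K t) r v)))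
      \<le> real (4 * CARD('d)) * K * (2 * (2 * real r + 1) ^ CARD('d))"
    using assms(2) by (intro mult_left_mono) auto
  moreover have "detour_bound TYPE('d) K r = K + real (4 * CARD('d)) * K * (2 * (2 * real r + 1) ^ CARD('d))"
    by (simp add: detour_bound_def add.commute)
  moreover have "detour_weight K r t e =
      real (4 * CARD('d)) * K * (\<Sum>v\<in>e. real (card (local_cluster (bad_sites K t) r v)))"
    using False by (simp add: detour_weight_def)
  ultimately show ?thesis using assms(2) by linarith
qed

text \<open>Phrased through self-avoiding paths, with \<open>Suc r\<close> vertices and hence
  \<open>r\<close> steps, because these are what the Peierls argument counts; a bound on the cluster
  follows.\<close>

definition no_long_path :: "(int ^ 'd::finite) set \<Rightarrow> nat \<Rightarrow> int ^ 'd \<Rightarrow> bool" where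
  "no_long_path B r v \<longleftrightarrow> \<not> (\<exists>vs. length vs = Suc r \<and> hd vs = v \<and> successively lattice_adj vs \<and>
     distinct vs \<and> set vs \<subseteq> B)"

lemma no_long_path_cluster:
  assumes "no_long_path B r v" "y \<in> cluster B v"
  shows "\<exists>vs\<in>walks B v y. length vs \<le> r"
proof -
  obtain vs where vs: "vs \<in> walks B v y" "distinct vs"
    using assms(2) conn_imp_saw[of B v y] by (auto simp: cluster_def)
  have "length vs \<le> r"
  proof (rule ccontr)
    assume l: "\<not> length vs \<le> r"
    let ?ws = "take (Suc r) vs"
    have "successively lattice_adj ?ws"
      using vs(1) successively_append_iff[of lattice_adj ?ws "drop (Suc r) vs"] by (simp add: walks_def)
    moreover have "length ?ws = Suc r" "hd ?ws = v" "distinct ?ws" "set ?ws \<subseteq> B"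
      using l vs set_take_subset[of "Suc r" vs] by (auto simp: walks_def)
    ultimately show False using assms(1) unfolding no_long_path_def by blast
  qed
  then show ?thesis using vs(1) by blast
qed

lemma no_long_path_imp:
  assumes "no_long_path B r v"
  shows "cluster B v \<subseteq> lball v r" "r \<le> s \<Longrightarrow> local_cluster B s v = cluster B v"
proof -
  show "cluster B v \<subseteq> lball v r"
  proof
    fix y assume "y \<in> cluster B v"
    from no_long_path_cluster[OF assms this] obtain vs where "vs \<in> walks B v y" "length vs \<le> r" by blast
    then show "y \<in> lball v r" using walks_length[of vs B v y] by (simp add: lball_def)
  qed
  assume "r \<le> s"
  have "cluster B v \<subseteq> local_cluster B s v"
  proof
    fix y assume "y \<in> cluster B v"
    from no_long_path_cluster[OF assms this] obtain vs where "vs \<in> walks B v y" "length vs \<le> r" by blast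
    then show "y \<in> local_cluster B s v" using \<open>r \<le> s\<close> unfolding local_cluster_def
      by (intro CollectI bexI[of _ vs]) auto
  qed
  then show "local_cluster B s v = cluster B v" using local_cluster_subset[of B s v] by blast
qed

lemma detour_weight_stable:
  assumes "\<And>v. v \<in> e \<Longrightarrow> no_long_path (bad_sites K t) r v" "r \<le> s"
  shows "detour_weight K s t e = detour_weight K r t e"
  using no_long_path_imp(2)[OF assms(1), of _ s] no_long_path_imp(2)[OF assms(1), of _ r] assms(2)
  by (simp add: detour_weight_def)

text \<open>Leaving the maximal filled-in bad cluster around the starting point of a walk, one reaches a
  vertex that no bad cluster separates from the distant point \<open>z\<close>.\<close>

lemma escape:
  fixes B :: "(int ^ 'd::finite) set"
  assumes d: "CARD('d) \<ge> 2"
    and short: "\<And>v. v \<in> lball 0 R \<Longrightarrow> no_long_path B r v"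
    and z: "l1 z > R + r"
    and vs: "successively lattice_adj vs" "vs \<noteq> []" "last vs \<notin> lball (hd vs) (2 * r)"
  shows "\<exists>as u rest. vs = as @ u # rest \<and> set as \<subseteq> lball (hd vs) (2 * r) \<and>
      u \<in> lball (hd vs) (2 * r + 1) \<and> (\<forall>q\<in>B \<inter> lball 0 R. u \<in> co_comp (cluster B q) z)"
proof -
  let ?o = "hd vs"
  let ?out = "\<lambda>q. co_comp (cluster B q) z"
  have zq: "z \<notin> lball q r" if "q \<in> lball 0 R" for q
    using that z l1_triangle[of "z - q" q] by (auto simp: lball_def)
  have fill: "y \<in> ?out q" if q: "q \<in> lball 0 R" and y: "y \<notin> lball q r" for q y
  proof -
    have sub: "cluster B q \<subseteq> lball q r" using no_long_path_imp(1)[OF short[OF q]] .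
    have "conn (- lball q r) z y" by (rule conn_co_lball[OF d zq[OF q] y])
    then have "conn (- cluster B q) z y" by (rule conn_mono) (use sub in blast)
    then show ?thesis using sub y by (auto simp: co_comp_def)
  qed
  have zc: "z \<notin> cluster B q" if "q \<in> lball 0 R" for q
    using no_long_path_imp(1)[OF short[OF that]] zq[OF that] by blast
  \<comment> \<open>The exteriors that do not contain the starting point; a minimal one belongs to a
    largest filled cluster around it.\<close>
  let ?F = "{?out q | q. q \<in> B \<inter> lball 0 R \<and> ?o \<notin> ?out q}"
  show ?thesis
  proof (cases "?F = {}")
    case True
    then have "\<forall>q\<in>B \<inter> lball 0 R. ?o \<in> ?out q" by blast
    then show ?thesis using vs(2) by (intro exI[of _ "[]"] exI[of _ ?o] exI[of _ "tl vs"]) simp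
  next
    case False
    have "finite ?F" by (rule finite_subset[of _ "?out ` lball 0 R"]) auto
    from finite_has_minimal[OF this False]
    obtain D where DF: "D \<in> ?F" and min0: "\<forall>D'\<in>?F. D' \<subseteq> D \<longrightarrow> D = D'" by (elim bexE)
    from DF obtain p where p: "p \<in> B" "p \<in> lball 0 R" "?o \<notin> ?out p" and D: "D = ?out p" by blast
    have op: "?o \<in> lball p r" using fill[OF p(2), of ?o] p(3) by blast
    have near: "y \<in> lball ?o (2 * r)" if "y \<notin> D" for y
    proof -
      have "y \<in> lball p r" using fill[OF p(2), of y] that D by blast
      then show ?thesis using op l1_diff_triangle[of y ?o p] by (auto simp: lball_def l1_minus_commute[of p])
    qed
    \<comment> \<open>Everything off \<open>D\<close> is within \<open>2 * r\<close> of the start,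
      and the walk ends farther away, so it does enter \<open>D\<close>.\<close>
    have "\<exists>x\<in>set vs. x \<in> D" using near[of "last vs"] vs(2,3) last_in_set[OF vs(2)] by blast
    from split_list_first_prop[OF this] obtain as u rest where
      vs_eq: "vs = as @ u # rest" and u: "u \<in> D" and as: "\<forall>y\<in>set as. y \<notin> D" by auto
    have "as \<noteq> []" using vs_eq u p(3) D by (cases as) auto
    then obtain as' a where as': "as = as' @ [a]" by (metis append_butlast_last_id)
    have adj: "lattice_adj a u" using vs(1) by (simp add: vs_eq as' successively_append_iff)
    have aD: "a \<notin> D" using as as' by simp
    have au: "(a, u) \<in> edge_boundary D" using adj aD u by (simp add: edge_boundary_def)
    have "u \<in> lball ?o (2 * r + 1)"
      using near[OF aD] adj l1_diff_triangle[of u ?o a]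
      by (auto simp: lball_def lattice_adj_iff_l1 l1_minus_commute[of a])
    moreover have "set as \<subseteq> lball ?o (2 * r)" using as near by blast
    moreover have "u \<in> ?out q" if q: "q \<in> B \<inter> lball 0 R" for q
    proof (rule ccontr)
      assume n: "u \<notin> ?out q"
      have sub: "?out q \<subseteq> D" unfolding D
        by (rule co_comp_nested[OF _ _ n]) (use au D zc q in auto)
      then have "?out q \<in> ?F" using q p(3) D by blast
      then have "D = ?out q" using min0 sub by blast
      then show False using n u by blast
    qed
    ultimately show ?thesis using vs_eq by blast
  qed
qed

section \<open>Geodesics compared with detours\<close>

lemma passage_time_le:
  assumes t: "nonneg_weight t" and vs: "vs \<in> walks UNIV x y"
  shows "passage_time t x y \<le> cost t vs"
proof -
  have bdd: "bdd_below (path_time t ` saw_paths x y)"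
  proof (rule bdd_belowI2[of _ 0])
    fix \<gamma> assume "\<gamma> \<in> saw_paths x y"
    then obtain ws where ws: "saw x y ws" "\<gamma> = path_edges ws" by (auto simp: saw_paths_def)
    then have "\<gamma> \<subseteq> lattice_edges" using walk_path_edges by (auto simp: saw_def)
    then show "0 \<le> path_time t \<gamma>" using t unfolding path_time_def nonneg_weight_def by (intro sum_nonneg) auto
  qed
  obtain vs' where vs': "saw x y vs'" "path_edges vs' \<subseteq> path_edges vs"
    by (rule loop_erasure[OF vs])
  have nn: "0 \<le> t e" if "e \<in> path_edges vs" for e
    using that t vs walk_path_edges by (auto simp: nonneg_weight_def walks_def)
  have "passage_time t x y \<le> path_time t (path_edges vs')"
    unfolding passage_time_def using vs'(1) by (intro cINF_lower bdd) (auto simp: saw_paths_def)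
  also have "\<dots> \<le> sum t (path_edges vs)"
    unfolding path_time_def using vs'(2) nn by (intro sum_mono2 finite_path_edges) auto
  also have "\<dots> \<le> cost t vs" by (rule sum_path_edges_le_cost[OF nn])
  finally show ?thesis .
qed

text \<open>Any competitor between \<open>u\<close> and \<open>v\<close> can be spliced into the
  path, and loop erasure turns the result into a self-avoiding path, which cannot beat the
  geodesic.\<close>

lemma geodesic_middle:
  assumes t: "nonneg_weight t" and saw: "saw x y (as @ u # ms @ v # bs)"
    and geo: "path_time t (path_edges (as @ u # ms @ v # bs)) = passage_time t x y"
  shows "cost t (u # ms @ [v]) \<le> ptime UNIV t u v"
proof (rule ptime_greatest)
  fix ws assume ws: "ws \<in> walks UNIV u v"
  let ?vs = "as @ u # ms @ v # bs"
  have vs: "?vs \<in> walks UNIV x y" using saw by (auto simp: saw_def walks_def)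
  have w1: "as @ [u] \<in> walks UNIV x u" and r: "u # ms @ v # bs \<in> walks UNIV u y"
    using walks_append_decomp[OF vs] by auto
  have w3: "v # bs \<in> walks UNIV v y" using walks_append_decomp[of "u # ms" v bs] r by auto
  have c: "cost t ?vs = cost t (as @ [u]) + cost t (u # ms @ [v]) + cost t (v # bs)"
    using cost_append[of t as u "ms @ v # bs"] cost_append[of t "u # ms" v bs] by simp
  note j = walks_join[OF w1 ws]
  note j' = walks_join[OF j(1) w3]
  have "cost t ?vs = passage_time t x y"
    using geo saw cost_distinct[of ?vs t] by (simp add: path_time_def saw_def)
  also have "\<dots> \<le> cost t (as @ [u]) + cost t ws + cost t (v # bs)"
    using passage_time_le[OF t j'(1)] j'(2)[of t] j(2)[of t] by simp
  finally show "cost t (u # ms @ [v]) \<le> cost t ws" using c by simp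
qed simp

text \<open>A geodesic leaves the bad clusters around its endpoints after few steps, and in between it
  is at least as fast as the detours.\<close>

lemma heavy_edges_bound:
  fixes t :: "(int ^ 'd::finite) set \<Rightarrow> real" and K \<epsilon> :: real
  assumes d: "CARD('d) \<ge> 2" and t: "nonneg_weight t" and K: "0 \<le> K"
    and short: "\<And>v. v \<in> lball 0 R \<Longrightarrow> no_long_path (bad_sites K t) r v"
    and x: "l1 x > 4 * r + 2" "l1 x + 2 * r + 1 \<le> R"
    and S: "S \<subseteq> lball 0 R" "walks S 0 x \<noteq> {}"
    and geo: "\<gamma> \<in> geodesics t 0 x" and \<epsilon>: "\<epsilon> \<ge> 0"
  shows "\<epsilon> * card {e \<in> \<gamma>. \<epsilon> < t e} \<le> 2 * \<epsilon> * (4 * r + 1) ^ CARD('d)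
     + 2 * (2 * r + 1) * detour_bound TYPE('d) K r + ptime S (detour_weight K r t) 0 x"
proof -
  let ?B = "bad_sites K t" and ?W = "detour_bound TYPE('d) K r" and ?w = "detour_weight K r t"
  obtain vs where saw: "saw 0 x vs" and \<gamma>: "\<gamma> = path_edges vs" "path_time t (path_edges vs) = passage_time t 0 x"
    using geo by (auto simp: geodesics_def saw_paths_def)
  have vs: "successively lattice_adj vs" "vs \<noteq> []" "hd vs = 0" "last vs = x" "distinct vs"
    using saw by (auto simp: saw_def)
  define z :: "int ^ 'd" where "z = axis undefined (int (R + r + 1))"
  have z: "l1 z > R + r" by (simp add: z_def l1_axis nat_add_distrib)
  have "x \<notin> lball 0 (2 * r)" "0 \<notin> lball x (2 * r)" using x by (auto simp: lball_def)
  then have nl: "last vs \<notin> lball (hd vs) (2 * r)" "last (rev vs) \<notin> lball (hd (rev vs)) (2 * r)"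
    using vs by (auto simp: hd_rev last_rev)
  obtain as u rest where u: "vs = as @ u # rest" "set as \<subseteq> lball 0 (2 * r)" "u \<in> lball 0 (2 * r + 1)"
      "\<forall>q\<in>?B \<inter> lball 0 R. u \<in> co_comp (cluster ?B q) z"
    using escape[OF d short z vs(1,2) nl(1)] vs(3) by auto
  have "successively lattice_adj (rev vs)"
    unfolding successively_rev using vs(1) by (rule successively_mono) (auto simp: lattice_adj_sym)
  then obtain cs v rest' where v: "rev vs = cs @ v # rest'" "set cs \<subseteq> lball x (2 * r)"
      "v \<in> lball x (2 * r + 1)" "\<forall>q\<in>?B \<inter> lball 0 R. v \<in> co_comp (cluster ?B q) z"
    using escape[OF d short z, of "rev vs"] nl(2) vs by (auto simp: hd_rev)
  define bs where "bs = rev cs"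
  have "rev (rev vs) = rev (cs @ v # rest')" using v(1) by simp
  then have v': "vs = rev rest' @ v # bs" by (simp add: bs_def)
  \<comment> \<open>The escape stretches at the two ends lie in disjoint balls because
    \<open>l1 x > 4 * r + 2\<close>, so \<open>u\<close>, found from the start, comes before
    \<open>v\<close>, found from the end.\<close>
  have disj: "y \<notin> lball x (2 * r + 1)" if "y \<in> lball 0 (2 * r + 1)" for y
    using x(1) that l1_triangle[of y "x - y"] by (simp add: lball_def l1_minus_commute[of y x])
  have in1: "set (as @ [u]) \<subseteq> lball 0 (2 * r + 1)" using u lball_mono[of "2 * r" "2 * r + 1" 0] by auto
  have in2: "set (v # bs) \<subseteq> lball x (2 * r + 1)"
    using v lball_mono[of "2 * r" "2 * r + 1" x] by (auto simp: bs_def)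
  have "(as @ [u]) @ rest = rev rest' @ (v # bs)" using u(1) v' by simp
  from append_eq_append_conv2[THEN iffD1, OF this] obtain ms where
    ms: "as @ [u] = rev rest' @ ms \<and> ms @ rest = v # bs \<or> (as @ [u]) @ ms = rev rest' \<and> rest = ms @ v # bs"
    by (elim exE)
  have "\<exists>ms. vs = as @ u # ms @ v # bs"
  proof (cases "(as @ [u]) @ ms = rev rest' \<and> rest = ms @ v # bs")
    case True
    then show ?thesis using u(1) by (intro exI[of _ ms]) simp
  next
    case False
    then have m: "as @ [u] = rev rest' @ ms" "ms @ rest = v # bs" using ms by auto
    show ?thesis
    proof (cases ms)
      case Nil
      then show ?thesis using m u(1) by (intro exI[of _ "[]"]) simp
    next
      case (Cons m0 ms0)
      then have "m0 = v" "m0 \<in> set (as @ [u])" using m by (simp, simp del: append_is_Nil_conv)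
      then show ?thesis using in1 in2 disj[of v] by auto
    qed
  qed
  then obtain ms where dec: "vs = as @ u # ms @ v # bs" by blast
  have uv: "l1 u \<le> 2 * r + 1" "l1 (v - x) \<le> 2 * r + 1" using u v by (auto simp: lball_def)
  have W: "?w e \<le> ?W" if "e \<in> path_edges vs" "successively lattice_adj vs" for e vs
    using that walk_path_edges by (intro detour_weight_le[OF _ K]) auto
  have W0: "0 \<le> ?W" using K by (simp add: detour_bound_def)
  have wn: "nonneg_weight ?w" by (rule detour_weight_nonneg[OF t K])
  obtain p1 where p1: "p1 \<in> walks (lball 0 (2 * r + 1)) 0 u" "length p1 = Suc (l1 u)"
    using exists_straight_walk'[of u 0 "2 * r + 1"] uv by auto
  obtain p2 where p2: "p2 \<in> walks (lball x (2 * r + 1)) x v" "length p2 = Suc (l1 (v - x))"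
    using exists_straight_walk'[of v x "2 * r + 1"] uv by auto
  have sub: "lball 0 (2 * r + 1) \<subseteq> lball 0 R" "lball x (2 * r + 1) \<subseteq> lball 0 R"
    using x by (auto intro!: lball_mono lball_subset)
  have c1: "cost ?w p1 \<le> (2 * r + 1) * ?W"
  proof -
    have "cost ?w p1 \<le> real (length p1 - 1) * ?W" using W p1(1) by (intro cost_le_length) (auto simp: walks_def)
    also have "\<dots> \<le> (2 * r + 1) * ?W" using uv p1(2) by (intro mult_right_mono W0) auto
    finally show ?thesis .
  qed
  have c2: "cost ?w p2 \<le> (2 * r + 1) * ?W"
  proof -
    have "cost ?w p2 \<le> real (length p2 - 1) * ?W" using W p2(1) by (intro cost_le_length) (auto simp: walks_def)
    also have "\<dots> \<le> (2 * r + 1) * ?W" using uv p2(2) by (intro mult_right_mono W0) auto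
    finally show ?thesis .
  qed
  \<comment> \<open>A walk \<open>p\<close> from 0 to \<open>x\<close> becomes a walk from
    \<open>u\<close> to \<open>v\<close> by adding straight pieces at both ends, each of at most
    \<open>2 * r + 1\<close> edges of weight at most \<open>?W\<close>; \<open>detour\<close> then
    bounds the true passage time by the detour cost.\<close>
  have "ptime UNIV t u v - 2 * (2 * r + 1) * ?W \<le> ptime S ?w 0 x"
  proof (rule ptime_greatest[OF S(2)])
    fix p assume p: "p \<in> walks S 0 x"
    have q1: "rev p1 \<in> walks (lball 0 R) u 0" using walks_rev[OF p1(1)] walks_mono[OF sub(1)] by blast
    have q2: "p \<in> walks (lball 0 R) 0 x" using p walks_mono[OF S(1)] by blast
    have q3: "p2 \<in> walks (lball 0 R) x v" using p2(1) walks_mono[OF sub(2)] by blast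
    note j = walks_join[OF q1 q2]
    note j' = walks_join[OF j(1) q3]
    define q where "q = (rev p1 @ tl p) @ tl p2"
    have q: "q \<in> walks (lball 0 R) u v" "cost ?w q = cost ?w p1 + cost ?w p + cost ?w p2"
      using j' j(2)[of ?w] by (auto simp: q_def cost_rev)
    have "ptime UNIV t u v \<le> cost ?w q"
    proof (rule detour[OF t K wn, where z = z])
      show "q \<in> walks UNIV u v" using q(1) walks_mono by blast
    next
      fix e assume "t e \<le> K" then show "t e \<le> ?w e" by (simp add: detour_weight_def)
    next
      fix e y assume e: "e \<in> path_edges q" "K < t e" "y \<in> e"
      have el: "e \<in> lattice_edges" using e(1) q(1) walk_path_edges by (auto simp: walks_def)
      then have yB: "y \<in> ?B" using e by (auto simp: bad_sites_def)
      have yR: "y \<in> lball 0 R" using e(1,3) path_edges_subset_set[of e q] q(1) by (auto simp: walks_def)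
      note nlp = no_long_path_imp[OF short[OF yR]]
      have lc: "local_cluster ?B r y = cluster ?B y" using nlp(2)[of r] by simp
      have "real (card (cluster ?B y)) \<le> (\<Sum>v\<in>e. real (card (local_cluster ?B r v)))"
        unfolding lc[symmetric] using finite_lattice_edge[OF el] e(3)
        by (intro member_le_sum[of y e "\<lambda>v. real (card (local_cluster ?B r v))"]) auto
      then have "real (4 * CARD('d)) * K * card (cluster ?B y) \<le> ?w e"
        using e(2) K by (simp add: detour_weight_def mult_left_mono)
      moreover have "finite (cluster ?B y)" using nlp(1) finite_lball finite_subset by blast
      ultimately show "finite (cluster ?B y) \<and> real (4 * CARD('d)) * K * card (cluster ?B y) \<le> ?w e" by simp
      have "z \<notin> lball y r" using yR z l1_triangle[of "z - y" y] by (auto simp: lball_def)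
      then show "z \<notin> cluster ?B y \<and> u \<in> co_comp (cluster ?B y) z \<and> v \<in> co_comp (cluster ?B y) z"
        using nlp(1) u(4) v(4) yB yR by blast
    qed
    then show "ptime UNIV t u v - 2 * (2 * r + 1) * ?W \<le> cost ?w p" using q(2) c1 c2 by (simp add: algebra_simps)
  qed
  then have mid: "cost t (u # ms @ [v]) \<le> 2 * (2 * r + 1) * ?W + ptime S ?w 0 x"
    using geodesic_middle[OF t, of 0 x as u ms v bs] saw \<gamma>(2) dec by auto
  let ?H = "{e \<in> path_edges (u # ms @ [v]). \<epsilon> < t e}"
  have tn: "0 \<le> t e" if "e \<in> path_edges (u # ms @ [v])" for e
  proof -
    have "vs \<in> walks UNIV 0 x" using vs by (simp add: walks_def)
    then have "u # ms @ v # bs \<in> walks UNIV u x" using walks_append_decomp(2) dec by blast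
    then have "u # ms @ [v] \<in> walks UNIV u v" using walks_append_decomp(1)[of "u # ms" v bs] by simp
    then have "successively lattice_adj (u # ms @ [v])" by (simp add: walks_def)
    then show ?thesis using t walk_path_edges that by (auto simp: nonneg_weight_def)
  qed
  have "\<epsilon> * card ?H = (\<Sum>e\<in>?H. \<epsilon>)" by simp
  also have "\<dots> \<le> (\<Sum>e\<in>?H. t e)" by (intro sum_mono) auto
  also have "\<dots> \<le> (\<Sum>e\<in>path_edges (u # ms @ [v]). t e)"
    using tn by (intro sum_mono2 finite_path_edges) auto
  also have "\<dots> \<le> cost t (u # ms @ [v])" by (rule sum_path_edges_le_cost[OF tn])
  finally have H: "\<epsilon> * card ?H \<le> 2 * (2 * r + 1) * ?W + ptime S ?w 0 x" using mid by simp
  have pe: "\<gamma> = path_edges (as @ [u]) \<union> path_edges (u # ms @ [v]) \<union> path_edges (v # bs)"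
    using path_edges_append[of as u "ms @ v # bs"] path_edges_append[of "u # ms" v bs] dec \<gamma>(1)
    by (simp add: Un_assoc)
  have dist: "distinct as" "distinct bs" "distinct (as @ [u])" "distinct (v # bs)" using vs(5) dec by auto
  \<comment> \<open>The edges before \<open>u\<close> are counted, not weighed: nothing bounds their
    weights, but the vertices before \<open>u\<close> are distinct and lie in a ball.\<close>
  have a1: "card (path_edges (as @ [u])) \<le> (4 * r + 1) ^ CARD('d)"
  proof -
    have "card (path_edges (as @ [u])) = card (set as)"
      using card_path_edges_distinct[OF dist(3)] distinct_card[OF dist(1)] by simp
    also have "\<dots> \<le> card (lball (0 :: int ^ 'd) (2 * r))" using u(2) by (intro card_mono) auto
    also have "\<dots> \<le> (2 * (2 * r) + 1) ^ CARD('d)" by (rule card_lball)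
    finally show ?thesis by simp
  qed
  have a2: "card (path_edges (v # bs)) \<le> (4 * r + 1) ^ CARD('d)"
  proof -
    have "card (path_edges (v # bs)) = card (set bs)"
      using card_path_edges_distinct[OF dist(4)] distinct_card[OF dist(2)] by simp
    also have "\<dots> \<le> card (lball x (2 * r))" using v(2) by (intro card_mono) (auto simp: bs_def)
    also have "\<dots> \<le> (2 * (2 * r) + 1) ^ CARD('d)" by (rule card_lball)
    finally show ?thesis by simp
  qed
  have "{e \<in> \<gamma>. \<epsilon> < t e} \<subseteq> path_edges (as @ [u]) \<union> ?H \<union> path_edges (v # bs)" using pe by blast
  then have "card {e \<in> \<gamma>. \<epsilon> < t e} \<le> card (path_edges (as @ [u]) \<union> ?H \<union> path_edges (v # bs))"
    by (intro card_mono) (auto simp: finite_path_edges)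
  also have "\<dots> \<le> card (path_edges (as @ [u])) + card ?H + card (path_edges (v # bs))"
    by (meson add_le_mono card_Un_le le_refl le_trans)
  also have "\<dots> \<le> 2 * (4 * r + 1) ^ CARD('d) + card ?H" using a1 a2 by simp
  finally have "real (card {e \<in> \<gamma>. \<epsilon> < t e}) \<le> real (2 * (4 * r + 1) ^ CARD('d) + card ?H)" by (rule of_nat_mono)
  then have "\<epsilon> * card {e \<in> \<gamma>. \<epsilon> < t e} \<le> \<epsilon> * real (2 * (4 * r + 1) ^ CARD('d) + card ?H)"
    using \<epsilon> by (rule mult_left_mono)
  then show ?thesis using H by (simp add: algebra_simps)
qed

section \<open>Independent fields and the Peierls argument\<close>

text \<open>Stated for functions of total configurations, so that \<open>h\<close> can also be
  applied to a configuration restricted to \<open>E\<close>, which is a point of the product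
  space.\<close>

definition depends_on :: "'e set \<Rightarrow> (('e \<Rightarrow> 'b) \<Rightarrow> 'c) \<Rightarrow> bool" where
  "depends_on E h \<longleftrightarrow> (\<forall>s t. (\<forall>e\<in>E. s e = t e) \<longrightarrow> h s = h t)"

lemma depends_onD: "depends_on E h \<Longrightarrow> (\<And>e. e \<in> E \<Longrightarrow> s e = t e) \<Longrightarrow> h s = h t"
  by (simp add: depends_on_def)

lemma depends_on_restrict: "depends_on E h \<Longrightarrow> h (restrict t E) = h t"
  by (rule depends_onD) auto

lemma depends_on_mono: "depends_on E h \<Longrightarrow> E \<subseteq> E' \<Longrightarrow> depends_on E' h"
  by (auto simp: depends_on_def)

definition lattice_auto :: "(int ^ 'd::finite \<Rightarrow> int ^ 'd) \<Rightarrow> bool" where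
  "lattice_auto \<phi> \<longleftrightarrow> bij \<phi> \<and> (\<forall>x y. lattice_adj (\<phi> x) (\<phi> y) = lattice_adj x y)"

lemma lattice_auto_edge: "lattice_auto \<phi> \<Longrightarrow> e \<in> lattice_edges \<Longrightarrow> \<phi> ` e \<in> lattice_edges"
  by (auto simp: lattice_auto_def lattice_edge_iff elim!: lattice_edge_cases)

lemma lattice_auto_inj_image: "lattice_auto \<phi> \<Longrightarrow> \<phi> ` e = \<phi> ` e' \<longleftrightarrow> e = e'"
  by (auto simp: lattice_auto_def bij_def inj_image_eq_iff)

lemma lattice_edges_nonempty: "lattice_edges \<noteq> ({} :: (int ^ 'd::finite) set set)"
proof -
  have "lattice_adj 0 (0 + axis undefined 1 :: int ^ 'd)" unfolding lattice_adj_iff_axis by blast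
  then show ?thesis by (auto simp: lattice_edge_iff[symmetric])
qed

definition npaths :: "nat \<Rightarrow> int ^ 'd::finite \<Rightarrow> (int ^ 'd) list set" where
  "npaths n v = {vs. length vs = Suc n \<and> hd vs = v \<and> successively lattice_adj vs}"

lemma npaths: "finite (npaths n v)" "card (npaths n (v :: int ^ 'd::finite)) \<le> (2 * CARD('d)) ^ n"
proof -
  have "finite (npaths n v) \<and> card (npaths n v) \<le> (2 * CARD('d)) ^ n"
  proof (induction n arbitrary: v)
    case 0
    have "npaths 0 v = {[v]}" by (auto simp: npaths_def length_Suc_conv)
    then show ?case by simp
  next
    case (Suc n)
    let ?N = "{y. lattice_adj v y}"
    have sub: "npaths (Suc n) v \<subseteq> (#) v ` (\<Union>y\<in>?N. npaths n y)"
    proof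
      fix vs assume vs: "vs \<in> npaths (Suc n) v"
      then obtain ws where ws: "vs = v # ws" "length ws = Suc n" by (cases vs) (auto simp: npaths_def)
      then have "ws \<noteq> []" by auto
      then have "ws \<in> npaths n (hd ws)" "lattice_adj v (hd ws)"
        using vs ws by (auto simp: npaths_def successively_Cons)
      then show "vs \<in> (#) v ` (\<Union>y\<in>?N. npaths n y)" using ws(1) by blast
    qed
    have fin: "finite (\<Union>y\<in>?N. npaths n y)" using Suc neighbours(1) by auto
    have "card (npaths (Suc n) v) \<le> card (\<Union>y\<in>?N. npaths n y)"
      using sub fin by (meson card_image_le card_mono finite_imageI le_trans)
    also have "\<dots> \<le> (\<Sum>y\<in>?N. card (npaths n y))" by (rule card_UN_le[OF neighbours(1)])
    also have "\<dots> \<le> (\<Sum>y\<in>?N. (2 * CARD('d)) ^ n)" using Suc by (intro sum_mono) blast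
    also have "\<dots> \<le> (2 * CARD('d)) ^ Suc n" using neighbours(2)[of v] by simp
    finally show ?case using sub fin finite_subset by blast
  qed
  then show "finite (npaths n v)" "card (npaths n v) \<le> (2 * CARD('d)) ^ n" by auto
qed

lemma finite_distinct_npaths [simp]: "finite {vs \<in> npaths n v. distinct vs}"
  by (rule finite_subset[OF _ npaths(1)]) auto

text \<open>Sites are coloured by their coordinates mod \<open>D\<close>, which uses at most
  \<open>D ^ CARD('d)\<close> colours. A frequent colour gives the subset, as distinct sites of one
  colour differ by a nonzero multiple of \<open>D\<close> in some coordinate.\<close>

lemma separated_subset:
  fixes V :: "(int ^ 'd::finite) set"
  assumes V: "finite V" and D: "D \<ge> 1"
  shows "\<exists>V'\<subseteq>V. card V \<le> D ^ CARD('d) * card V' \<and> (\<forall>v\<in>V'. \<forall>v'\<in>V'. v \<noteq> v' \<longrightarrow> D \<le> l1 (v - v'))"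
proof -
  define col where "col v = (\<chi> i. v $ i mod int D)" for v :: "int ^ 'd"
  let ?C = "col ` V"
  let ?cls = "\<lambda>c. {v \<in> V. col v = c}"
  have "?C \<subseteq> vec_lambda ` (PiE UNIV (\<lambda>_. {0..<int D}))"
  proof (intro image_subsetI)
    fix v :: "int ^ 'd" have "(\<lambda>i. v $ i mod int D) \<in> PiE UNIV (\<lambda>_. {0..<int D})" using D by auto
    then show "col v \<in> vec_lambda ` (PiE UNIV (\<lambda>_. {0..<int D}))" unfolding col_def by blast
  qed
  moreover have finP: "finite (PiE (UNIV :: 'd set) (\<lambda>_. {0..<int D}))" by (intro finite_PiE) auto
  ultimately have "card ?C \<le> card (PiE (UNIV :: 'd set) (\<lambda>_. {0..<int D}))"
    by (meson card_image_le card_mono finite_imageI le_trans)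
  also have "\<dots> = D ^ CARD('d)" by (subst card_PiE) auto
  finally have C: "card ?C \<le> D ^ CARD('d)" .
  have sum: "card V = (\<Sum>c\<in>?C. card (?cls c))"
  proof -
    have "card (\<Union>c\<in>?C. ?cls c) = (\<Sum>c\<in>?C. card (?cls c))"
      using V by (intro card_UN_disjoint) auto
    moreover have "(\<Union>c\<in>?C. ?cls c) = V" by auto
    ultimately show ?thesis by simp
  qed
  have "\<exists>c. card V \<le> D ^ CARD('d) * card (?cls c)"
  proof (rule ccontr)
    assume "\<not> ?thesis"
    then have less: "D ^ CARD('d) * card (?cls c) < card V" for c by (auto simp: not_le)
    then have "V \<noteq> {}" by (metis card.empty not_less_zero)
    have "D ^ CARD('d) * card V = (\<Sum>c\<in>?C. D ^ CARD('d) * card (?cls c))"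
      unfolding sum_distrib_left[symmetric] using sum by simp
    also have "\<dots> < (\<Sum>c\<in>?C. card V)"
      using V \<open>V \<noteq> {}\<close> less by (intro sum_strict_mono) auto
    also have "\<dots> \<le> D ^ CARD('d) * card V" using C by simp
    finally show False by simp
  qed
  then obtain c where c: "card V \<le> D ^ CARD('d) * card (?cls c)" ..
  have "D \<le> l1 (v - v')" if v: "v \<in> ?cls c" "v' \<in> ?cls c" "v \<noteq> v'" for v v'
  proof -
    obtain i where i: "v $ i \<noteq> v' $ i" using v(3) by (auto simp: vec_eq_iff)
    have "col v $ i = col v' $ i" using v by simp
    then have "int D dvd v $ i - v' $ i" by (simp add: col_def mod_eq_dvd_iff)
    then have "int D \<le> \<bar>v $ i - v' $ i\<bar>" using i dvd_imp_le_int[of "v $ i - v' $ i" "int D"] by simp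
    then show ?thesis using abs_component_le_l1[of "v - v'" i] by simp
  qed
  then show ?thesis using c by (intro exI[of _ "?cls c"]) auto
qed

section \<open>Fields of independent, identically distributed edge variables\<close>

text \<open>The value space \<open>N\<close> is a parameter because the locale serves both the real
  weights and the Bernoulli variables of bond percolation.\<close>

locale iid_field = prob_space M
  for M :: "'w measure" and N :: "'b measure" and X :: "(int ^ 'd::finite) set \<Rightarrow> 'w \<Rightarrow> 'b" +
  assumes indep: "indep_vars (\<lambda>_. N) X lattice_edges"
    and ident: "\<And>e e'. e \<in> lattice_edges \<Longrightarrow> e' \<in> lattice_edges \<Longrightarrow> distr M N (X e) = distr M N (X e')"
begin

lemma measurable_X [measurable]: "e \<in> lattice_edges \<Longrightarrow> X e \<in> measurable M N"
  using indep by (simp add: indep_vars_def)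

lemma measurable_field:
  assumes "h \<in> measurable (PiM E (\<lambda>_. N)) L" "depends_on E h" "E \<subseteq> lattice_edges"
  shows "(\<lambda>\<omega>. h (\<lambda>e. X e \<omega>)) \<in> measurable M L"
proof -
  have "(\<lambda>\<omega>. \<lambda>e\<in>E. X e \<omega>) \<in> measurable M (PiM E (\<lambda>_. N))"
    using assms(3) by (intro measurable_restrict) auto
  from measurable_compose[OF this assms(1)] show ?thesis
    by (simp add: depends_on_restrict[OF assms(2)])
qed

lemma indep_local:
  assumes "\<And>j. j \<in> J \<Longrightarrow> E j \<subseteq> lattice_edges" "disjoint_family_on E J"
    and "\<And>j. j \<in> J \<Longrightarrow> h j \<in> measurable (PiM (E j) (\<lambda>_. N)) (L j)"
    and "\<And>j. j \<in> J \<Longrightarrow> depends_on (E j) (h j)"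
  shows "indep_vars L (\<lambda>j \<omega>. h j (\<lambda>e. X e \<omega>)) J"
proof -
  have "indep_vars (\<lambda>j. PiM (E j) (\<lambda>_. N)) (\<lambda>j \<omega>. restrict (\<lambda>e. X e \<omega>) (E j)) J"
    by (rule indep_vars_restrict[OF indep assms(1,2)])
  from indep_vars_compose2[OF this, of h L] assms(3)
  have "indep_vars L (\<lambda>j \<omega>. h j (restrict (\<lambda>e. X e \<omega>) (E j))) J" by blast
  then show ?thesis
    by (rule indep_vars_cong[THEN iffD1, rotated -1])
      (auto simp: depends_on_restrict[OF assms(4)])
qed

text \<open>By independence both joint laws are products of one-edge laws, and all one-edge laws
  agree.\<close>

lemma law_auto:
  assumes \<phi>: "lattice_auto \<phi>"
  shows "distr M (PiM lattice_edges (\<lambda>_. N)) (\<lambda>\<omega>. \<lambda>e\<in>lattice_edges. X (\<phi> ` e) \<omega>) =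
    distr M (PiM lattice_edges (\<lambda>_. N)) (\<lambda>\<omega>. \<lambda>e\<in>lattice_edges. X e \<omega>)"
proof -
  have ind: "indep_vars (\<lambda>_. N) (\<lambda>e. X (\<phi> ` e)) lattice_edges"
  proof -
    have dj: "disjoint_family_on (\<lambda>e. {\<phi> ` e}) lattice_edges"
      using lattice_auto_inj_image[OF \<phi>] by (auto simp: disjoint_family_on_def)
    show ?thesis
      using indep_local[of lattice_edges "\<lambda>e. {\<phi> ` e}" "\<lambda>e f. f (\<phi> ` e)" "\<lambda>_. N"] dj
        lattice_auto_edge[OF \<phi>] by (simp add: depends_on_def measurable_component_singleton)
  qed
  have 1: "distr M (PiM lattice_edges (\<lambda>_. N)) (\<lambda>\<omega>. \<lambda>e\<in>lattice_edges. X (\<phi> ` e) \<omega>) =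
      PiM lattice_edges (\<lambda>e. distr M N (X (\<phi> ` e)))"
    using indep_vars_iff_distr_eq_PiM'[of lattice_edges "\<lambda>e. X (\<phi> ` e)" "\<lambda>_. N"]
      lattice_edges_nonempty ind lattice_auto_edge[OF \<phi>] measurable_X by blast
  have 2: "distr M (PiM lattice_edges (\<lambda>_. N)) (\<lambda>\<omega>. \<lambda>e\<in>lattice_edges. X e \<omega>) =
      PiM lattice_edges (\<lambda>e. distr M N (X e))"
    using indep_vars_iff_distr_eq_PiM'[of lattice_edges X "\<lambda>_. N"]
      lattice_edges_nonempty indep measurable_X by blast
  show ?thesis unfolding 1 2
    by (rule PiM_cong) (auto intro!: ident lattice_auto_edge[OF \<phi>])
qed

lemma measurable_restrict_field:
  assumes "\<And>e. e \<in> lattice_edges \<Longrightarrow> f e \<in> lattice_edges"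
  shows "(\<lambda>\<omega>. \<lambda>e\<in>lattice_edges. X (f e) \<omega>) \<in> measurable M (PiM lattice_edges (\<lambda>_. N))"
  using assms by (intro measurable_restrict) auto

lemma expectation_auto:
  fixes h :: "((int ^ 'd) set \<Rightarrow> 'b) \<Rightarrow> real"
  assumes \<phi>: "lattice_auto \<phi>" and h: "h \<in> borel_measurable (PiM lattice_edges (\<lambda>_. N))"
    and loc: "depends_on lattice_edges h"
  shows "expectation (\<lambda>\<omega>. h (\<lambda>e. X (\<phi> ` e) \<omega>)) = expectation (\<lambda>\<omega>. h (\<lambda>e. X e \<omega>))"
proof -
  have m: "(\<lambda>\<omega>. \<lambda>e\<in>lattice_edges. X (\<phi> ` e) \<omega>) \<in> measurable M (PiM lattice_edges (\<lambda>_. N))"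
    "(\<lambda>\<omega>. \<lambda>e\<in>lattice_edges. X e \<omega>) \<in> measurable M (PiM lattice_edges (\<lambda>_. N))"
    using measurable_restrict_field[of "\<lambda>e. \<phi> ` e"] measurable_restrict_field[of "\<lambda>e. e"]
      lattice_auto_edge[OF \<phi>] by auto
  have "expectation (\<lambda>\<omega>. h (\<lambda>e\<in>lattice_edges. X (\<phi> ` e) \<omega>)) = expectation (\<lambda>\<omega>. h (\<lambda>e\<in>lattice_edges. X e \<omega>))"
    using integral_distr[OF m(1) h] integral_distr[OF m(2) h] law_auto[OF \<phi>] by simp
  then show ?thesis by (simp add: depends_on_restrict[OF loc])
qed

lemma prob_auto:
  assumes \<phi>: "lattice_auto \<phi>" and P: "Measurable.pred (PiM lattice_edges (\<lambda>_. N)) P"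
    and loc: "depends_on lattice_edges P"
  shows "prob {\<omega> \<in> space M. P (\<lambda>e. X (\<phi> ` e) \<omega>)} = prob {\<omega> \<in> space M. P (\<lambda>e. X e \<omega>)}"
proof -
  have m: "(\<lambda>\<omega>. \<lambda>e\<in>lattice_edges. X (\<phi> ` e) \<omega>) \<in> measurable M (PiM lattice_edges (\<lambda>_. N))"
    "(\<lambda>\<omega>. \<lambda>e\<in>lattice_edges. X e \<omega>) \<in> measurable M (PiM lattice_edges (\<lambda>_. N))"
    using measurable_restrict_field[of "\<lambda>e. \<phi> ` e"] measurable_restrict_field[of "\<lambda>e. e"]
      lattice_auto_edge[OF \<phi>] by auto
  let ?A = "{f \<in> space (PiM lattice_edges (\<lambda>_. N)). P f}"
  have A: "?A \<in> sets (PiM lattice_edges (\<lambda>_. N))" using P by (simp add: pred_def)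
  have "prob ((\<lambda>\<omega>. \<lambda>e\<in>lattice_edges. X (\<phi> ` e) \<omega>) -` ?A \<inter> space M) =
      prob ((\<lambda>\<omega>. \<lambda>e\<in>lattice_edges. X e \<omega>) -` ?A \<inter> space M)"
    using measure_distr[OF m(1) A] measure_distr[OF m(2) A] law_auto[OF \<phi>] by simp
  moreover have "(\<lambda>\<omega>. \<lambda>e\<in>lattice_edges. X (\<phi> ` e) \<omega>) -` ?A \<inter> space M = {\<omega> \<in> space M. P (\<lambda>e. X (\<phi> ` e) \<omega>)}"
    using measurable_space[OF m(1)] by (auto simp: depends_on_restrict[OF loc])
  moreover have "(\<lambda>\<omega>. \<lambda>e\<in>lattice_edges. X e \<omega>) -` ?A \<inter> space M = {\<omega> \<in> space M. P (\<lambda>e. X e \<omega>)}"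
    using measurable_space[OF m(2)] by (auto simp: depends_on_restrict[OF loc])
  ultimately show ?thesis by simp
qed

lemma prob_all_local:
  assumes V: "finite V" and W: "\<And>v. v \<in> V \<Longrightarrow> W v \<subseteq> lattice_edges"
    and Q: "\<And>v. v \<in> V \<Longrightarrow> Measurable.pred (PiM (W v) (\<lambda>_. N)) (Q v)" "\<And>v. v \<in> V \<Longrightarrow> depends_on (W v) (Q v)"
    and dj: "disjoint_family_on W V"
  shows "prob {\<omega> \<in> space M. \<forall>v\<in>V. Q v (\<lambda>e. X e \<omega>)} = (\<Prod>v\<in>V. prob {\<omega> \<in> space M. Q v (\<lambda>e. X e \<omega>)})"
proof (cases "V = {}")
  case True
  then show ?thesis by (simp add: prob_space)
next
  case False
  have "indep_vars (\<lambda>_. count_space UNIV) (\<lambda>v \<omega>. Q v (\<lambda>e. X e \<omega>)) V"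
    by (rule indep_local[OF W dj]) (use Q in auto)
  from indep_varsD_finite[OF this False V, of "\<lambda>_. {True}"]
  have "prob (\<Inter>v\<in>V. (\<lambda>\<omega>. Q v (\<lambda>e. X e \<omega>)) -` {True} \<inter> space M) =
     (\<Prod>v\<in>V. prob ((\<lambda>\<omega>. Q v (\<lambda>e. X e \<omega>)) -` {True} \<inter> space M))" by simp
  moreover have "(\<Inter>v\<in>V. (\<lambda>\<omega>. Q v (\<lambda>e. X e \<omega>)) -` {True} \<inter> space M) =
      {\<omega> \<in> space M. \<forall>v\<in>V. Q v (\<lambda>e. X e \<omega>)}" using False by auto
  moreover have "(\<lambda>\<omega>. Q v (\<lambda>e. X e \<omega>)) -` {True} \<inter> space M = {\<omega> \<in> space M. Q v (\<lambda>e. X e \<omega>)}" for v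
    by auto
  ultimately show ?thesis by simp
qed

end

section \<open>Rare local events\<close>

text \<open>Events at sites at distance at least \<open>D\<close> read disjoint sets of edges. Any
  finite set of sites contains at least the fraction \<open>1 / D ^ CARD('d)\<close> of its members
  with independent events, so the exponent in \<open>Q_small\<close> leaves a factor
  \<open>1 / (4 * CARD('d))\<close> per site. This beats the \<open>2 * CARD('d)\<close>
  continuations of a path by a factor 2.\<close>

locale rare_events = iid_field M N X
  for M :: "'w measure" and N :: "'b measure" and X :: "(int ^ 'd::finite) set \<Rightarrow> 'w \<Rightarrow> 'b" +
  fixes D :: nat and W :: "int ^ 'd \<Rightarrow> (int ^ 'd) set set" and Q :: "int ^ 'd \<Rightarrow> ((int ^ 'd) set \<Rightarrow> 'b) \<Rightarrow> bool"
  assumes D: "D \<ge> 1" and W: "\<And>v. W v \<subseteq> lattice_edges"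
    and Q_pred: "\<And>v. Measurable.pred (PiM (W v) (\<lambda>_. N)) (Q v)" and Q_dep: "\<And>v. depends_on (W v) (Q v)"
    and W_disj: "\<And>v v'. D \<le> l1 (v - v') \<Longrightarrow> W v \<inter> W v' = {}"
    and Q_small: "\<And>v. prob {\<omega> \<in> space M. Q v (\<lambda>e. X e \<omega>)} \<le> (1 / (4 * CARD('d))) ^ (D ^ CARD('d))"
begin

abbreviation Qset :: "'w \<Rightarrow> (int ^ 'd) set" where
  "Qset \<omega> \<equiv> {v. Q v (\<lambda>e. X e \<omega>)}"

lemma Q_event [measurable]: "Measurable.pred M (\<lambda>\<omega>. Q v (\<lambda>e. X e \<omega>))"
  by (rule measurable_field[OF Q_pred Q_dep W])

lemma subset_event: "finite V \<Longrightarrow> {\<omega> \<in> space M. V \<subseteq> Qset \<omega>} \<in> events"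
  unfolding subset_iff mem_Collect_eq by measurable

lemma peierls:
  assumes V: "finite V"
  shows "prob {\<omega> \<in> space M. V \<subseteq> Qset \<omega>} \<le> (1 / (4 * CARD('d))) ^ card V"
proof -
  let ?s = "1 / (4 * real CARD('d))"
  have c: "real CARD('d) \<ge> 1" by (simp add: Suc_le_eq)
  have "?s \<le> 1 / 1" by (rule frac_le) (use c in linarith)+
  then have s: "0 \<le> ?s" "?s \<le> 1" by (simp, simp only: div_by_1)
  obtain V' where V': "V' \<subseteq> V" "card V \<le> D ^ CARD('d) * card V'"
      "\<forall>v\<in>V'. \<forall>v'\<in>V'. v \<noteq> v' \<longrightarrow> D \<le> l1 (v - v')"
    using separated_subset[OF V D] by blast
  have fin: "finite V'" using V V'(1) finite_subset by blast
  have dj: "disjoint_family_on W V'" using V'(3) W_disj by (auto simp: disjoint_family_on_def)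
  have "prob {\<omega> \<in> space M. V \<subseteq> Qset \<omega>} \<le> prob {\<omega> \<in> space M. V' \<subseteq> Qset \<omega>}"
    using V'(1) subset_event[OF fin] by (intro finite_measure_mono) auto
  also have "{\<omega> \<in> space M. V' \<subseteq> Qset \<omega>} = {\<omega> \<in> space M. \<forall>v\<in>V'. Q v (\<lambda>e. X e \<omega>)}" by auto
  also have "prob \<dots> = (\<Prod>v\<in>V'. prob {\<omega> \<in> space M. Q v (\<lambda>e. X e \<omega>)})"
    by (rule prob_all_local[OF fin W Q_pred Q_dep dj])
  also have "\<dots> \<le> (\<Prod>v\<in>V'. ?s ^ (D ^ CARD('d)))" using Q_small by (intro prod_mono) auto
  also have "\<dots> = ?s ^ (D ^ CARD('d) * card V')" by (simp only: prod_constant power_mult)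
  also have "\<dots> \<le> ?s ^ card V" using V'(2) s by (rule power_decreasing)
  finally show ?thesis by simp
qed

lemma path_event: "{\<omega> \<in> space M. \<exists>vs\<in>npaths n v. distinct vs \<and> set vs \<subseteq> Qset \<omega>} \<in> events"
proof -
  have "{\<omega> \<in> space M. \<exists>vs\<in>npaths n v. distinct vs \<and> set vs \<subseteq> Qset \<omega>} =
      (\<Union>vs\<in>{vs \<in> npaths n v. distinct vs}. {\<omega> \<in> space M. set vs \<subseteq> Qset \<omega>})" by auto
  also have "\<dots> \<in> events" using subset_event by (intro sets.finite_UN) auto
  finally show ?thesis .
qed

text \<open>The sum itself is recorded, besides the probability of the union, because it bounds the
  expected number of bad paths in \<open>expectation_cluster\<close>.\<close>

lemma sum_paths:
  "(\<Sum>vs\<in>{vs \<in> npaths n v. distinct vs}. prob {\<omega> \<in> space M. set vs \<subseteq> Qset \<omega>}) \<le> (1 / 2) ^ Suc n"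
proof -
  let ?P = "{vs \<in> npaths n v. distinct vs}"
  have "(\<Sum>vs\<in>?P. prob {\<omega> \<in> space M. set vs \<subseteq> Qset \<omega>}) \<le> (\<Sum>vs\<in>?P. (1 / (4 * real CARD('d))) ^ Suc n)"
  proof (rule sum_mono)
    fix vs assume "vs \<in> ?P"
    then have "card (set vs) = Suc n" by (simp add: npaths_def distinct_card)
    then show "prob {\<omega> \<in> space M. set vs \<subseteq> Qset \<omega>} \<le> (1 / (4 * real CARD('d))) ^ Suc n"
      using peierls[of "set vs"] by simp
  qed
  also have "\<dots> = card ?P * (1 / (4 * real CARD('d))) ^ Suc n" by simp
  also have "\<dots> \<le> real ((2 * CARD('d)) ^ Suc n) * (1 / (4 * real CARD('d))) ^ Suc n"
  proof (rule mult_right_mono)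
    have "card ?P \<le> card (npaths n v)" using npaths(1) by (intro card_mono) auto
    also have "\<dots> \<le> (2 * CARD('d)) ^ n" by (rule npaths(2))
    also have "\<dots> \<le> (2 * CARD('d)) ^ Suc n" by (rule power_increasing) auto
    finally show "real (card ?P) \<le> real ((2 * CARD('d)) ^ Suc n)" by (rule of_nat_mono)
  qed simp
  also have "\<dots> = (2 * real CARD('d) * (1 / (4 * real CARD('d)))) ^ Suc n"
    by (simp only: power_mult_distrib of_nat_power of_nat_mult of_nat_numeral)
  also have "2 * real CARD('d) * (1 / (4 * real CARD('d))) = 1 / 2" by simp
  finally show ?thesis .
qed

lemma peierls_path:
  "prob {\<omega> \<in> space M. \<exists>vs\<in>npaths n v. distinct vs \<and> set vs \<subseteq> Qset \<omega>} \<le> (1 / 2) ^ Suc n"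
proof -
  have "{\<omega> \<in> space M. \<exists>vs\<in>npaths n v. distinct vs \<and> set vs \<subseteq> Qset \<omega>} =
      (\<Union>vs\<in>{vs \<in> npaths n v. distinct vs}. {\<omega> \<in> space M. set vs \<subseteq> Qset \<omega>})" by auto
  also have "prob \<dots> \<le> (\<Sum>vs\<in>{vs \<in> npaths n v. distinct vs}. prob {\<omega> \<in> space M. set vs \<subseteq> Qset \<omega>})"
    using subset_event by (intro finite_measure_subadditive_finite) auto
  also have "\<dots> \<le> (1 / 2) ^ Suc n" by (rule sum_paths)
  finally show ?thesis .
qed

end

section \<open>Crossings of annuli\<close>

definition oconn :: "(int ^ 'd::finite) set \<Rightarrow> (int ^ 'd) set set \<Rightarrow> int ^ 'd \<Rightarrow> int ^ 'd \<Rightarrow> bool" where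
  "oconn S U = (\<lambda>u v. lattice_adj u v \<and> u \<in> S \<and> v \<in> S \<and> {u, v} \<in> U)\<^sup>*\<^sup>*"

text \<open>The far endpoint lies exactly on the sphere and the connection stays in the ball, so the
  event reads only the edges inside \<open>lball c L2\<close>.\<close>

definition crossing :: "nat \<Rightarrow> nat \<Rightarrow> (int ^ 'd::finite) set set \<Rightarrow> int ^ 'd \<Rightarrow> bool" where
  "crossing L1 L2 U c \<longleftrightarrow> (\<exists>x y. l1 (x - c) \<le> L1 \<and> l1 (y - c) = L2 \<and> oconn (lball c L2) U x y)"

lemma oconn_trans: "oconn S U x y \<Longrightarrow> oconn S U y z \<Longrightarrow> oconn S U x z"
  by (simp add: oconn_def)

lemma oconn_sym: "oconn S U x y \<Longrightarrow> oconn S U y x"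
  unfolding oconn_def
proof (induction rule: rtranclp_induct)
  case (step y z)
  then show ?case
    by (intro converse_rtranclp_into_rtranclp[of _ z y x]) (auto simp: lattice_adj_sym insert_commute)
qed simp

lemma oconn_mono:
  assumes "oconn S U x y" "S \<subseteq> S'" "\<And>e. e \<in> U \<Longrightarrow> e \<in> lattice_edges \<Longrightarrow> e \<subseteq> S \<Longrightarrow> e \<in> U'"
  shows "oconn S' U' x y"
  using assms(1) unfolding oconn_def
proof (induction rule: rtranclp_induct)
  case (step y z)
  then have "lattice_adj y z \<and> y \<in> S' \<and> z \<in> S' \<and> {y, z} \<in> U'"
    using assms(2,3) by (auto simp: lattice_edge_iff)
  with step.IH show ?case by (rule rtranclp.rtrancl_into_rtrancl)
qed simp

lemma oconn_walk:
  assumes "vs \<in> walks S x y" "path_edges vs \<subseteq> U"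
  shows "oconn S U x y"
proof -
  have "successively (\<lambda>u v. lattice_adj u v \<and> {u, v} \<in> U) vs"
    using assms by (simp add: successively_path_edges walks_def)
  then have "successively (\<lambda>u v. lattice_adj u v \<and> u \<in> S \<and> v \<in> S \<and> {u, v} \<in> U) vs"
    by (rule successively_mono) (use assms(1) in \<open>auto simp: walks_def\<close>)
  then show ?thesis using assms successively_imp_rtranclp[of vs] by (auto simp: walks_def oconn_def)
qed

lemma oconn_imp_walk:
  assumes "oconn S U x y" "x \<in> S"
  obtains vs where "vs \<in> walks S x y" "path_edges vs \<subseteq> U"
proof -
  have "\<exists>vs\<in>walks S x y. path_edges vs \<subseteq> U"
    using assms(1) unfolding oconn_def
  proof (induction rule: converse_rtranclp_induct)
    case base
    show ?case
    proof (cases "y \<in> S")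
      case True
      then show ?thesis by (intro bexI[of _ "[y]"]) (auto simp: walks_single)
    next
      case False
      have "x = y \<or> y \<in> S" using assms(1) unfolding oconn_def by (cases rule: rtranclp.cases) auto
      then show ?thesis using False assms(2) by auto
    qed
  next
    case (step x z)
    then obtain vs where vs: "vs \<in> walks S z y" "path_edges vs \<subseteq> U" by blast
    then have "hd vs = z" "vs \<noteq> []" by (auto simp: walks_def)
    then obtain ws where "vs = z # ws" by (cases vs) auto
    then show ?case using vs step(1) by (intro bexI[of _ "x # vs"]) (auto intro: walks_Cons)
  qed
  then show ?thesis using that by blast
qed

lemma crossing_local:
  "crossing L1 L2 U c \<longleftrightarrow> crossing L1 L2 (U \<inter> {e \<in> lattice_edges. e \<subseteq> lball c L2}) c"
  unfolding crossing_def by (blast intro: oconn_mono)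

lemma finite_window [simp]: "finite {e \<in> lattice_edges. e \<subseteq> lball c r}"
  by (rule finite_subset[of _ "Pow (lball c r)"]) auto

lemma lattice_auto_shift: "lattice_auto (\<lambda>x. a + x)"
  by (auto simp: lattice_auto_def bij_plus_right)

lemma oconn_shift:
  assumes "oconn S {e. (\<lambda>x. a + x) ` e \<in> U} x y"
  shows "oconn ((\<lambda>x. a + x) ` S) U (a + x) (a + y)"
  using assms unfolding oconn_def
proof (induction rule: rtranclp_induct)
  case (step y z)
  then have "lattice_adj (a + y) (a + z) \<and> a + y \<in> (\<lambda>x. a + x) ` S \<and> a + z \<in> (\<lambda>x. a + x) ` S \<and> {a + y, a + z} \<in> U"
    by auto
  with step.IH show ?case by (rule rtranclp.rtrancl_into_rtrancl)
qed simp

lemma lball_shift: "(\<lambda>x. a + x) ` lball c r = lball (a + c) r"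
proof
  show "lball (a + c) r \<subseteq> (\<lambda>x. a + x) ` lball c r"
  proof
    fix y assume "y \<in> lball (a + c) r"
    then have "y - a \<in> lball c r" by (simp add: lball_def algebra_simps)
    then show "y \<in> (\<lambda>x. a + x) ` lball c r" by (intro image_eqI[of _ _ "y - a"]) auto
  qed
qed (auto simp: lball_def)

lemma crossing_shift: "crossing L1 L2 {e. (\<lambda>x. a + x) ` e \<in> U} c \<longleftrightarrow> crossing L1 L2 U (a + c)"
proof
  assume "crossing L1 L2 {e. (\<lambda>x. a + x) ` e \<in> U} c"
  then obtain x y where xy: "l1 (x - c) \<le> L1" "l1 (y - c) = L2"
      "oconn (lball c L2) {e. (\<lambda>x. a + x) ` e \<in> U} x y" by (auto simp: crossing_def)
  from oconn_shift[OF xy(3)] show "crossing L1 L2 U (a + c)"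
    unfolding crossing_def lball_shift using xy(1,2) by (intro exI[of _ "a + x"] exI[of _ "a + y"]) auto
next
  assume "crossing L1 L2 U (a + c)"
  then obtain x y where xy: "l1 (x - (a + c)) \<le> L1" "l1 (y - (a + c)) = L2" "oconn (lball (a + c) L2) U x y"
    by (auto simp: crossing_def)
  have U: "{e. (\<lambda>x. - a + x) ` e \<in> {e. (\<lambda>x. a + x) ` e \<in> U}} = U"
    by (auto simp: image_image)
  have xy3: "oconn (lball (a + c) L2) {e. (\<lambda>x. - a + x) ` e \<in> {e. (\<lambda>x. a + x) ` e \<in> U}} x y"
    using xy(3) by (simp only: U)
  have "oconn ((\<lambda>x. - a + x) ` lball (a + c) L2) {e. (\<lambda>x. a + x) ` e \<in> U} (- a + x) (- a + y)"
    by (rule oconn_shift[OF xy3])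
  then have "oconn (lball c L2) {e. (\<lambda>x. a + x) ` e \<in> U} (x - a) (y - a)"
    using lball_shift[of "- a" "a + c" L2] by simp
  then show "crossing L1 L2 {e. (\<lambda>x. a + x) ` e \<in> U} c"
    unfolding crossing_def using xy(1,2) by (intro exI[of _ "x - a"] exI[of _ "y - a"]) (auto simp: algebra_simps)
qed

text \<open>The walk is stopped at its first visit to the sphere; a step changes the distance to
  \<open>c\<close> by at most 1, so it cannot jump across.\<close>

lemma oconn_exit:
  assumes "oconn UNIV U x y" "l1 (x - c) \<le> L" "l1 (y - c) \<ge> L"
  shows "\<exists>y'. l1 (y' - c) = L \<and> oconn (lball c L) U x y'"
  using assms(1,2) unfolding oconn_def
proof (induction rule: converse_rtranclp_induct)
  case base
  then show ?case using assms(3) by (intro exI[of _ y]) auto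
next
  case (step x z)
  show ?case
  proof (cases "l1 (x - c) = L")
    case True
    then show ?thesis by (intro exI[of _ x]) auto
  next
    case False
    then have l: "l1 (z - c) \<le> L"
      using step.prems step.hyps(1) l1_diff_triangle[of z c x]
      by (simp add: lattice_adj_iff_l1 l1_minus_commute[of x])
    then obtain y' where y': "l1 (y' - c) = L"
        "(\<lambda>u v. lattice_adj u v \<and> u \<in> lball c L \<and> v \<in> lball c L \<and> {u, v} \<in> U)\<^sup>*\<^sup>* z y'"
      using step.IH by blast
    have "lattice_adj x z \<and> x \<in> lball c L \<and> z \<in> lball c L \<and> {x, z} \<in> U"
      using step.hyps(1) step.prems l by (simp add: lball_def)
    then show ?thesis using y' by (intro exI[of _ y']) (auto intro: converse_rtranclp_into_rtranclp)
  qed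
qed

section \<open>Coarse-graining into blocks\<close>

definition block :: "nat \<Rightarrow> int ^ 'd::finite \<Rightarrow> int ^ 'd" where
  "block h x = (\<chi> i. x $ i div int h)"

lemma block_dist:
  assumes "h \<ge> 1"
  shows "l1 (x - int h *s block h (x :: int ^ 'd::finite)) \<le> CARD('d) * h"
proof -
  have "nat \<bar>(x - int h *s block h x) $ i\<bar> \<le> h" for i
  proof -
    have "(x - int h *s block h x) $ i = x $ i mod int h" by (simp add: block_def minus_mult_div_eq_mod)
    then show ?thesis using assms pos_mod_bound[of "int h" "x $ i"] pos_mod_sign[of "int h" "x $ i"] by linarith
  qed
  then have "l1 (x - int h *s block h x) \<le> (\<Sum>i\<in>(UNIV :: 'd set). h)" unfolding l1_def by (rule sum_mono)
  then show ?thesis by simp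
qed

lemma block_adj:
  assumes h: "h \<ge> 1" and xy: "lattice_adj x y"
  shows "block h x = block h y \<or> lattice_adj (block h x) (block h y)"
proof -
  obtain i s where s: "s = 1 \<or> s = -1" "y = x + axis i s" using xy unfolding lattice_adj_iff_axis by blast
  have up: "(a + 1) div int h = a div int h \<or> (a + 1) div int h = a div int h + 1" for a
  proof -
    have "a div int h \<le> (a + 1) div int h" using h by (intro zdiv_mono1) auto
    moreover have "(a + 1) div int h \<le> (a + int h) div int h" using h by (intro zdiv_mono1) auto
    moreover have "(a + int h) div int h = a div int h + 1" using h by simp
    ultimately show ?thesis by linarith
  qed
  define \<delta> where "\<delta> = (x $ i + s) div int h - x $ i div int h"
  have "\<delta> = 0 \<or> \<delta> = 1 \<or> \<delta> = -1"
    using s(1) up[of "x $ i"] up[of "x $ i - 1"] by (auto simp: \<delta>_def)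
  moreover have "block h y = block h x + axis i \<delta>"
    by (simp add: s(2) block_def vec_eq_iff axis_def \<delta>_def)
  ultimately show ?thesis
    unfolding lattice_adj_iff_axis by (auto simp: vec_eq_iff axis_def)
qed

lemma open_cluster_oconn:
  assumes "y \<in> open_cluster \<eta>"
  shows "oconn UNIV {e. \<eta> e} 0 y"
proof -
  obtain vs where vs: "saw 0 y vs" "\<forall>e\<in>path_edges vs. \<eta> e"
    using assms by (auto simp: open_cluster_def saw_paths_def)
  then have "vs \<in> walks UNIV 0 y" by (simp add: saw_def walks_def)
  then show ?thesis using oconn_walk vs(2) by blast
qed

text \<open>An infinite cluster leaves every bounded region, so each block it visits sees a
  crossing. The visited blocks form a connected set, since neighbouring sites lie in equal or
  adjacent blocks, and they reach beyond distance \<open>n\<close>; so they contain a self-avoiding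
  path of \<open>n\<close> steps from 0. The inner radius \<open>CARD('d) * h\<close> is the
  distance bound of \<open>block_dist\<close>.\<close>

lemma infinite_cluster_crossings:
  fixes \<eta> :: "(int ^ 'd::finite) set \<Rightarrow> bool"
  assumes inf: "infinite (open_cluster \<eta>)" and h: "h \<ge> 1" and A: "A \<ge> 1"
  shows "\<exists>vs\<in>npaths n 0. distinct vs \<and>
    set vs \<subseteq> {v. crossing (CARD('d) * h) (A * CARD('d) * h) {e. \<eta> e} (int h *s v)}"
proof -
  let ?U = "{e. \<eta> e}"
  let ?V = "block h ` {x. oconn UNIV ?U 0 x}"
  have far: "\<exists>y. oconn UNIV ?U 0 y \<and> l1 (y - c) > L" for c L
  proof (rule ccontr)
    assume "\<not> ?thesis"
    then have "open_cluster \<eta> \<subseteq> lball c L" using open_cluster_oconn by (force simp: lball_def not_less)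
    then show False using inf finite_subset finite_lball by blast
  qed
  have cr: "crossing (CARD('d) * h) (A * CARD('d) * h) ?U (int h *s v)" if vV: "v \<in> ?V" for v
  proof -
    obtain x where x: "oconn UNIV ?U 0 x" "v = block h x" using vV by blast
    obtain y where y: "oconn UNIV ?U 0 y" "l1 (y - int h *s v) > A * CARD('d) * h" using far by blast
    have "oconn UNIV ?U x y" by (rule oconn_trans[OF oconn_sym[OF x(1)] y(1)])
    moreover have d: "l1 (x - int h *s v) \<le> CARD('d) * h" using block_dist[OF h] x(2) by simp
    moreover have "l1 (x - int h *s v) \<le> A * CARD('d) * h"
      using d by (rule le_trans) (use A in simp)
    ultimately obtain y' where "l1 (y' - int h *s v) = A * CARD('d) * h" "oconn (lball (int h *s v) (A * CARD('d) * h)) ?U x y'"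
      using oconn_exit[of ?U x y "int h *s v" "A * CARD('d) * h"] less_imp_le[OF y(2)] by blast
    then show ?thesis unfolding crossing_def using d by blast
  qed
  have V: "conn ?V (block h 0) (block h x)" if xc: "oconn UNIV ?U 0 x" for x
    using xc[unfolded oconn_def]
  proof (induction rule: rtranclp_induct)
    case (step y z)
    have 0: "oconn UNIV ?U 0 y" using step.hyps(1) by (simp add: oconn_def)
    have "oconn UNIV ?U y z" using step.hyps(2) by (auto simp: oconn_def)
    with 0 have "oconn UNIV ?U 0 z" by (rule oconn_trans)
    with 0 have in_V: "block h y \<in> ?V" "block h z \<in> ?V" by blast+
    have "conn ?V (block h y) (block h z)"
      using block_adj[OF h, of y z] step.hyps(2) in_V by (auto intro: conn_step)
    with step.IH show ?case by (rule conn_trans)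
  qed simp
  have b0: "block h 0 = 0" by (simp add: block_def vec_eq_iff)
  \<comment> \<open>This far out, the block of \<open>y\<close> is at distance greater than
    \<open>n\<close> even after \<open>CARD('d) * h\<close> is lost to rounding.\<close>
  obtain y where y: "oconn UNIV ?U 0 y" "l1 (y - 0) > h * n + CARD('d) * h" using far by blast
  have "l1 y \<le> l1 (int h *s block h y) + l1 (y - int h *s block h y)"
    using l1_triangle[of "int h *s block h y" "y - int h *s block h y"] by simp
  also have "\<dots> \<le> h * l1 (block h y) + CARD('d) * h"
    using block_dist[OF h, of y] by (simp add: l1_scale)
  moreover have "l1 y > h * n + CARD('d) * h" using y(2) by simp
  ultimately have "h * n < h * l1 (block h y)" by linarith
  then have ny: "n < l1 (block h y)" by simp
  have "oconn UNIV ?U 0 0" by (simp add: oconn_def)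
  then have "block h 0 \<in> ?V" by blast
  then obtain vs where vs: "vs \<in> walks ?V 0 (block h y)" "distinct vs"
    using conn_imp_saw[OF V[OF y(1)]] b0 by metis
  have len: "length vs \<ge> Suc n" using walks_length[OF vs(1)] ny by simp
  let ?ws = "take (Suc n) vs"
  have "successively lattice_adj ?ws"
    using vs(1) successively_append_iff[of lattice_adj ?ws "drop (Suc n) vs"] by (simp add: walks_def)
  then have "?ws \<in> npaths n 0" using vs(1) len by (auto simp: npaths_def walks_def)
  moreover have "set ?ws \<subseteq> ?V" using set_take_subset[of "Suc n" vs] vs(1) by (auto simp: walks_def)
  ultimately show ?thesis using cr vs(2) by (intro bexI[of _ ?ws]) auto
qed

section \<open>Finite patterns of open edges\<close>

lemma pred_component:
  assumes "e \<in> W" "Measurable.pred N b"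
  shows "Measurable.pred (PiM W (\<lambda>_. N)) (\<lambda>f. b (f e))"
  using measurable_compose[OF measurable_component_singleton[of e W "\<lambda>_. N"], of b "count_space UNIV"] assms
  by simp

lemma pred_finite_pattern:
  assumes W: "finite W" and b: "Measurable.pred N b"
  shows "Measurable.pred (PiM W (\<lambda>_. N)) (\<lambda>f. P {e \<in> W. b (f e)})"
proof -
  have "Measurable.pred (PiM W (\<lambda>_. N)) (\<lambda>f. \<exists>U\<in>{U \<in> Pow W. P U}. \<forall>e\<in>W. b (f e) = (e \<in> U))"
  proof (intro pred_intros_finite)
    fix U e assume "e \<in> W"
    then have "Measurable.pred (PiM W (\<lambda>_. N)) (\<lambda>f. b (f e))"
      by (rule pred_component[OF _ b])
    then show "Measurable.pred (PiM W (\<lambda>_. N)) (\<lambda>f. b (f e) = (e \<in> U))"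
      by (cases "e \<in> U") auto
  qed (use W in auto)
  moreover have "(\<exists>U\<in>{U \<in> Pow W. P U}. \<forall>e\<in>W. b (f e) = (e \<in> U)) \<longleftrightarrow> P {e \<in> W. b (f e)}" for f
  proof
    assume "\<exists>U\<in>{U \<in> Pow W. P U}. \<forall>e\<in>W. b (f e) = (e \<in> U)"
    then obtain U where "U \<subseteq> W" "P U" "\<forall>e\<in>W. b (f e) = (e \<in> U)" by blast
    moreover from this have "{e \<in> W. b (f e)} = U" by blast
    ultimately show "P {e \<in> W. b (f e)}" by simp
  qed (intro bexI[of _ "{e \<in> W. b (f e)}"], auto)
  ultimately show ?thesis by simp
qed

text \<open>The probability that the set of open edges in \<open>E\<close> satisfies
  \<open>P\<close>, when edges are open independently with probability \<open>p\<close>. The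
  explicit form is there for its continuity in \<open>p\<close>.\<close>

definition pattern_poly :: "'e set \<Rightarrow> ('e set \<Rightarrow> bool) \<Rightarrow> real \<Rightarrow> real" where
  "pattern_poly E P p = (\<Sum>U\<in>{U \<in> Pow E. P U}. p ^ card U * (1 - p) ^ card (E - U))"

lemma continuous_pattern_poly: "isCont (pattern_poly E P) p"
  unfolding pattern_poly_def by (intro continuous_intros)

context iid_field
begin

lemma prob_pattern:
  assumes E: "finite E" "E \<subseteq> lattice_edges" and b: "Measurable.pred N b"
    and p: "\<And>e. e \<in> E \<Longrightarrow> prob {\<omega> \<in> space M. b (X e \<omega>)} = p"
  shows "prob {\<omega> \<in> space M. P {e \<in> E. b (X e \<omega>)}} = pattern_poly E P p"
proof -
  have bX: "Measurable.pred M (\<lambda>\<omega>. b (X e \<omega>))" if "e \<in> E" for e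
    using measurable_compose[OF measurable_X b] that E by blast
  have one: "prob {\<omega> \<in> space M. \<forall>e\<in>E. b (X e \<omega>) = (e \<in> U)} = p ^ card U * (1 - p) ^ card (E - U)"
    if U: "U \<in> Pow E" for U
  proof -
    have "prob {\<omega> \<in> space M. \<forall>e\<in>E. b (X e \<omega>) = (e \<in> U)} =
        (\<Prod>e\<in>E. prob {\<omega> \<in> space M. b (X e \<omega>) = (e \<in> U)})"
    proof (rule prob_all_local[where W = "\<lambda>e. {e}" and Q = "\<lambda>e f. b (f e) = (e \<in> U)", OF E(1)])
      fix e :: "(int ^ 'd) set"
      have "Measurable.pred (PiM {e} (\<lambda>_. N)) (\<lambda>f. b (f e))"
        by (rule pred_component[OF _ b]) simp
      then show "Measurable.pred (PiM {e} (\<lambda>_. N)) (\<lambda>f. b (f e) = (e \<in> U))" by (cases "e \<in> U") auto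
    qed (use E(2) in \<open>auto simp: depends_on_def disjoint_family_on_def\<close>)
    also have "\<dots> = (\<Prod>e\<in>E. if e \<in> U then p else 1 - p)"
    proof (rule prod.cong[OF refl])
      fix e assume e: "e \<in> E"
      have "prob {\<omega> \<in> space M. \<not> b (X e \<omega>)} = 1 - p"
        using prob_neg[of "\<lambda>\<omega>. b (X e \<omega>)"] bX[OF e] p[OF e] by (simp add: pred_def)
      then show "prob {\<omega> \<in> space M. b (X e \<omega>) = (e \<in> U)} = (if e \<in> U then p else 1 - p)"
        using p[OF e] by simp
    qed
    also have "\<dots> = (\<Prod>e\<in>U. p) * (\<Prod>e\<in>E - U. 1 - p)"
    proof -
      have "E \<inter> U = U" "E \<inter> - U = E - U" using U by auto
      then show ?thesis using prod.If_cases[OF E(1), of "\<lambda>e. e \<in> U" "\<lambda>_. p" "\<lambda>_. 1 - p"] by simp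
    qed
    finally show ?thesis by simp
  qed
  have "{\<omega> \<in> space M. P {e \<in> E. b (X e \<omega>)}} =
      (\<Union>U\<in>{U \<in> Pow E. P U}. {\<omega> \<in> space M. \<forall>e\<in>E. b (X e \<omega>) = (e \<in> U)})"
  proof -
    have *: "(\<forall>e\<in>E. b (X e \<omega>) = (e \<in> U)) \<longleftrightarrow> U = {e \<in> E. b (X e \<omega>)}" if "U \<in> Pow E" for U \<omega>
      using that by auto
    then show ?thesis by auto
  qed
  also have "prob \<dots> = (\<Sum>U\<in>{U \<in> Pow E. P U}. prob {\<omega> \<in> space M. \<forall>e\<in>E. b (X e \<omega>) = (e \<in> U)})"
  proof (rule finite_measure_finite_Union)
    show "finite {U \<in> Pow E. P U}" using E(1) by auto
    have "{\<omega> \<in> space M. \<forall>e\<in>E. b (X e \<omega>) = (e \<in> U)} \<in> events" for U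
    proof -
      have "Measurable.pred M (\<lambda>\<omega>. \<forall>e\<in>E. b (X e \<omega>) = (e \<in> U))"
      proof (intro pred_intros_finite E(1))
        fix e assume "e \<in> E"
        then show "Measurable.pred M (\<lambda>\<omega>. b (X e \<omega>) = (e \<in> U))" using bX by (cases "e \<in> U") auto
      qed
      then show ?thesis by (simp add: pred_def)
    qed
    then show "(\<lambda>U. {\<omega> \<in> space M. \<forall>e\<in>E. b (X e \<omega>) = (e \<in> U)}) ` {U \<in> Pow E. P U} \<subseteq> events" by blast
    show "disjoint_family_on (\<lambda>U. {\<omega> \<in> space M. \<forall>e\<in>E. b (X e \<omega>) = (e \<in> U)}) {U \<in> Pow E. P U}"
      by (auto simp: disjoint_family_on_def)
  qed
  also have "\<dots> = pattern_poly E P p" unfolding pattern_poly_def by (intro sum.cong refl one) auto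
  finally show ?thesis .
qed

lemma crossing_pred:
  assumes b: "Measurable.pred N b" and E: "E = {e \<in> lattice_edges. e \<subseteq> lball c L2}"
  shows "Measurable.pred (PiM E (\<lambda>_. N)) (\<lambda>f. crossing L1 L2 {e. b (f e)} c)"
    "depends_on E (\<lambda>f. crossing L1 L2 {e. b (f e)} c)"
proof -
  have eq: "crossing L1 L2 {e. b (f e)} c \<longleftrightarrow> crossing L1 L2 {e \<in> E. b (f e)} c" for f
  proof -
    have "{e. b (f e)} \<inter> E = {e \<in> E. b (f e)}" by blast
    then show ?thesis using crossing_local[of L1 L2 "{e. b (f e)}" c] by (simp only: E)
  qed
  show "Measurable.pred (PiM E (\<lambda>_. N)) (\<lambda>f. crossing L1 L2 {e. b (f e)} c)"
    unfolding eq by (rule pred_finite_pattern[OF _ b]) (simp add: E)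
  show "depends_on E (\<lambda>f. crossing L1 L2 {e. b (f e)} c)"
    unfolding depends_on_def eq by (intro allI impI) (metis (mono_tags, lifting) Collect_cong)
qed

text \<open>A crossing of the annulus around \<open>int h *s v\<close> serves as the rare event at
  block \<open>v\<close>. In block units these events have range
  \<open>2 * A * CARD('d) + 1\<close>, whatever \<open>h\<close> is, so one smallness condition
  excludes infinite clusters through \<open>peierls_path\<close>.\<close>

lemma finite_size_criterion:
  assumes b: "Measurable.pred N b" and h: "h \<ge> 1" and A: "A \<ge> 1"
    and small: "prob {\<omega> \<in> space M. crossing (CARD('d) * h) (A * CARD('d) * h) {e. b (X e \<omega>)} 0}
      \<le> (1 / (4 * CARD('d))) ^ ((2 * A * CARD('d) + 1) ^ CARD('d))"
    and event: "{\<omega> \<in> space M. infinite (open_cluster (\<lambda>e. b (X e \<omega>)))} \<in> events"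
  shows "prob {\<omega> \<in> space M. infinite (open_cluster (\<lambda>e. b (X e \<omega>)))} = 0"
proof -
  let ?L1 = "CARD('d) * h" and ?L2 = "A * CARD('d) * h"
  define W where "W v = {e \<in> lattice_edges. e \<subseteq> lball (int h *s v) ?L2}" for v :: "int ^ 'd"
  define Q where "Q v f = crossing ?L1 ?L2 {e. b (f e)} (int h *s v)" for v :: "int ^ 'd" and f
  have W_sub: "W v \<subseteq> lattice_edges" for v by (auto simp: W_def)
  have pred: "Measurable.pred (PiM (W v) (\<lambda>_. N)) (Q v)" "depends_on (W v) (Q v)" for v
    unfolding Q_def by (rule crossing_pred[OF b]; simp add: W_def)+
  interpret rare_events M N X "2 * A * CARD('d) + 1" W Q
  proof
    fix v v' :: "int ^ 'd" assume v: "2 * A * CARD('d) + 1 \<le> l1 (v - v')"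
    show "W v \<inter> W v' = {}"
    proof (rule ccontr)
      assume "W v \<inter> W v' \<noteq> {}"
      then obtain e where e: "e \<in> lattice_edges" "e \<subseteq> lball (int h *s v) ?L2" "e \<subseteq> lball (int h *s v') ?L2"
        by (auto simp: W_def)
      then obtain x where x: "x \<in> lball (int h *s v) ?L2" "x \<in> lball (int h *s v') ?L2"
        by (auto elim!: lattice_edge_cases)
      have "h * l1 (v - v') = l1 (int h *s v - int h *s v')"
        by (simp add: l1_scale[of "int h", simplified, symmetric] vector_ssub_ldistrib)
      also have "\<dots> \<le> 2 * ?L2"
        using x l1_diff_triangle[of "int h *s v" "int h *s v'" x]
        by (auto simp: lball_def l1_minus_commute[of "int h *s v"])
      also have "\<dots> = h * (2 * A * CARD('d))" by simp
      also have "\<dots> < h * (2 * A * CARD('d) + 1)" using h by simp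
      also have "\<dots> \<le> h * l1 (v - v')" using v by (rule mult_le_mono2)
      finally show False by simp
    qed
  next
    fix v :: "int ^ 'd"
    let ?a = "int h *s v"
    have "depends_on lattice_edges (Q 0)" by (rule depends_on_mono[OF pred(2) W_sub])
    moreover have "Measurable.pred (PiM lattice_edges (\<lambda>_. N)) (Q 0)"
    proof -
      have "(\<lambda>f. restrict f (W 0)) \<in> measurable (PiM lattice_edges (\<lambda>_. N)) (PiM (W 0) (\<lambda>_. N))"
        by (rule measurable_restrict_subset[OF W_sub])
      from measurable_compose[OF this pred(1)[of 0]] show ?thesis
        by (simp add: depends_on_restrict[OF pred(2)])
    qed
    ultimately have "prob {\<omega> \<in> space M. Q 0 (\<lambda>e. X ((\<lambda>x. ?a + x) ` e) \<omega>)} = prob {\<omega> \<in> space M. Q 0 (\<lambda>e. X e \<omega>)}"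
      by (intro prob_auto[OF lattice_auto_shift])
    moreover have "Q 0 (\<lambda>e. X ((\<lambda>x. ?a + x) ` e) \<omega>) = Q v (\<lambda>e. X e \<omega>)" for \<omega>
      using crossing_shift[of ?L1 ?L2 ?a "{e. b (X e \<omega>)}" 0] by (simp add: Q_def)
    ultimately have "prob {\<omega> \<in> space M. Q v (\<lambda>e. X e \<omega>)} = prob {\<omega> \<in> space M. Q 0 (\<lambda>e. X e \<omega>)}" by simp
    then show "prob {\<omega> \<in> space M. Q v (\<lambda>e. X e \<omega>)} \<le> (1 / (4 * CARD('d))) ^ ((2 * A * CARD('d) + 1) ^ CARD('d))"
      using small by (simp add: Q_def)
  qed (use W_sub pred in auto)
  have le: "prob {\<omega> \<in> space M. infinite (open_cluster (\<lambda>e. b (X e \<omega>)))} \<le> (1 / 2) ^ Suc n" for n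
  proof -
    have "{\<omega> \<in> space M. infinite (open_cluster (\<lambda>e. b (X e \<omega>)))} \<subseteq>
        {\<omega> \<in> space M. \<exists>vs\<in>npaths n 0. distinct vs \<and> set vs \<subseteq> Qset \<omega>}"
      using infinite_cluster_crossings[OF _ h A] by (auto simp: Q_def)
    then have "prob {\<omega> \<in> space M. infinite (open_cluster (\<lambda>e. b (X e \<omega>)))} \<le>
        prob {\<omega> \<in> space M. \<exists>vs\<in>npaths n 0. distinct vs \<and> set vs \<subseteq> Qset \<omega>}"
      by (intro finite_measure_mono path_event)
    also have "\<dots> \<le> (1 / 2) ^ Suc n" by (rule peierls_path)
    finally show ?thesis .
  qed
  have lim: "(\<lambda>n. (1 / 2 :: real) ^ Suc n) \<longlonglongrightarrow> 0" by (intro LIMSEQ_Suc LIMSEQ_power_zero) simp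
  have "prob {\<omega> \<in> space M. infinite (open_cluster (\<lambda>e. b (X e \<omega>)))} \<le> 0"
    by (rule LIMSEQ_le_const[OF lim]) (use le in blast)
  then show ?thesis using measure_nonneg by (rule antisym)
qed

end

lemma iid_bond_percolation:
  "iid_field (bond_percolation p) (measure_pmf (bernoulli_pmf p)) (\<lambda>(e :: (int ^ 'd::finite) set) \<eta>. \<eta> e)"
proof -
  let ?N = "measure_pmf (bernoulli_pmf p)"
  let ?M = "bond_percolation p :: ((int ^ 'd) set \<Rightarrow> bool) measure"
  have N: "prob_space ?N" by (rule prob_space_measure_pmf)
  interpret prob_space ?M unfolding bond_percolation_def by (rule prob_space_PiM[OF N])
  have comp: "distr ?M ?N (\<lambda>\<eta>. \<eta> e) = ?N" if "e \<in> lattice_edges" for e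
    unfolding bond_percolation_def by (rule distr_PiM_component[OF N that])
  have rv: "(\<lambda>\<eta>. \<eta> e) \<in> measurable ?M ?N" if "e \<in> lattice_edges" for e :: "(int ^ 'd) set"
    unfolding bond_percolation_def by (rule measurable_component_singleton[OF that])
  have "distr ?M (PiM lattice_edges (\<lambda>_. ?N)) (\<lambda>x. \<lambda>e\<in>lattice_edges. x e) = distr ?M ?M (\<lambda>x. x)"
    by (rule distr_cong) (auto simp: bond_percolation_def space_PiM PiE_restrict)
  also have "\<dots> = ?M" by simp
  also have "\<dots> = PiM lattice_edges (\<lambda>e. distr ?M ?N (\<lambda>\<eta>. \<eta> e))"
    unfolding bond_percolation_def[of p] by (rule PiM_cong) (simp_all add: comp[unfolded bond_percolation_def])
  finally have "indep_vars (\<lambda>_. ?N) (\<lambda>e \<eta>. \<eta> e) lattice_edges"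
    using indep_vars_iff_distr_eq_PiM'[of lattice_edges "\<lambda>e \<eta>. \<eta> e" "\<lambda>_. ?N"] lattice_edges_nonempty rv
    by blast
  then show ?thesis using comp by unfold_locales auto
qed

lemma crossing_pattern:
  "crossing L1 L2 {e. b (f e)} c \<longleftrightarrow>
    crossing L1 L2 {e \<in> {e \<in> lattice_edges. e \<subseteq> lball c L2}. b (f e)} c"
proof -
  have "{e. b (f e)} \<inter> {e \<in> lattice_edges. e \<subseteq> lball c L2} = {e \<in> {e \<in> lattice_edges. e \<subseteq> lball c L2}. b (f e)}"
    by blast
  then show ?thesis using crossing_local[of L1 L2 "{e. b (f e)}" c] by simp
qed

lemma crossing_all_open: "crossing L1 L2 {e \<in> lattice_edges. e \<subseteq> lball 0 L2} (0 :: int ^ 'd::finite)"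
proof -
  define y :: "int ^ 'd" where "y = axis undefined (int L2)"
  have y: "l1 (y - 0) = L2" by (simp add: y_def l1_axis)
  obtain vs where vs: "vs \<in> walks (lball 0 L2) 0 y" using exists_straight_walk'[of y 0 L2] y by auto
  have "path_edges vs \<subseteq> {e \<in> lattice_edges. e \<subseteq> lball 0 L2}"
    using vs walk_path_edges[of vs] path_edges_subset_set[of _ vs] by (fastforce simp: walks_def)
  from oconn_walk[OF vs this] y show ?thesis
    unfolding crossing_def by (intro exI[of _ 0] exI[of _ y]) simp
qed

text \<open>If the bound failed at \<open>p\<close>, continuity of \<open>pattern_poly\<close> would
  make it fail at some \<open>p' > p\<close>, where \<open>finite_size_criterion\<close> rules out
  percolation; but \<open>p'\<close> exceeds \<open>critical_prob\<close>, the supremum of such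
  values.\<close>

theorem crossing_probability_lower_bound:
  assumes "iid_field M N (X :: (int ^ 'd::finite) set \<Rightarrow> 'w \<Rightarrow> 'b)" and b: "Measurable.pred N b"
    and p: "\<And>e. e \<in> lattice_edges \<Longrightarrow> measure M {\<omega> \<in> space M. b (X e \<omega>)} = p"
    and pc: "critical_prob TYPE('d) \<le> p" and h: "h \<ge> 1" and A: "A \<ge> 1"
  shows "(1 / (4 * CARD('d))) ^ ((2 * A * CARD('d) + 1) ^ CARD('d)) \<le>
    measure M {\<omega> \<in> space M. crossing (CARD('d) * h) (A * CARD('d) * h) {e. b (X e \<omega>)} 0}"
proof (rule ccontr)
  let ?\<delta> = "(1 / (4 * real CARD('d))) ^ ((2 * A * CARD('d) + 1) ^ CARD('d))"
  let ?L1 = "CARD('d) * h" and ?L2 = "A * CARD('d) * h"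
  let ?E = "{e \<in> lattice_edges. e \<subseteq> lball (0 :: int ^ 'd) ?L2}"
  let ?P = "\<lambda>U. crossing ?L1 ?L2 U (0 :: int ^ 'd)"
  let ?q = "pattern_poly ?E ?P"
  interpret iid_field M N X by fact
  assume "\<not> ?thesis"
  moreover have "prob {\<omega> \<in> space M. ?P {e. b (X e \<omega>)}} = ?q p"
    unfolding crossing_pattern[of ?L1 ?L2 b] using p by (intro prob_pattern b) auto
  ultimately have qp: "?q p < ?\<delta>" by simp
  obtain e :: "(int ^ 'd) set" where e: "e \<in> lattice_edges" using lattice_edges_nonempty by blast
  have p01: "0 \<le> p" "p \<le> 1" using p[OF e] measure_nonneg[of M] prob_le_1 by metis+
  have "real CARD('d) \<ge> 1" by (simp add: Suc_le_eq)
  have "?\<delta> \<le> 1"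
  proof (rule power_le_one)
    have "1 / (4 * real CARD('d)) \<le> 1 / 1" by (rule frac_le) (use \<open>real CARD('d) \<ge> 1\<close> in linarith)+
    then show "1 / (4 * real CARD('d)) \<le> 1" by (simp only: div_by_1)
  qed simp
  \<comment> \<open>There must be room above \<open>p\<close>: with all edges open the annulus is
    crossed surely, so the polynomial is at least 1 there.\<close>
  have "p \<noteq> 1"
  proof
    assume "p = 1"
    have "(1 :: real) ^ card ?E * (1 - 1) ^ card (?E - ?E) \<le> ?q 1"
      unfolding pattern_poly_def
      by (rule member_le_sum[where f = "\<lambda>U. (1 :: real) ^ card U * (1 - 1) ^ card (?E - U)"])
        (use crossing_all_open in auto)
    then have "1 \<le> ?q 1" by simp
    then show False using qp \<open>p = 1\<close> \<open>?\<delta> \<le> 1\<close> by simp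
  qed
  have "eventually (\<lambda>p'. ?q p' < ?\<delta>) (at p)"
    using continuous_pattern_poly[where E = ?E and P = ?P and p = p] qp unfolding isCont_def by (rule order_tendstoD(2))
  then obtain r where r: "r > 0" "\<And>p'. p' \<noteq> p \<Longrightarrow> dist p' p < r \<Longrightarrow> ?q p' < ?\<delta>"
    unfolding eventually_at by blast
  define p' where "p' = min 1 (p + r / 2)"
  have p': "p < p'" "p' \<le> 1" "0 \<le> p'" "?q p' < ?\<delta>"
    using r p01 \<open>p \<noteq> 1\<close> by (auto simp: p'_def dist_real_def intro!: r(2))
  let ?B = "bond_percolation p' :: ((int ^ 'd) set \<Rightarrow> bool) measure"
  interpret B: iid_field ?B "measure_pmf (bernoulli_pmf p')" "\<lambda>e \<eta>. \<eta> e" by (rule iid_bond_percolation)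
  have bern: "B.prob {\<eta> \<in> space ?B. \<eta> e} = p'" if e: "e \<in> lattice_edges" for e
  proof -
    have "B.prob ((\<lambda>\<eta>. \<eta> e) -` {True} \<inter> space ?B) = measure (distr ?B (measure_pmf (bernoulli_pmf p')) (\<lambda>\<eta>. \<eta> e)) {True}"
      using B.measurable_X[OF e] by (subst measure_distr) auto
    also have "distr ?B (measure_pmf (bernoulli_pmf p')) (\<lambda>\<eta>. \<eta> e) = measure_pmf (bernoulli_pmf p')"
      unfolding bond_percolation_def by (rule distr_PiM_component[OF prob_space_measure_pmf e])
    also have "measure (measure_pmf (bernoulli_pmf p')) {True} = p'"
      using p' by (simp add: measure_pmf_single)
    finally show ?thesis by (simp add: vimage_def Int_def conj_commute)
  qed
  have pred: "Measurable.pred (measure_pmf (bernoulli_pmf p')) (\<lambda>x. x)" by simp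
  have "?P {e. \<eta> e} \<longleftrightarrow> ?P {e \<in> ?E. \<eta> e}" for \<eta>
    by (rule crossing_pattern[where b = "\<lambda>x. x"])
  then have "{\<eta> \<in> space ?B. ?P {e. \<eta> e}} = {\<eta> \<in> space ?B. ?P {e \<in> ?E. \<eta> e}}"
    by (intro Collect_cong conj_cong refl)
  moreover have "B.prob {\<eta> \<in> space ?B. ?P {e \<in> ?E. \<eta> e}} = ?q p'"
    by (rule B.prob_pattern[where b = "\<lambda>x. x", OF _ _ pred]) (use bern in auto)
  ultimately have "B.prob {\<eta> \<in> space ?B. ?P {e. \<eta> e}} = ?q p'" by (simp only:)
  then have "B.prob {\<eta> \<in> space ?B. infinite (open_cluster (\<lambda>e. \<eta> e))} = 0"
    by (intro B.finite_size_criterion[where b = "\<lambda>x. x", OF pred h A])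
      (use p'(4) in \<open>simp_all add: sets_percolation_event\<close>)
  then have "percolation_prob TYPE('d) p' = 0" by (simp add: percolation_prob_def)
  then have "p' \<le> critical_prob TYPE('d)"
    unfolding critical_prob_def using p' by (intro cSup_upper bdd_aboveI[of _ 1]) auto
  then show False using pc p'(1) by simp
qed

section \<open>Random detour weights\<close>

text \<open>Off \<open>E\<close> every point of the product space takes the value
  \<open>undefined\<close>, so the component is constant. This lets the measurability lemmas below
  hold for every \<open>E\<close>, with locality proved separately.\<close>

lemma measurable_any_component:
  "(\<lambda>f. f e) \<in> borel_measurable (PiM E (\<lambda>_. borel :: real measure))"
proof (cases "e \<in> E")
  case True
  then show ?thesis by (rule measurable_component_singleton)
next
  case False
  have "(\<lambda>f. f e) \<in> borel_measurable (PiM E (\<lambda>_. borel :: real measure)) \<longleftrightarrow>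
      (\<lambda>f. undefined :: real) \<in> borel_measurable (PiM E (\<lambda>_. borel :: real measure))"
    by (rule measurable_cong) (use False in \<open>auto simp: space_PiM PiE_def extensional_def\<close>)
  then show ?thesis by simp
qed

text \<open>Replacing the edges at \<open>v\<close> by the neighbours of \<open>v\<close> makes the
  quantifier finite, which gives measurability.\<close>

lemma bad_sites_iff: "v \<in> bad_sites K f \<longleftrightarrow> (\<exists>y\<in>{y. lattice_adj v y}. K < f {v, y})"
proof
  assume "v \<in> bad_sites K f"
  then obtain e where e: "e \<in> lattice_edges" "v \<in> e" "K < f e" by (auto simp: bad_sites_def)
  obtain x y where xy: "e = {x, y}" "lattice_adj x y" by (rule lattice_edge_cases[OF e(1)])
  then have "v = x \<or> v = y" using e(2) by simp
  then show "\<exists>y\<in>{y. lattice_adj v y}. K < f {v, y}"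
  proof
    assume "v = x" then show ?thesis using xy e(3) by (intro bexI[of _ y]) auto
  next
    assume "v = y" then show ?thesis using xy e(3) lattice_adj_sym[of x y]
      by (intro bexI[of _ x]) (auto simp: insert_commute)
  qed
next
  assume "\<exists>y\<in>{y. lattice_adj v y}. K < f {v, y}"
  then show "v \<in> bad_sites K f" by (auto simp: bad_sites_def lattice_edge_iff)
qed

lemma pred_bad_site:
  "Measurable.pred (PiM E (\<lambda>_. borel :: real measure)) (\<lambda>f. v \<in> bad_sites K f)"
  unfolding bad_sites_iff
proof (rule pred_intros_finite(4)[OF neighbours(1)])
  fix y show "Measurable.pred (PiM E (\<lambda>_. borel :: real measure)) (\<lambda>f. K < f {v, y})"
    using measurable_any_component[of "{v, y}" E] by measurable
qed

lemma pred_local_cluster: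
  "Measurable.pred (PiM E (\<lambda>_. borel :: real measure)) (\<lambda>f. y \<in> local_cluster (bad_sites K f) r v)"
proof -
  have "Measurable.pred (PiM E (\<lambda>_. borel :: real measure))
      (\<lambda>f. \<exists>vs\<in>{vs \<in> walks UNIV v y. length vs \<le> Suc r}. \<forall>u\<in>set vs. u \<in> bad_sites K f)"
    by (intro pred_intros_countable_bounded(4) pred_intros_finite(3) pred_bad_site) auto
  moreover have "y \<in> local_cluster (bad_sites K f) r v \<longleftrightarrow>
      (\<exists>vs\<in>{vs \<in> walks UNIV v y. length vs \<le> Suc r}. \<forall>u\<in>set vs. u \<in> bad_sites K f)" for f
    unfolding local_cluster_def walks_def by (simp add: subset_iff) blast
  ultimately show ?thesis by (simp only:)
qed

lemma measurable_card_local_cluster: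
  "(\<lambda>f. real (card (local_cluster (bad_sites K f) r v))) \<in> borel_measurable (PiM E (\<lambda>_. borel :: real measure))"
proof -
  have "real (card (local_cluster (bad_sites K f) r v)) =
      (\<Sum>y\<in>lball v r. of_bool (y \<in> local_cluster (bad_sites K f) r v))" for f
  proof -
    have "local_cluster (bad_sites K f) r v \<inter> lball v r = local_cluster (bad_sites K f) r v"
      using local_cluster_subset by blast
    then show ?thesis by (simp add: sum.If_cases of_bool_def Int_commute)
  qed
  moreover have "(\<lambda>f. \<Sum>y\<in>lball v r. of_bool (y \<in> local_cluster (bad_sites K f) r v) :: real)
      \<in> borel_measurable (PiM E (\<lambda>_. borel :: real measure))"
  proof (rule borel_measurable_sum)
    fix y
    show "(\<lambda>f. of_bool (y \<in> local_cluster (bad_sites K f) r v) :: real) \<in> borel_measurable (PiM E (\<lambda>_. borel))"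
      unfolding of_bool_def using pred_local_cluster[where E = E and y = y and K = K and r = r and v = v]
      by (intro measurable_If) (auto simp: pred_def)
  qed
  ultimately show ?thesis by simp
qed

lemma measurable_detour_weight:
  "(\<lambda>f. detour_weight K r f e) \<in> borel_measurable (PiM E (\<lambda>_. borel :: real measure))"
  unfolding detour_weight_def
  using measurable_any_component[of e E] measurable_card_local_cluster
  by (intro measurable_If borel_measurable_times borel_measurable_sum borel_measurable_const) auto

lemma measurable_cost:
  "(\<And>e. (\<lambda>f. w f e) \<in> borel_measurable L) \<Longrightarrow> (\<lambda>f. cost (w f) vs) \<in> borel_measurable L"
  by (induction vs rule: induct_list012) auto

lemma measurable_ptime:
  "(\<lambda>f. ptime S (detour_weight K r f) x y) \<in> borel_measurable (PiM E (\<lambda>_. borel :: real measure))"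
  unfolding ptime_def
  by (intro borel_measurable_cINF_real measurable_cost measurable_detour_weight) auto

section \<open>Locality of detour weights and passage times\<close>

text \<open>Edges that meet the ball, not only those inside it: whether a site is bad depends on all
  its edges.\<close>

definition window :: "int ^ 'd::finite \<Rightarrow> nat \<Rightarrow> (int ^ 'd) set set" where
  "window c r = {e \<in> lattice_edges. e \<inter> lball c r \<noteq> {}}"

lemma bad_sites_cong:
  "(\<And>e. e \<in> lattice_edges \<Longrightarrow> v \<in> e \<Longrightarrow> f e = g e) \<Longrightarrow> v \<in> bad_sites K f \<longleftrightarrow> v \<in> bad_sites K g"
  by (auto simp: bad_sites_def)

lemma local_cluster_cong:
  assumes "\<And>u. u \<in> lball v r \<Longrightarrow> u \<in> B \<longleftrightarrow> u \<in> B'"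
  shows "local_cluster B r v = local_cluster B' r v"
proof -
  have *: "local_cluster B r v \<subseteq> local_cluster B' r v"
    if BB: "\<And>u. u \<in> lball v r \<Longrightarrow> u \<in> B \<Longrightarrow> u \<in> B'" for B B' :: "(int ^ 'a) set"
  proof
    fix y assume "y \<in> local_cluster B r v"
    then obtain vs where vs: "vs \<in> walks B v y" "length vs \<le> Suc r" by (auto simp: local_cluster_def)
    have "u \<in> B'" if u: "u \<in> set vs" for u
    proof -
      obtain as bs where ab: "vs = as @ u # bs" using u by (auto simp: in_set_conv_decomp)
      then have "as @ [u] \<in> walks B v u" using walks_append_decomp(1) vs(1) by blast
      then have "l1 (u - v) \<le> length (as @ [u]) - 1" by (rule walks_length)
      then have "u \<in> lball v r" using vs(2) ab by (simp add: lball_def)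
      then show ?thesis using BB vs(1) u by (auto simp: walks_def)
    qed
    then show "y \<in> local_cluster B' r v" using vs unfolding local_cluster_def
      by (intro CollectI bexI[of _ vs]) (auto simp: walks_def)
  qed
  show ?thesis using *[of B B'] *[of B' B] assms by blast
qed

lemma detour_weight_cong:
  assumes e: "e \<in> lattice_edges" "e \<subseteq> lball c m"
    and fg: "\<And>e. e \<in> window c (m + r) \<Longrightarrow> f e = g e"
  shows "detour_weight K r f e = detour_weight K r g e"
proof -
  have sub: "lball v r \<subseteq> lball c (m + r)" if "v \<in> e" for v
    using e(2) that by (intro lball_subset) (auto simp: lball_def)
  have "local_cluster (bad_sites K f) r v = local_cluster (bad_sites K g) r v" if v: "v \<in> e" for v
  proof (rule local_cluster_cong, rule bad_sites_cong, rule fg)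
    fix u e' assume "u \<in> lball v r" "e' \<in> lattice_edges" "u \<in> e'"
    then show "e' \<in> window c (m + r)" using sub[OF v] by (auto simp: window_def)
  qed
  moreover have "f e = g e"
  proof (rule fg)
    obtain x where "x \<in> e" using e(1) by (auto elim!: lattice_edge_cases)
    then show "e \<in> window c (m + r)" using e lball_mono[of m "m + r" c] by (auto simp: window_def)
  qed
  ultimately show ?thesis by (simp add: detour_weight_def cong: sum.cong)
qed

lemma depends_on_ptime:
  "depends_on (window c (m + r)) (\<lambda>f. ptime (lball c m) (detour_weight K r f) x y)"
  unfolding depends_on_def by (intro allI impI ptime_local detour_weight_cong) auto

lemma depends_on_ptime':
  "depends_on lattice_edges (\<lambda>f. ptime (S :: (int ^ 'd::finite) set) (detour_weight K r f) x y)"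
  unfolding depends_on_def
proof (intro allI impI ptime_local)
  fix f g :: "(int ^ 'd) set \<Rightarrow> real" and e :: "(int ^ 'd) set"
  assume fg: "\<forall>e\<in>lattice_edges. f e = g e" and e: "e \<in> lattice_edges"
  have "bad_sites K f = bad_sites K g" using fg by (auto simp: bad_sites_def)
  then show "detour_weight K r f e = detour_weight K r g e" using fg e by (simp add: detour_weight_def)
qed

text \<open>Two balls met by one edge have centres at distance at most \<open>2 * r + 1\<close>, as
  the edge spans at most one step between them.\<close>

lemma window_disjoint: "2 * r + 2 \<le> l1 (c - c') \<Longrightarrow> window c r \<inter> window c' r = {}"
proof (rule ccontr)
  assume l: "2 * r + 2 \<le> l1 (c - c')" and "window c r \<inter> window c' r \<noteq> {}"
  then obtain e where e: "e \<in> lattice_edges" "e \<inter> lball c r \<noteq> {}" "e \<inter> lball c' r \<noteq> {}" by (auto simp: window_def)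
  then obtain x y where x: "x \<in> e" "x \<in> lball c r" and y: "y \<in> e" "y \<in> lball c' r" by blast
  have "l1 (x - y) \<le> 1" using e(1) x(1) y(1)
    by (auto elim!: lattice_edge_cases simp: lattice_adj_iff_l1 l1_minus_commute)
  moreover have "l1 (c - c') \<le> l1 (c - x) + l1 (x - y) + l1 (y - c')"
    using l1_diff_triangle[of c c' x] l1_diff_triangle[of x c' y] by simp
  ultimately show False using x(2) y(2) l by (simp add: lball_def l1_minus_commute[of c x])
qed

lemma window_subset: "window c r \<subseteq> lattice_edges"
  by (auto simp: window_def)

section \<open>Invariance under lattice automorphisms\<close>

lemma lattice_auto_inv: "lattice_auto \<phi> \<Longrightarrow> lattice_auto (inv \<phi>)"
  unfolding lattice_auto_def by (metis bij_betw_inv_into bij_inv_eq_iff)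

lemma walks_image:
  assumes "lattice_auto \<phi>" "vs \<in> walks S x y"
  shows "map \<phi> vs \<in> walks (\<phi> ` S) (\<phi> x) (\<phi> y)"
  using assms by (auto simp: walks_def lattice_auto_def successively_map hd_map last_map)

lemma walks_auto:
  assumes "lattice_auto \<phi>"
  shows "walks (\<phi> ` S) (\<phi> x) (\<phi> y) = map \<phi> ` walks S x y"
proof
  show "map \<phi> ` walks S x y \<subseteq> walks (\<phi> ` S) (\<phi> x) (\<phi> y)" using walks_image[OF assms] by blast
  have bij: "bij \<phi>" using assms by (simp add: lattice_auto_def)
  show "walks (\<phi> ` S) (\<phi> x) (\<phi> y) \<subseteq> map \<phi> ` walks S x y"
  proof
    fix vs assume "vs \<in> walks (\<phi> ` S) (\<phi> x) (\<phi> y)"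
    from walks_image[OF lattice_auto_inv[OF assms] this]
    have "map (inv \<phi>) vs \<in> walks S x y" using bij by (simp add: image_inv_f_f bij_is_inj)
    moreover have "vs = map \<phi> (map (inv \<phi>) vs)" using bij by (simp add: o_def bij_is_surj surj_f_inv_f)
    ultimately show "vs \<in> map \<phi> ` walks S x y" by blast
  qed
qed

lemma bij_image_eqI:
  assumes "bij \<phi>" "\<And>v. \<phi> v \<in> A \<longleftrightarrow> v \<in> B"
  shows "A = \<phi> ` B"
proof (rule set_eqI)
  fix x
  obtain v where v: "x = \<phi> v" using bij_is_surj[OF assms(1)] by (elim surjE)
  show "x \<in> A \<longleftrightarrow> x \<in> \<phi> ` B"
    unfolding v using assms(2)[of v] inj_image_mem_iff[OF bij_is_inj[OF assms(1)], of v B] by simp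
qed

lemma bad_sites_auto:
  assumes "lattice_auto \<phi>"
  shows "bad_sites K f = \<phi> ` bad_sites K (\<lambda>e. f (\<phi> ` e))"
proof -
  have bij: "bij \<phi>" using assms by (simp add: lattice_auto_def)
  have "\<phi> v \<in> bad_sites K f \<longleftrightarrow> v \<in> bad_sites K (\<lambda>e. f (\<phi> ` e))" for v
  proof
    assume "\<phi> v \<in> bad_sites K f"
    then obtain e where e: "e \<in> lattice_edges" "\<phi> v \<in> e" "K < f e" by (auto simp: bad_sites_def)
    have "inv \<phi> ` e \<in> lattice_edges" by (rule lattice_auto_edge[OF lattice_auto_inv[OF assms] e(1)])
    moreover have "v \<in> inv \<phi> ` e" using e(2) bij by (metis bij_inv_eq_iff image_eqI)
    moreover have "\<phi> ` inv \<phi> ` e = e" using bij by (simp add: bij_is_surj image_f_inv_f)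
    ultimately show "v \<in> bad_sites K (\<lambda>e. f (\<phi> ` e))" using e(3) by (auto simp: bad_sites_def intro!: bexI[of _ "inv \<phi> ` e"])
  next
    assume "v \<in> bad_sites K (\<lambda>e. f (\<phi> ` e))"
    then show "\<phi> v \<in> bad_sites K f" using lattice_auto_edge[OF assms] by (auto simp: bad_sites_def)
  qed
  then show ?thesis by (rule bij_image_eqI[OF bij])
qed

lemma local_cluster_auto:
  assumes "lattice_auto \<phi>"
  shows "local_cluster (\<phi> ` B) r (\<phi> v) = \<phi> ` local_cluster B r v"
proof -
  have bij: "bij \<phi>" using assms by (simp add: lattice_auto_def)
  have "\<phi> y \<in> local_cluster (\<phi> ` B) r (\<phi> v) \<longleftrightarrow> y \<in> local_cluster B r v" for y
    unfolding local_cluster_def by (simp add: walks_auto[OF assms])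
  then show ?thesis by (rule bij_image_eqI[OF bij])
qed

lemma detour_weight_auto:
  assumes "lattice_auto \<phi>"
  shows "detour_weight K r (\<lambda>e. f (\<phi> ` e)) e = detour_weight K r f (\<phi> ` e)"
proof -
  have inj: "inj \<phi>" using assms by (simp add: lattice_auto_def bij_is_inj)
  have "(\<Sum>v\<in>\<phi> ` e. real (card (local_cluster (bad_sites K f) r v))) =
      (\<Sum>v\<in>e. real (card (local_cluster (bad_sites K f) r (\<phi> v))))"
    using inj by (subst sum.reindex) (auto intro: inj_on_subset)
  also have "\<dots> = (\<Sum>v\<in>e. real (card (local_cluster (bad_sites K (\<lambda>e. f (\<phi> ` e))) r v)))"
    unfolding bad_sites_auto[OF assms, of K f] local_cluster_auto[OF assms]
    using inj by (intro sum.cong refl) (simp add: card_image inj_on_subset)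
  finally show ?thesis by (simp add: detour_weight_def)
qed

lemma cost_map: "cost w (map \<phi> vs) = cost (\<lambda>e. w (\<phi> ` e)) vs"
  by (induction vs rule: induct_list012) auto

lemma ptime_auto:
  assumes "lattice_auto \<phi>"
  shows "ptime S (detour_weight K r (\<lambda>e. f (\<phi> ` e))) x y = ptime (\<phi> ` S) (detour_weight K r f) (\<phi> x) (\<phi> y)"
  unfolding ptime_def walks_auto[OF assms] image_image cost_map detour_weight_auto[OF assms] ..

lemma card_path_edges_le: "card (path_edges vs) \<le> length vs - 1"
proof (induction vs rule: induct_list012)
  case (3 x y vs)
  have "card (path_edges (x # y # vs)) \<le> Suc (card (path_edges (y # vs)))"
    by (simp add: card_insert_if finite_path_edges)
  with 3 show ?case by simp
qed auto

text \<open>Points of the cluster beyond distance \<open>\<rho>\<close> are endpoints of long self-avoiding bad paths.\<close>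

lemma card_local_cluster_le:
  fixes B :: "(int ^ 'd::finite) set"
  shows "card (local_cluster B r v) \<le> (2 * \<rho> + 1) ^ CARD('d) +
    (\<Sum>n\<in>{\<rho><..r}. card {vs \<in> npaths n v. distinct vs \<and> set vs \<subseteq> B})"
proof -
  let ?P = "\<lambda>n. {vs \<in> npaths n v. distinct vs \<and> set vs \<subseteq> B}"
  have finP: "finite (?P n)" for n by (rule finite_subset[OF _ npaths(1)]) auto
  have "local_cluster B r v \<subseteq> lball v \<rho> \<union> last ` (\<Union>n\<in>{\<rho><..r}. ?P n)"
  proof
    fix y assume "y \<in> local_cluster B r v"
    then obtain vs where vs: "vs \<in> walks B v y" "length vs \<le> Suc r" by (auto simp: local_cluster_def)
    obtain ws where ws: "saw v y ws" "path_edges ws \<subseteq> path_edges vs" "set ws \<subseteq> set vs"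
      by (rule loop_erasure[OF vs(1)])
    have d: "distinct ws" "ws \<noteq> []" using ws(1) by (auto simp: saw_def)
    have "length ws - 1 \<le> card (path_edges vs)"
      using card_path_edges_distinct[OF d(1)] card_mono[OF finite_path_edges ws(2)] by simp
    also have "\<dots> \<le> r" using card_path_edges_le[of vs] vs(2) by simp
    finally have len: "length ws - 1 \<le> r" .
    show "y \<in> lball v \<rho> \<union> last ` (\<Union>n\<in>{\<rho><..r}. ?P n)"
    proof (cases "y \<in> lball v \<rho>")
      case False
      have "ws \<in> walks UNIV v y" using ws(1) by (simp add: saw_def walks_def)
      then have "l1 (y - v) \<le> length ws - 1" by (rule walks_length)
      then have "\<rho> < length ws - 1" using False by (simp add: lball_def)
      moreover have "ws \<in> ?P (length ws - 1)"
        using ws vs(1) d by (auto simp: npaths_def saw_def walks_def)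
      ultimately have "ws \<in> (\<Union>n\<in>{\<rho><..r}. ?P n)"
        using len by (intro UN_I[of "length ws - 1"]) auto
      moreover have "y = last ws" using ws(1) by (simp add: saw_def)
      ultimately show ?thesis by (intro UnI2 image_eqI[of y last ws])
    qed simp
  qed
  then have "card (local_cluster B r v) \<le> card (lball v \<rho> \<union> last ` (\<Union>n\<in>{\<rho><..r}. ?P n))"
    using finP by (intro card_mono) auto
  also have "\<dots> \<le> card (lball v \<rho>) + card (last ` (\<Union>n\<in>{\<rho><..r}. ?P n))" by (rule card_Un_le)
  also have "\<dots> \<le> (2 * \<rho> + 1) ^ CARD('d) + card (\<Union>n\<in>{\<rho><..r}. ?P n)"
    using finP by (intro add_mono card_lball card_image_le) auto
  also have "\<dots> \<le> (2 * \<rho> + 1) ^ CARD('d) + (\<Sum>n\<in>{\<rho><..r}. card (?P n))"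
    by (intro add_mono le_refl card_UN_le) auto
  finally show ?thesis .
qed

text \<open>\<open>K_small\<close> prepares a union bound over the at most
  \<open>2 * CARD('d)\<close> edges at a site. Sites at distance 2 share no edge, so bad sites have
  range 2, which explains the exponent \<open>2 ^ CARD('d)\<close>.\<close>

locale fpp_field = iid_field M "borel :: real measure" \<tau>
  for M :: "'w measure" and \<tau> :: "(int ^ 'd::finite) set \<Rightarrow> 'w \<Rightarrow> real" +
  fixes K :: real
  assumes dim: "CARD('d) \<ge> 2"
    and \<tau>_nonneg: "\<And>e \<omega>. e \<in> lattice_edges \<Longrightarrow> \<omega> \<in> space M \<Longrightarrow> 0 \<le> \<tau> e \<omega>"
    and K_pos: "0 < K"
    and K_small: "\<And>e. e \<in> lattice_edges \<Longrightarrow>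
      2 * CARD('d) * prob {\<omega> \<in> space M. K < \<tau> e \<omega>} \<le> (1 / (4 * CARD('d))) ^ (2 ^ CARD('d))"
begin

abbreviation t :: "'w \<Rightarrow> (int ^ 'd) set \<Rightarrow> real" where "t \<omega> \<equiv> \<lambda>e. \<tau> e \<omega>"

abbreviation bad :: "'w \<Rightarrow> (int ^ 'd) set" where "bad \<omega> \<equiv> bad_sites K (t \<omega>)"

lemma nonneg_t: "\<omega> \<in> space M \<Longrightarrow> nonneg_weight (t \<omega>)"
  by (simp add: nonneg_weight_def \<tau>_nonneg)

sublocale bad: rare_events M "borel :: real measure" \<tau> 2 "\<lambda>v. {e \<in> lattice_edges. v \<in> e}" "\<lambda>v f. v \<in> bad_sites K f"
proof
  fix v v' :: "int ^ 'd" assume l: "2 \<le> l1 (v - v')"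
  show "{e \<in> lattice_edges. v \<in> e} \<inter> {e \<in> lattice_edges. v' \<in> e} = {}"
  proof (rule ccontr)
    assume "\<not> ?thesis"
    then obtain e where "e \<in> lattice_edges" "v \<in> e" "v' \<in> e" by blast
    then have "l1 (v - v') \<le> 1"
      by (auto elim!: lattice_edge_cases simp: lattice_adj_iff_l1 l1_minus_commute)
    then show False using l by simp
  qed
next
  fix v :: "int ^ 'd"
  let ?E = "(\<lambda>y. {v, y}) ` {y. lattice_adj v y}"
  have E: "{e \<in> lattice_edges. v \<in> e} = ?E"
    by (auto elim!: lattice_edge_cases simp: lattice_edge_iff lattice_adj_sym insert_commute)
  have fin: "finite ?E" using neighbours(1) by auto
  have "card ?E \<le> card {y. lattice_adj v y}" using neighbours(1) by (rule card_image_le)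
  then have cardE: "card ?E \<le> 2 * CARD('d)" using neighbours(2)[of v] by simp
  have ev: "{\<omega> \<in> space M. K < \<tau> e \<omega>} \<in> events" if "e \<in> lattice_edges" for e
    using measurable_X[OF that] by measurable
  have "{\<omega> \<in> space M. v \<in> bad \<omega>} = (\<Union>e\<in>?E. {\<omega> \<in> space M. K < \<tau> e \<omega>})"
    unfolding E[symmetric] by (auto simp: bad_sites_def)
  also have "prob \<dots> \<le> (\<Sum>e\<in>?E. prob {\<omega> \<in> space M. K < \<tau> e \<omega>})"
  proof (rule finite_measure_subadditive_finite[OF fin])
    have "e \<in> lattice_edges" if "e \<in> ?E" for e using that E by blast
    then show "(\<lambda>e. {\<omega> \<in> space M. K < \<tau> e \<omega>}) ` ?E \<subseteq> events" using ev by blast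
  qed
  also have "\<dots> \<le> (\<Sum>e\<in>?E. (1 / (4 * CARD('d))) ^ (2 ^ CARD('d)) / (2 * CARD('d)))"
  proof (rule sum_mono)
    fix e assume "e \<in> ?E"
    then have "e \<in> lattice_edges" using E by blast
    from K_small[OF this] show "prob {\<omega> \<in> space M. K < \<tau> e \<omega>} \<le> (1 / (4 * CARD('d))) ^ (2 ^ CARD('d)) / (2 * CARD('d))"
      by (simp add: field_simps)
  qed
  also have "\<dots> = card ?E * ((1 / (4 * CARD('d))) ^ (2 ^ CARD('d)) / (2 * CARD('d)))" by simp
  also have "\<dots> \<le> real (2 * CARD('d)) * ((1 / (4 * CARD('d))) ^ (2 ^ CARD('d)) / (2 * CARD('d)))"
    using cardE by (intro mult_right_mono of_nat_mono) auto
  also have "\<dots> = (1 / (4 * CARD('d))) ^ (2 ^ CARD('d))" by simp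
  finally show "prob {\<omega> \<in> space M. v \<in> bad \<omega>} \<le> (1 / (4 * CARD('d))) ^ (2 ^ CARD('d))" .
  show "depends_on {e \<in> lattice_edges. v \<in> e} (\<lambda>f. v \<in> bad_sites K f)"
    unfolding depends_on_def by (intro allI impI bad_sites_cong) auto
qed (auto intro: pred_bad_site)

lemma no_long_path_iff: "no_long_path B r v \<longleftrightarrow> \<not> (\<exists>vs\<in>npaths r v. distinct vs \<and> set vs \<subseteq> B)"
  by (auto simp: no_long_path_def npaths_def)

lemma long_path_event: "{\<omega> \<in> space M. \<not> no_long_path (bad \<omega>) r v} \<in> events"
  using bad.path_event[of r v] by (simp add: no_long_path_iff)

lemma prob_long_path: "prob {\<omega> \<in> space M. \<not> no_long_path (bad \<omega>) r v} \<le> (1 / 2) ^ Suc r"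
  using bad.peierls_path[of r v] by (simp add: no_long_path_iff)

lemma measurable_local:
  assumes "\<And>E. h \<in> borel_measurable (PiM E (\<lambda>_. borel :: real measure))" "depends_on lattice_edges h"
  shows "(\<lambda>\<omega>. h (t \<omega>)) \<in> borel_measurable M"
  by (rule measurable_field[OF assms]) simp

lemma measurable_T [measurable]: "(\<lambda>\<omega>. ptime S (detour_weight K r (t \<omega>)) x y) \<in> borel_measurable M"
  by (rule measurable_local[OF measurable_ptime depends_on_ptime'])

lemma measurable_w [measurable]:
  assumes "e \<in> lattice_edges"
  shows "(\<lambda>\<omega>. detour_weight K r (t \<omega>) e) \<in> borel_measurable M"
proof (rule measurable_local[OF measurable_detour_weight])
  show "depends_on lattice_edges (\<lambda>f. detour_weight K r f e)"
    unfolding depends_on_def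
  proof (intro allI impI)
    fix f g :: "(int ^ 'd) set \<Rightarrow> real" assume fg: "\<forall>e\<in>lattice_edges. f e = g e"
    have "bad_sites K f = bad_sites K g" using fg by (auto simp: bad_sites_def)
    then show "detour_weight K r f e = detour_weight K r g e" using fg assms by (simp add: detour_weight_def)
  qed
qed

lemma measurable_cluster [measurable]:
  "(\<lambda>\<omega>. real (card (local_cluster (bad \<omega>) r v))) \<in> borel_measurable M"
proof (rule measurable_local[OF measurable_card_local_cluster])
  show "depends_on lattice_edges (\<lambda>f. real (card (local_cluster (bad_sites K f) r v)))"
    unfolding depends_on_def
  proof (intro allI impI)
    fix f g :: "(int ^ 'd) set \<Rightarrow> real" assume fg: "\<forall>e\<in>lattice_edges. f e = g e"
    have "bad_sites K f = bad_sites K g" using fg by (auto simp: bad_sites_def)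
    then show "real (card (local_cluster (bad_sites K f) r v)) = real (card (local_cluster (bad_sites K g) r v))" by simp
  qed
qed

lemma sum_half_powers: "(\<Sum>n\<in>{\<rho><..r}. (1 / 2 :: real) ^ Suc n) \<le> (1 / 2) ^ \<rho>"
proof -
  show ?thesis
  proof (cases "\<rho> \<le> r")
    case True
    then have "(\<Sum>n\<in>{\<rho><..r}. (1 / 2 :: real) ^ Suc n) = (1 / 2) ^ Suc \<rho> - (1 / 2) ^ Suc r"
    proof (induction r rule: dec_induct)
      case (step r)
      then have "{\<rho><..Suc r} = insert (Suc r) {\<rho><..r}" by auto
      with step show ?case by simp
    qed simp
    moreover have "(1 / 2 :: real) ^ Suc \<rho> \<le> (1 / 2) ^ \<rho>" "(0 :: real) \<le> (1 / 2) ^ Suc r" by auto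
    ultimately show ?thesis by linarith
  qed simp
qed

text \<open>Points within \<open>\<rho>\<close> are counted by volume on the event \<open>A\<close>,
  points beyond \<open>\<rho>\<close> by the long bad paths leading to them, whose expected number
  is at most \<open>(1 / 2) ^ \<rho>\<close>. The bound does not involve the cut-off
  \<open>r\<close>, and \<open>\<rho>\<close> can be chosen to suit the size of
  \<open>prob A\<close>.\<close>

lemma expectation_cluster:
  assumes A: "A \<in> events"
  shows "expectation (\<lambda>\<omega>. real (card (local_cluster (bad \<omega>) r v)) * indicator A \<omega>)
    \<le> real ((2 * \<rho> + 1) ^ CARD('d)) * prob A + (1 / 2) ^ \<rho>"
proof -
  let ?P = "\<lambda>n. {vs \<in> npaths n v. distinct vs}"
  let ?ev = "\<lambda>vs. {\<omega> \<in> space M. set vs \<subseteq> bad \<omega>}"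
  let ?S = "\<lambda>\<omega>. \<Sum>n\<in>{\<rho><..r}. \<Sum>vs\<in>?P n. indicator (?ev vs) \<omega> :: real"
  have ev: "?ev vs \<in> events" for vs using bad.subset_event[of "set vs"] by simp
  have S0: "0 \<le> ?S \<omega>" for \<omega> by (intro sum_nonneg) auto
  have intS: "integrable M ?S" using ev
    by (intro Bochner_Integration.integrable_sum integrable_real_indicator) (auto simp: emeasure_eq_measure)
  have le: "real (card (local_cluster (bad \<omega>) r v)) * indicator A \<omega> \<le>
      real ((2 * \<rho> + 1) ^ CARD('d)) * indicator A \<omega> + ?S \<omega>" if \<omega>: "\<omega> \<in> space M" for \<omega>
  proof -
    have c: "real (card {vs \<in> npaths n v. distinct vs \<and> set vs \<subseteq> bad \<omega>}) = (\<Sum>vs\<in>?P n. indicator (?ev vs) \<omega>)" for n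
    proof -
      have "(\<Sum>vs\<in>?P n. indicator (?ev vs) \<omega> :: real) = (\<Sum>vs\<in>?P n. if set vs \<subseteq> bad \<omega> then 1 else 0)"
        using \<omega> by (intro sum.cong refl) (auto simp: indicator_def)
      also have "\<dots> = real (card (?P n \<inter> {vs. set vs \<subseteq> bad \<omega>}))"
        by (simp add: sum.If_cases)
      also have "?P n \<inter> {vs. set vs \<subseteq> bad \<omega>} = {vs \<in> npaths n v. distinct vs \<and> set vs \<subseteq> bad \<omega>}" by auto
      finally show ?thesis by simp
    qed
    have "real (card (local_cluster (bad \<omega>) r v)) \<le> real ((2 * \<rho> + 1) ^ CARD('d) +
        (\<Sum>n\<in>{\<rho><..r}. card {vs \<in> npaths n v. distinct vs \<and> set vs \<subseteq> bad \<omega>}))"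
      by (intro of_nat_mono card_local_cluster_le)
    also have "\<dots> = (2 * \<rho> + 1) ^ CARD('d) + ?S \<omega>" using c by simp
    finally have *: "real (card (local_cluster (bad \<omega>) r v)) \<le> (2 * \<rho> + 1) ^ CARD('d) + ?S \<omega>" .
    show ?thesis
    proof (cases "\<omega> \<in> A")
      case True
      then show ?thesis using * by simp
    qed (use S0 in simp)
  qed
  have "expectation (\<lambda>\<omega>. real (card (local_cluster (bad \<omega>) r v)) * indicator A \<omega>)
      \<le> expectation (\<lambda>\<omega>. real ((2 * \<rho> + 1) ^ CARD('d)) * indicator A \<omega> + ?S \<omega>)"
  proof (rule integral_mono)
    show "integrable M (\<lambda>\<omega>. real (card (local_cluster (bad \<omega>) r v)) * indicator A \<omega>)"
    proof (rule integrable_const_bound[where B = "real ((2 * r + 1) ^ CARD('d))"])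
      show "AE \<omega> in M. norm (real (card (local_cluster (bad \<omega>) r v)) * indicator A \<omega>) \<le> real ((2 * r + 1) ^ CARD('d))"
        using card_local_cluster[of "bad \<omega>" r v for \<omega>]
        by (intro AE_I2) (auto simp: indicator_def simp del: of_nat_power)
      show "(\<lambda>\<omega>. real (card (local_cluster (bad \<omega>) r v)) * indicator A \<omega>) \<in> borel_measurable M"
        using A measurable_cluster by measurable
    qed
    show "integrable M (\<lambda>\<omega>. real ((2 * \<rho> + 1) ^ CARD('d)) * indicator A \<omega> + ?S \<omega>)"
      using A intS by (intro Bochner_Integration.integrable_add integrable_mult_right integrable_real_indicator)
        (auto simp: emeasure_eq_measure)
  qed (use le in auto)
  also have "\<dots> = real ((2 * \<rho> + 1) ^ CARD('d)) * prob A + (\<Sum>n\<in>{\<rho><..r}. \<Sum>vs\<in>?P n. prob (?ev vs))"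
  proof -
    have i: "integrable M (indicator (?ev vs) :: _ \<Rightarrow> real)" for vs
      using ev by (intro integrable_real_indicator) (auto simp: emeasure_eq_measure)
    have iA: "integrable M (\<lambda>\<omega>. real ((2 * \<rho> + 1) ^ CARD('d)) * indicator A \<omega> :: real)"
      using A by (intro integrable_mult_right integrable_real_indicator) (auto simp: emeasure_eq_measure)
    have "expectation ?S = (\<Sum>n\<in>{\<rho><..r}. \<Sum>vs\<in>?P n. expectation (indicator (?ev vs)))"
      using i by (simp add: Bochner_Integration.integral_sum Bochner_Integration.integrable_sum)
    also have "\<dots> = (\<Sum>n\<in>{\<rho><..r}. \<Sum>vs\<in>?P n. prob (?ev vs))" using ev by simp
    finally show ?thesis using A by (subst Bochner_Integration.integral_add[OF iA intS]) simp
  qed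
  also have "\<dots> \<le> real ((2 * \<rho> + 1) ^ CARD('d)) * prob A + (\<Sum>n\<in>{\<rho><..r}. (1 / 2) ^ Suc n)"
    by (intro add_left_mono sum_mono bad.sum_paths[unfolded Collect_mem_eq])
  also have "\<dots> \<le> real ((2 * \<rho> + 1) ^ CARD('d)) * prob A + (1 / 2) ^ \<rho>"
    by (intro add_left_mono sum_half_powers)
  finally show ?thesis .
qed

end

section \<open>Concentration\<close>

text \<open>With the square of the logarithm, \<open>(1 / 2) ^ rad n\<close> is eventually smaller
  than every negative power of \<open>n\<close>, while every power of \<open>rad n\<close> stays
  below any positive power of \<open>n\<close>.\<close>

definition rad :: "nat \<Rightarrow> nat" where
  "rad n = nat \<lfloor>(ln (real n))\<^sup>2\<rfloor>"

lemma rad_le: "real (rad n) \<le> (ln (real n))\<^sup>2"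
  by (simp add: rad_def)

lemma rad_ge: "(ln (real n))\<^sup>2 \<le> real (Suc (rad n))"
  unfolding rad_def by (simp add: of_nat_nat) linarith

lemma detour_bound_mono:
  "0 \<le> K \<Longrightarrow> real r \<le> s \<Longrightarrow> detour_bound TYPE('d::finite) K r \<le> K + 8 * real CARD('d) * K * (2 * s + 1) ^ CARD('d)"
  unfolding detour_bound_def by (auto intro!: mult_left_mono power_mono)

lemma detour_bound_pos: "0 < K \<Longrightarrow> 0 < detour_bound TYPE('d::finite) K r"
  unfolding detour_bound_def by (intro add_pos_nonneg mult_nonneg_nonneg) auto

lemma ptime_le_straight:
  fixes t :: "(int ^ 'd::finite) set \<Rightarrow> real"
  assumes t: "nonneg_weight t" and K: "0 \<le> K" and m: "l1 (y - x) \<le> m"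
  shows "0 \<le> ptime (lball x m) (detour_weight K r t) x y"
    "ptime (lball x m) (detour_weight K r t) x y \<le> real (l1 (y - x)) * detour_bound TYPE('d) K r"
proof -
  obtain vs where vs: "vs \<in> walks (lball x m) x y" "length vs = Suc (l1 (y - x))"
    by (rule exists_straight_walk'[OF m])
  have w: "nonneg_weight (detour_weight K r t)" by (rule detour_weight_nonneg[OF t K])
  show "0 \<le> ptime (lball x m) (detour_weight K r t) x y" using vs(1) by (intro ptime_nonneg w) auto
  have "ptime (lball x m) (detour_weight K r t) x y \<le> cost (detour_weight K r t) vs"
    by (rule ptime_le[OF w vs(1)])
  also have "\<dots> \<le> real (length vs - 1) * detour_bound TYPE('d) K r"
    using vs(1) walk_path_edges by (intro cost_le_length detour_weight_le[OF _ K]) (auto simp: walks_def)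
  finally show "ptime (lball x m) (detour_weight K r t) x y \<le> real (l1 (y - x)) * detour_bound TYPE('d) K r"
    using vs(2) by simp
qed

context fpp_field
begin

abbreviation W :: "nat \<Rightarrow> 'w \<Rightarrow> (int ^ 'd) set \<Rightarrow> real" where
  "W r \<omega> \<equiv> detour_weight K r (t \<omega>)"

text \<open>The ball of radius \<open>m\<close> and the cut-off \<open>r\<close> together make the
  passage time a function of finitely many edges, so that distant blocks are independent.\<close>

definition mean_time :: "nat \<Rightarrow> nat \<Rightarrow> int ^ 'd \<Rightarrow> real" where
  "mean_time m r u = expectation (\<lambda>\<omega>. ptime (lball 0 m) (W r \<omega>) 0 u)"

lemma W_nonneg: "\<omega> \<in> space M \<Longrightarrow> nonneg_weight (W r \<omega>)"
  using detour_weight_nonneg[OF nonneg_t] K_pos by simp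

lemma T_bounds:
  assumes "\<omega> \<in> space M" "l1 (y - x) \<le> m"
  shows "0 \<le> ptime (lball x m) (W r \<omega>) x y"
    "ptime (lball x m) (W r \<omega>) x y \<le> real (l1 (y - x)) * detour_bound TYPE('d) K r"
  using ptime_le_straight[OF nonneg_t[OF assms(1)] _ assms(2)] K_pos by auto

lemma integrable_T:
  assumes "l1 (y - x) \<le> m"
  shows "integrable M (\<lambda>\<omega>. ptime (lball x m) (W r \<omega>) x y)"
proof (rule integrable_const_bound[where B = "real (l1 (y - x)) * detour_bound TYPE('d) K r"])
  show "AE \<omega> in M. norm (ptime (lball x m) (W r \<omega>) x y) \<le> real (l1 (y - x)) * detour_bound TYPE('d) K r"
    using T_bounds[OF _ assms] by (intro AE_I2) auto
qed (rule measurable_T)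

lemma mean_time_auto:
  assumes "lattice_auto \<phi>"
  shows "expectation (\<lambda>\<omega>. ptime (\<phi> ` lball 0 m) (W r \<omega>) (\<phi> 0) (\<phi> u)) = mean_time m r u"
proof -
  have "ptime (\<phi> ` lball 0 m) (W r \<omega>) (\<phi> 0) (\<phi> u) =
      ptime (lball 0 m) (detour_weight K r (\<lambda>e. t \<omega> (\<phi> ` e))) 0 u" for \<omega>
    by (rule ptime_auto[OF assms, symmetric])
  then show ?thesis
    using expectation_auto[OF assms measurable_ptime depends_on_ptime'[of "lball 0 m" K r 0 u]]
    unfolding mean_time_def by simp
qed

lemma mean_time_shift:
  "expectation (\<lambda>\<omega>. ptime (lball c m) (W r \<omega>) c (c + u)) = mean_time m r u"
  using mean_time_auto[OF lattice_auto_shift[of c], of m r u] lball_shift[of c 0 m] by simp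

lemma T_sum_event:
  "{\<omega> \<in> space M. x \<le> (\<Sum>j\<in>J. ptime (S j) (W r \<omega>) (a j) (b j))} \<in> events"
  by measurable

text \<open>Blocks whose indices agree mod \<open>R\<close> have disjoint windows and are
  independent, so the Hoeffding bound applies to each residue class; if the total is too large, some
  class exceeds its share. The period \<open>R\<close> is the separation required by
  \<open>window_disjoint\<close>, and since \<open>u \<noteq> 0\<close> the centre moves by at least
  1 per block.\<close>

lemma hoeffding_blocks:
  fixes u c :: "int ^ 'd"
  assumes u: "u \<noteq> 0" "l1 u \<le> m" and a: "mean_time m r u \<le> a" and \<eta>: "\<eta> > 0"
    and R: "R = 2 * (m + r) + 2" and k: "R \<le> k"
  shows "prob {\<omega> \<in> space M. real k * (a + \<eta>) \<le>
      (\<Sum>j<k. ptime (lball (c + int j *s u) m) (W r \<omega>) (c + int j *s u) (c + int (Suc j) *s u))}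
    \<le> R * exp (- 2 * \<eta>\<^sup>2 * real (k div R) / (real (l1 u) * detour_bound TYPE('d) K r)\<^sup>2)"
proof -
  let ?p = "\<lambda>j. c + int j *s u"
  let ?Y = "\<lambda>j \<omega>. ptime (lball (?p j) m) (W r \<omega>) (?p j) (?p (Suc j))"
  let ?b = "real (l1 u) * detour_bound TYPE('d) K r"
  define J where "J i = {j \<in> {..<k}. j mod R = i}" for i
  have R0: "R > 0" using R by simp
  have l1u: "1 \<le> l1 u" using u(1) by (cases "l1 u") auto
  have finJ: "finite (J i)" for i by (simp add: J_def)
  have step: "?p (Suc j) = ?p j + u" for j by (simp add: vec_eq_iff algebra_simps)
  have b: "?b > 0" using u(1) by (intro mult_pos_pos detour_bound_pos K_pos) (simp add: zero_less_iff_neq_zero)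
  have cardJ: "k div R \<le> card (J i)" if i: "i < R" for i
  proof -
    have "(\<lambda>q. q * R + i) ` {..<k div R} \<subseteq> J i"
    proof (intro image_subsetI)
      fix q assume "q \<in> {..<k div R}"
      then have "Suc q * R \<le> k div R * R" by (intro mult_le_mono1) simp
      also have "\<dots> \<le> k" by (rule div_times_less_eq_dividend)
      finally have "q * R + i < k" using i by simp
      then show "q * R + i \<in> J i" using i by (simp add: J_def)
    qed
    moreover have "inj_on (\<lambda>q. q * R + i) {..<k div R}" using R0 by (auto simp: inj_on_def)
    ultimately show ?thesis using card_inj_on_le[OF _ _ finJ] by fastforce
  qed
  have one: "prob {\<omega> \<in> space M. real (card (J i)) * (a + \<eta>) \<le> (\<Sum>j\<in>J i. ?Y j \<omega>)}
      \<le> exp (- 2 * \<eta>\<^sup>2 * real (k div R) / ?b\<^sup>2)" if i: "i < R" for i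
  proof -
    let ?n = "real (card (J i))"
    have "1 \<le> k div R" using k R0 by (simp add: Suc_leI div_greater_zero_iff)
    then have n: "?n \<ge> real (k div R)" "?n > 0" using cardJ[OF i] by auto
    have ind: "indep_vars (\<lambda>_. borel) ?Y (J i)"
    proof (rule indep_local[where E = "\<lambda>j. window (?p j) (m + r)" and h = "\<lambda>j f. ptime (lball (?p j) m) (detour_weight K r f) (?p j) (?p (Suc j))"])
      have "window (?p j) (m + r) \<inter> window (?p j') (m + r) = {}" if j: "j \<in> J i" "j' \<in> J i" "j \<noteq> j'" for j j'
      proof (rule window_disjoint)
        have "int R dvd int j - int j'"
        proof -
          have "int j mod int R = int j' mod int R" using j by (simp add: J_def flip: zmod_int)
          then show ?thesis by (simp add: mod_eq_dvd_iff)
        qed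
        then have "int R \<le> \<bar>int j - int j'\<bar>" using j(3) dvd_imp_le_int[of "int j - int j'" "int R"] by simp
        then have "R \<le> nat \<bar>int j - int j'\<bar>" by linarith
        also have "\<dots> \<le> nat \<bar>int j - int j'\<bar> * l1 u"
          using mult_le_mono2[OF l1u, of "nat \<bar>int j - int j'\<bar>"] by simp
        also have "\<dots> = l1 (?p j - ?p j')"
        proof -
          have eq: "?p j - ?p j' = (int j - int j') *s u" by (simp add: vec_eq_iff algebra_simps)
          show ?thesis unfolding eq l1_scale ..
        qed
        finally show "2 * (m + r) + 2 \<le> l1 (?p j - ?p j')" using R by simp
      qed
      then show "disjoint_family_on (\<lambda>j. window (?p j) (m + r)) (J i)" by (auto simp: disjoint_family_on_def)
    qed (intro window_subset measurable_ptime depends_on_ptime)+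
    interpret H: Hoeffding_ineq M "J i" ?Y "\<lambda>_. 0" "\<lambda>_. ?b" "\<Sum>j\<in>J i. expectation (?Y j)"
    proof unfold_locales
      show "AE \<omega> in M. ?Y j \<omega> \<in> {0..?b}" for j
        using T_bounds[of _ "?p (Suc j)" "?p j" m r] u(2) by (intro AE_I2) (auto simp: step)
    qed (use finJ ind in auto)
    let ?\<mu> = "\<Sum>j\<in>J i. expectation (?Y j)"
    have "expectation (?Y j) = mean_time m r u" for j
      unfolding step by (rule mean_time_shift)
    then have "?\<mu> = (\<Sum>j\<in>J i. mean_time m r u)" by (intro sum.cong refl)
    then have "?\<mu> = ?n * mean_time m r u" by (simp only: sum_constant)
    then have \<mu>: "?\<mu> \<le> ?n * a" using a by (simp add: mult_left_mono)
    define \<epsilon> where "\<epsilon> = ?n * (a + \<eta>) - ?\<mu>"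
    have \<epsilon>: "\<epsilon> \<ge> ?n * \<eta>" using \<mu> by (simp add: \<epsilon>_def algebra_simps)
    have n\<eta>: "0 \<le> ?n * \<eta>" using \<eta> by simp
    have "{\<omega> \<in> space M. ?n * (a + \<eta>) \<le> (\<Sum>j\<in>J i. ?Y j \<omega>)} = {\<omega> \<in> space M. ?\<mu> + \<epsilon> \<le> (\<Sum>j\<in>J i. ?Y j \<omega>)}"
      by (simp add: \<epsilon>_def)
    also have "prob \<dots> \<le> exp (- 2 * \<epsilon>\<^sup>2 / (\<Sum>j\<in>J i. (?b - 0)\<^sup>2))"
    proof (rule H.Hoeffding_ineq_ge)
      show "0 \<le> \<epsilon>" using \<epsilon> n\<eta> by linarith
      show "0 < (\<Sum>j\<in>J i. (?b - 0)\<^sup>2)"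
        using mult_pos_pos[OF n(2) zero_less_power[OF b]] by (simp only: sum_constant diff_zero)
    qed
    also have "\<dots> \<le> exp (- 2 * \<eta>\<^sup>2 * real (k div R) / ?b\<^sup>2)"
    proof -
      have "(?n * \<eta>)\<^sup>2 \<le> \<epsilon>\<^sup>2" using \<epsilon> n\<eta> by (rule power_mono)
      then have q1: "(?n * \<eta>)\<^sup>2 / (?n * ?b\<^sup>2) \<le> \<epsilon>\<^sup>2 / (?n * ?b\<^sup>2)" using n(2) by (intro divide_right_mono) auto
      have "(x * \<eta>)\<^sup>2 / (x * B) = x * (\<eta>\<^sup>2 / B)" if "x > 0" for x B :: real
        using that by (simp add: power2_eq_square)
      from this[OF n(2)] have q2: "(?n * \<eta>)\<^sup>2 / (?n * ?b\<^sup>2) = ?n * (\<eta>\<^sup>2 / ?b\<^sup>2)" .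
      have "real (k div R) * (\<eta>\<^sup>2 / ?b\<^sup>2) \<le> ?n * (\<eta>\<^sup>2 / ?b\<^sup>2)" using n(1) by (rule mult_right_mono) simp
      with q1 q2 have *: "real (k div R) * (\<eta>\<^sup>2 / ?b\<^sup>2) \<le> \<epsilon>\<^sup>2 / (?n * ?b\<^sup>2)" by linarith
      have e1: "- 2 * \<epsilon>\<^sup>2 / (\<Sum>j\<in>J i. (?b - 0)\<^sup>2) = - 2 * (\<epsilon>\<^sup>2 / (?n * ?b\<^sup>2))" by simp
      have e2: "- 2 * \<eta>\<^sup>2 * real (k div R) / ?b\<^sup>2 = - 2 * (real (k div R) * (\<eta>\<^sup>2 / ?b\<^sup>2))" by simp
      show ?thesis unfolding e1 e2 exp_le_cancel_iff using * by linarith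
    qed
    finally show ?thesis .
  qed
  have part: "(\<Sum>i<R. \<Sum>j\<in>J i. f j) = (\<Sum>j<k. f j)" for f :: "nat \<Rightarrow> real"
    unfolding J_def using R0 by (intro sum.group) auto
  have "{\<omega> \<in> space M. real k * (a + \<eta>) \<le> (\<Sum>j<k. ?Y j \<omega>)} \<subseteq>
      (\<Union>i\<in>{..<R}. {\<omega> \<in> space M. real (card (J i)) * (a + \<eta>) \<le> (\<Sum>j\<in>J i. ?Y j \<omega>)})"
  proof
    fix \<omega> assume \<omega>: "\<omega> \<in> {\<omega> \<in> space M. real k * (a + \<eta>) \<le> (\<Sum>j<k. ?Y j \<omega>)}"
    show "\<omega> \<in> (\<Union>i\<in>{..<R}. {\<omega> \<in> space M. real (card (J i)) * (a + \<eta>) \<le> (\<Sum>j\<in>J i. ?Y j \<omega>)})"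
    proof (rule ccontr)
      assume "\<not> ?thesis"
      then have less: "(\<Sum>j\<in>J i. ?Y j \<omega>) < real (card (J i)) * (a + \<eta>)" if "i < R" for i
        using \<omega> that by (auto simp: not_le)
      have "(\<Sum>j<k. ?Y j \<omega>) = (\<Sum>i<R. \<Sum>j\<in>J i. ?Y j \<omega>)" by (simp only: part)
      also have "\<dots> < (\<Sum>i<R. real (card (J i)) * (a + \<eta>))" using less R0 by (intro sum_strict_mono) auto
      also have "\<dots> = (\<Sum>i<R. \<Sum>j\<in>J i. a + \<eta>)" by simp
      also have "\<dots> = (\<Sum>j<k. a + \<eta>)" by (rule part)
      finally show False using \<omega> by simp
    qed
  qed
  then have "prob {\<omega> \<in> space M. real k * (a + \<eta>) \<le> (\<Sum>j<k. ?Y j \<omega>)} \<le>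
      prob (\<Union>i\<in>{..<R}. {\<omega> \<in> space M. real (card (J i)) * (a + \<eta>) \<le> (\<Sum>j\<in>J i. ?Y j \<omega>)})"
    by (intro finite_measure_mono sets.finite_UN T_sum_event) auto
  also have "\<dots> \<le> (\<Sum>i<R. prob {\<omega> \<in> space M. real (card (J i)) * (a + \<eta>) \<le> (\<Sum>j\<in>J i. ?Y j \<omega>)})"
    by (intro finite_measure_subadditive_finite) (auto intro: T_sum_event)
  also have "\<dots> \<le> (\<Sum>i<R. exp (- 2 * \<eta>\<^sup>2 * real (k div R) / ?b\<^sup>2))" by (intro sum_mono one) auto
  finally show ?thesis by simp
qed

text \<open>At scale \<open>n\<close> the clusters are cut off at radius \<open>rad n\<close>; all the exceptional probabilities
  are then summable, and the cut-off is rarely felt.\<close>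

lemma slow_blocks_unlikely:
  fixes u :: "int ^ 'd"
  assumes u: "u \<noteq> 0" "l1 u \<le> m" and a: "\<And>r. mean_time m r u \<le> a" and \<eta>: "\<eta> > 0"
    and m': "m' \<ge> 1" and k: "\<And>n. n \<le> m' * k n"
  shows "eventually (\<lambda>n. prob {\<omega> \<in> space M. \<exists>c\<in>lball 0 (Q * n). real (k n) * (a + \<eta>) \<le>
      (\<Sum>j<k n. ptime (lball (c + int j *s u) m) (W (rad n) \<omega>) (c + int j *s u) (c + int (Suc j) *s u))}
    \<le> 1 / real n ^ 2) sequentially"
proof -
  let ?d = "CARD('d)" and ?L = "real (l1 u)" and ?D = "2 * real m + 2"
  \<comment> \<open>The exponents balance as follows: the squared range of a block is at most
    n^(1/4) and a residue class has at least n^(3/4) blocks, so the Hoeffding exponent is of order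
    n^(1/2) and beats the polynomial number of starting points.\<close>
  have e1: "eventually (\<lambda>n::nat. ?L * (K + 8 * real ?d * K * (2 * (ln (real n))\<^sup>2 + 1) ^ ?d) \<le> real n powr (1/8)) sequentially"
    by real_asymp
  have "real m' > 0" "?D > 0" using m' by auto
  then have e2: "eventually (\<lambda>n::nat. real n powr (3/4) \<le> real n / (real m' * (?D + 2 * (ln (real n))\<^sup>2)) - 1) sequentially"
    by real_asymp
  \<comment> \<open>\<open>Suc Q\<close> in place of \<open>Q\<close> keeps the leading coefficient
    positive when \<open>Q = 0\<close>.\<close>
  have e3: "eventually (\<lambda>n::nat. (2 * (real (Suc Q) * real n) + 1) ^ ?d * ((?D + 2 * (ln (real n))\<^sup>2) * exp (- 2 * \<eta>\<^sup>2 * real n powr (1/2)))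
      \<le> 1 / real n ^ 2) sequentially"
    using \<eta> \<open>?D > 0\<close> by real_asymp
  have e4: "eventually (\<lambda>n::nat. 1 \<le> n) sequentially" by (rule eventually_ge_at_top)
  show ?thesis using e1 e2 e3 e4
  proof eventually_elim
    case (elim n)
    define R where "R = 2 * (m + rad n) + 2"
    let ?R' = "?D + 2 * (ln (real n))\<^sup>2"
    let ?b = "?L * detour_bound TYPE('d) K (rad n)"
    let ?ev = "\<lambda>c. {\<omega> \<in> space M. real (k n) * (a + \<eta>) \<le>
      (\<Sum>j<k n. ptime (lball (c + int j *s u) m) (W (rad n) \<omega>) (c + int j *s u) (c + int (Suc j) *s u))}"
    have R: "0 < real R" "real R \<le> ?R'" using rad_le[of n] by (auto simp: R_def)
    have "?b \<le> ?L * (K + 8 * real ?d * K * (2 * (ln (real n))\<^sup>2 + 1) ^ ?d)"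
      using K_pos by (intro mult_left_mono detour_bound_mono rad_le) auto
    then have b: "?b \<le> real n powr (1/8)" using elim(1) by linarith
    have b0: "0 < ?b" using u(1) by (intro mult_pos_pos detour_bound_pos K_pos) (simp add: zero_less_iff_neq_zero)
    have "?b\<^sup>2 \<le> (real n powr (1/8))\<^sup>2" using b b0 by (intro power_mono) auto
    also have "\<dots> = real n powr (1/4)" using elim(4) by (simp add: powr_power)
    finally have b2: "?b\<^sup>2 \<le> real n powr (1/4)" .
    have "real n / (real m' * ?R') \<le> real n / (real m' * real R)"
      using R m' by (intro divide_left_mono mult_left_mono) (auto intro!: mult_pos_pos)
    also have "\<dots> \<le> real (m' * k n) / (real m' * real R)"
      using k[of n] R(1) m' by (intro divide_right_mono) (auto simp del: of_nat_mult)
    also have "\<dots> = real (k n) / real R" using m' by simp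
    also have "\<dots> \<le> real (k n div R) + 1"
      using R(1) floor_divide_of_nat_eq[of "k n" R, where ?'a = real] by linarith
    finally have kR: "real n powr (3/4) \<le> real (k n div R)" using elim(2) by linarith
    have "R \<le> k n"
    proof (rule ccontr)
      assume "\<not> R \<le> k n"
      then have "k n div R = 0" by simp
      then show False using kR elim(4) by simp
    qed
    note one = hoeffding_blocks[OF u a \<eta> R_def this]
    have exp_le: "exp (- 2 * \<eta>\<^sup>2 * real (k n div R) / ?b\<^sup>2) \<le> exp (- 2 * \<eta>\<^sup>2 * real n powr (1/2))"
    proof -
      have "real n powr (1/2) * ?b\<^sup>2 \<le> real n powr (1/2) * real n powr (1/4)" using b2 by (intro mult_left_mono) auto
      also have "\<dots> = real n powr (3/4)" by (simp flip: powr_add)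
      also have "\<dots> \<le> real (k n div R)" by (rule kR)
      finally have "real n powr (1/2) \<le> real (k n div R) / ?b\<^sup>2"
        by (simp only: pos_le_divide_eq[OF zero_less_power[OF b0]])
      then have "2 * \<eta>\<^sup>2 * real n powr (1/2) \<le> 2 * \<eta>\<^sup>2 * (real (k n div R) / ?b\<^sup>2)" by (intro mult_left_mono) auto
      then show ?thesis by simp
    qed
    have "{\<omega> \<in> space M. \<exists>c\<in>lball 0 (Q * n). real (k n) * (a + \<eta>) \<le>
      (\<Sum>j<k n. ptime (lball (c + int j *s u) m) (W (rad n) \<omega>) (c + int j *s u) (c + int (Suc j) *s u))}
      = (\<Union>c\<in>lball 0 (Q * n). ?ev c)" by auto
    also have "prob \<dots> \<le> (\<Sum>c\<in>lball 0 (Q * n). prob (?ev c))"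
      by (intro finite_measure_subadditive_finite) (auto intro: T_sum_event)
    also have "\<dots> \<le> (\<Sum>c\<in>lball (0 :: int ^ 'd) (Q * n). ?R' * exp (- 2 * \<eta>\<^sup>2 * real n powr (1/2)))"
    proof (rule sum_mono)
      fix c
      have "prob (?ev c) \<le> real R * exp (- 2 * \<eta>\<^sup>2 * real (k n div R) / ?b\<^sup>2)" by (rule one)
      also have "\<dots> \<le> ?R' * exp (- 2 * \<eta>\<^sup>2 * real n powr (1/2))" using R exp_le by (intro mult_mono) auto
      finally show "prob (?ev c) \<le> ?R' * exp (- 2 * \<eta>\<^sup>2 * real n powr (1/2))" .
    qed
    also have "\<dots> = real (card (lball (0 :: int ^ 'd) (Q * n))) * (?R' * exp (- 2 * \<eta>\<^sup>2 * real n powr (1/2)))" by simp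
    also have "\<dots> \<le> (2 * (real (Suc Q) * real n) + 1) ^ ?d * (?R' * exp (- 2 * \<eta>\<^sup>2 * real n powr (1/2)))"
    proof (rule mult_right_mono)
      have "real (card (lball (0 :: int ^ 'd) (Q * n))) \<le> real ((2 * (Q * n) + 1) ^ ?d)"
        by (intro of_nat_mono card_lball)
      also have "\<dots> \<le> (2 * (real (Suc Q) * real n) + 1) ^ ?d"
        unfolding of_nat_power by (intro power_mono) (auto simp: algebra_simps)
      finally show "real (card (lball (0 :: int ^ 'd) (Q * n))) \<le> (2 * (real (Suc Q) * real n) + 1) ^ ?d" .
      show "0 \<le> ?R' * exp (- 2 * \<eta>\<^sup>2 * real n powr (1/2))" using R by simp
    qed
    finally show ?case using elim(3) by linarith
  qed
qed

text \<open>Polynomially many sites stand against a failure probability of at most (1/2)^((ln n)^2)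
  at each.\<close>

lemma long_paths_unlikely:
  "eventually (\<lambda>n. prob {\<omega> \<in> space M. \<exists>v\<in>lball 0 (Q * n). \<not> no_long_path (bad \<omega>) (rad n) v} \<le> 1 / real n ^ 2) sequentially"
proof -
  let ?d = "CARD('d)"
  have "eventually (\<lambda>n::nat. (2 * (real (Suc Q) * real n) + 1) ^ ?d * (1 / 2) powr ((ln (real n))\<^sup>2) \<le> 1 / real n ^ 2) sequentially"
    by real_asymp
  then show ?thesis
  proof eventually_elim
    case (elim n)
    have "{\<omega> \<in> space M. \<exists>v\<in>lball 0 (Q * n). \<not> no_long_path (bad \<omega>) (rad n) v} =
        (\<Union>v\<in>lball 0 (Q * n). {\<omega> \<in> space M. \<not> no_long_path (bad \<omega>) (rad n) v})" by auto
    also have "prob \<dots> \<le> (\<Sum>v\<in>lball 0 (Q * n). prob {\<omega> \<in> space M. \<not> no_long_path (bad \<omega>) (rad n) v})"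
      by (intro finite_measure_subadditive_finite) (auto intro: long_path_event)
    also have "\<dots> \<le> (\<Sum>v\<in>lball (0 :: int ^ 'd) (Q * n). (1 / 2) powr ((ln (real n))\<^sup>2))"
    proof (rule sum_mono)
      fix v
      have "prob {\<omega> \<in> space M. \<not> no_long_path (bad \<omega>) (rad n) v} \<le> (1 / 2) powr real (Suc (rad n))"
        using prob_long_path[of "rad n" v] by (subst powr_realpow) auto
      also have "\<dots> \<le> (1 / 2) powr ((ln (real n))\<^sup>2)" by (rule powr_mono'[OF rad_ge]) auto
      finally show "prob {\<omega> \<in> space M. \<not> no_long_path (bad \<omega>) (rad n) v} \<le> (1 / 2) powr ((ln (real n))\<^sup>2)" .
    qed
    also have "\<dots> = real (card (lball (0 :: int ^ 'd) (Q * n))) * (1 / 2) powr ((ln (real n))\<^sup>2)" by simp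
    also have "\<dots> \<le> (2 * (real (Suc Q) * real n) + 1) ^ ?d * (1 / 2) powr ((ln (real n))\<^sup>2)"
    proof (rule mult_right_mono)
      have "real (card (lball (0 :: int ^ 'd) (Q * n))) \<le> real ((2 * (Q * n) + 1) ^ ?d)"
        by (intro of_nat_mono card_lball)
      also have "\<dots> \<le> (2 * (real (Suc Q) * real n) + 1) ^ ?d"
        unfolding of_nat_power by (intro power_mono) (auto simp: algebra_simps)
      finally show "real (card (lball (0 :: int ^ 'd) (Q * n))) \<le> (2 * (real (Suc Q) * real n) + 1) ^ ?d" .
    qed simp
    finally show ?case using elim by linarith
  qed
qed

end

section \<open>The time constant\<close>

lemma walks_lball_nonempty: "l1 (y - x) \<le> m \<Longrightarrow> walks (lball x m) x y \<noteq> {}"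
  using exists_straight_walk'[of y x m] by blast

lemma chain_blocks:
  fixes p :: "nat \<Rightarrow> int ^ 'd::finite"
  assumes w: "nonneg_weight w" and p: "p 0 \<in> S"
    and S: "\<And>j. j < q \<Longrightarrow> lball (p j) m \<subseteq> S" and step: "\<And>j. j < q \<Longrightarrow> l1 (p (Suc j) - p j) \<le> m"
  shows "walks S (p 0) (p q) \<noteq> {} \<and>
    ptime S w (p 0) (p q) \<le> (\<Sum>j<q. ptime (lball (p j) m) w (p j) (p (Suc j)))"
  using S step
proof (induction q)
  case 0
  have "ptime S w (p 0) (p 0) \<le> cost w [p 0]" by (rule ptime_le[OF w walks_single[OF p]])
  then show ?case using walks_single[OF p] by auto
next
  case (Suc q)
  then have IH: "walks S (p 0) (p q) \<noteq> {}"
    "ptime S w (p 0) (p q) \<le> (\<Sum>j<q. ptime (lball (p j) m) w (p j) (p (Suc j)))" by auto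
  have ne: "walks (lball (p q) m) (p q) (p (Suc q)) \<noteq> {}" using Suc.prems(2) by (intro walks_lball_nonempty) simp
  have "ptime S w (p 0) (p (Suc q)) \<le> ptime S w (p 0) (p q) + ptime (lball (p q) m) w (p q) (p (Suc q))"
    by (rule ptime_triangle[OF w order_refl _ IH(1) ne]) (use Suc.prems(1) in simp)
  moreover have "walks S (p 0) (p (Suc q)) \<noteq> {}"
  proof -
    obtain vs ws where vs: "vs \<in> walks S (p 0) (p q)" and "ws \<in> walks (lball (p q) m) (p q) (p (Suc q))"
      using IH(1) ne by blast
    then have "ws \<in> walks S (p q) (p (Suc q))" using walks_mono[of "lball (p q) m" S] Suc.prems(1)[of q] by blast
    from walks_join(1)[OF vs this] show ?thesis by blast
  qed
  ultimately show ?case using IH(2) by simp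
qed

text \<open>The coordinates of \<open>z\<close> are filled in one after the other: along coordinate
  \<open>i\<close> whole blocks of length \<open>m\<close> are used, and the remainder, shorter than
  \<open>m\<close>, is walked straight. Each chain of blocks starts in \<open>lball s H\<close>,
  where the block hypothesis is available.\<close>

lemma reach:
  fixes t :: "(int ^ 'd::finite) set \<Rightarrow> real"
  assumes t: "nonneg_weight t" and K: "0 \<le> K" and m: "1 \<le> m" "m \<le> M" and k: "H \<le> m * k"
    and blocks: "\<And>c i \<sigma>. c \<in> lball s H \<Longrightarrow> \<sigma> = 1 \<or> \<sigma> = -1 \<Longrightarrow>
      (\<Sum>j<k. ptime (lball (c + int j *s axis i (\<sigma> * int m)) M) (detour_weight K r t)
         (c + int j *s axis i (\<sigma> * int m)) (c + int (Suc j) *s axis i (\<sigma> * int m))) \<le> B"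
    and z: "l1 z \<le> H"
  shows "ptime (lball s (H + M)) (detour_weight K r t) s (s + z) \<le> CARD('d) * (B + m * detour_bound TYPE('d) K r)"
proof -
  let ?w = "detour_weight K r t" and ?S = "lball s (H + M)" and ?W = "detour_bound TYPE('d) K r"
  have w: "nonneg_weight ?w" by (rule detour_weight_nonneg[OF t K])
  have W0: "0 \<le> ?W" using K by (auto simp: detour_bound_def)
  define zF where "zF F = (\<chi> i. if i \<in> F then z $ i else 0)" for F
  have zF_l1: "l1 (zF F) \<le> H" for F
  proof -
    have "l1 (zF F) \<le> l1 z" unfolding l1_def zF_def by (intro sum_mono) auto
    then show ?thesis using z by simp
  qed
  have ball: "lball (s + y) M \<subseteq> ?S" if "l1 y \<le> H" for y
    using that by (intro lball_subset) simp
  have "walks ?S s (s + zF F) \<noteq> {} \<and> ptime ?S ?w s (s + zF F) \<le> card F * (B + m * ?W)" if "finite F" for F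
    using that
  proof induction
    case empty
    have s: "s \<in> ?S" by simp
    have "zF {} = 0" by (simp add: zF_def vec_eq_iff)
    moreover have "ptime ?S ?w s s \<le> cost ?w [s]" by (rule ptime_le[OF w walks_single[OF s]])
    ultimately show ?case using walks_single[OF s] by auto
  next
    case (insert i F)
    define \<sigma> :: int where "\<sigma> = (if z $ i \<ge> 0 then 1 else -1)"
    have \<sigma>: "\<sigma> = 1 \<or> \<sigma> = -1" by (simp add: \<sigma>_def)
    define a where "a = nat \<bar>z $ i\<bar>"
    define q where "q = a div m"
    have zi: "z $ i = \<sigma> * int a" by (simp add: \<sigma>_def a_def)
    define u :: "int ^ 'd" where "u = axis i (\<sigma> * int m)"
    define c where "c = s + zF F"
    let ?p = "\<lambda>j. c + int j *s u"
    have mid: "l1 (zF F + axis i (\<sigma> * int b)) \<le> H" if b: "b \<le> a" for b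
    proof -
      have "l1 (zF F + axis i (\<sigma> * int b)) \<le> l1 z" unfolding l1_def
      proof (rule sum_mono)
        fix j show "nat \<bar>(zF F + axis i (\<sigma> * int b)) $ j\<bar> \<le> nat \<bar>z $ j\<bar>"
        proof (cases "j = i")
          case True
          then show ?thesis using insert.hyps b by (auto simp: zF_def axis_def a_def \<sigma>_def)
        qed (simp add: zF_def axis_def)
      qed
      then show ?thesis using z by simp
    qed
    have pj: "?p j = s + (zF F + axis i (\<sigma> * int (j * m)))" for j
      by (simp add: c_def u_def vec_eq_iff axis_def)
    have qa: "j \<le> q \<Longrightarrow> j * m \<le> a" for j
      unfolding q_def using m(1) by (metis div_times_less_eq_dividend le_trans mult_le_mono1)
    have cH: "c \<in> lball s H" using zF_l1 by (simp add: c_def lball_def)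
    have u_l1: "l1 u = m" using \<sigma> by (auto simp: u_def l1_axis)
    have nonneg: "0 \<le> ptime (lball (?p j) M) ?w (?p j) (?p (Suc j))" for j
    proof (rule ptime_nonneg[OF w walks_lball_nonempty])
      have "?p (Suc j) - ?p j = u" by (simp add: vec_eq_iff algebra_simps)
      then show "l1 (?p (Suc j) - ?p j) \<le> M" using u_l1 m by simp
    qed
    have cb: "walks ?S (?p 0) (?p q) \<noteq> {} \<and>
        ptime ?S ?w (?p 0) (?p q) \<le> (\<Sum>j<q. ptime (lball (?p j) M) ?w (?p j) (?p (Suc j)))"
    proof (rule chain_blocks[OF w, of ?p])
      show "?p 0 \<in> ?S" using cH lball_mono[of H "H + M" s] by auto
      fix j assume "j < q"
      then show "lball (?p j) M \<subseteq> ?S" unfolding pj by (intro ball mid qa) simp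
      have "?p (Suc j) - ?p j = u" by (simp add: vec_eq_iff algebra_simps)
      then show "l1 (?p (Suc j) - ?p j) \<le> M" using u_l1 m by simp
    qed
    have "a \<le> H" using component_le_l1[of z i] z by (simp add: a_def)
    then have "q \<le> (m * k) div m" unfolding q_def using k by (intro div_le_mono) simp
    then have qk: "q \<le> k" using m(1) by simp
    \<comment> \<open>The hypothesis speaks of chains of \<open>k\<close> blocks; dropping the
      surplus ones only lowers the sum, as passage times are nonnegative.\<close>
    have "(\<Sum>j<q. ptime (lball (?p j) M) ?w (?p j) (?p (Suc j))) \<le> (\<Sum>j<k. ptime (lball (?p j) M) ?w (?p j) (?p (Suc j)))"
      using qk nonneg by (intro sum_mono2) auto
    also have "\<dots> \<le> B" unfolding u_def by (rule blocks[OF cH \<sigma>])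
    finally have 1: "ptime ?S ?w c (?p q) \<le> B" using cb by simp
    let ?e = "s + zF (insert i F)"
    have e: "?e - ?p q = axis i (\<sigma> * int (a mod m))"
    proof -
      have "a = q * m + a mod m" by (simp add: q_def)
      then have "int a = int (q * m) + int (a mod m)" by (metis of_nat_add)
      then have "\<sigma> * int a - \<sigma> * int (q * m) = \<sigma> * int (a mod m)" by (simp add: algebra_simps)
      then show ?thesis unfolding pj using insert.hyps(2) zi
        by (auto simp: zF_def vec_eq_iff axis_def)
    qed
    have le: "l1 (?e - ?p q) \<le> m" unfolding e using \<sigma> m(1) by (auto simp: l1_axis mod_le_divisor)
    have sub: "lball (?p q) M \<subseteq> ?S" unfolding pj by (intro ball mid qa) simp
    have le': "l1 (?e - ?p q) \<le> M" using le m by simp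
    have ne2: "walks (lball (?p q) M) (?p q) ?e \<noteq> {}" by (rule walks_lball_nonempty[OF le'])
    have "ptime (lball (?p q) M) ?w (?p q) ?e \<le> real (l1 (?e - ?p q)) * ?W"
      by (rule ptime_le_straight(2)[OF t K le'])
    also have "\<dots> \<le> m * ?W" using le W0 by (intro mult_right_mono) auto
    finally have 2: "ptime (lball (?p q) M) ?w (?p q) ?e \<le> m * ?W" .
    have ne1: "walks ?S c (?p q) \<noteq> {}" using cb by simp
    have ne0: "walks ?S s c \<noteq> {}" and T0: "ptime ?S ?w s c \<le> card F * (B + m * ?W)"
      using insert.IH by (auto simp: c_def)
    have "ptime ?S ?w s (?p q) \<le> ptime ?S ?w s c + ptime ?S ?w c (?p q)"
      by (rule ptime_triangle[OF w order_refl order_refl ne0 ne1])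
    moreover have ne3: "walks ?S s (?p q) \<noteq> {}" using ne0 ne1 walks_join(1) by blast
    moreover have "ptime ?S ?w s ?e \<le> ptime ?S ?w s (?p q) + ptime (lball (?p q) M) ?w (?p q) ?e"
      by (rule ptime_triangle[OF w order_refl sub ne3 ne2])
    moreover have "walks ?S s ?e \<noteq> {}"
    proof -
      obtain vs ws where vs: "vs \<in> walks ?S s (?p q)" and "ws \<in> walks (lball (?p q) M) (?p q) ?e"
        using ne2 ne3 by blast
      then have "ws \<in> walks ?S (?p q) ?e" using walks_mono[OF sub] by blast
      from walks_join(1)[OF vs this] show ?thesis by blast
    qed
    moreover have "card (insert i F) * (B + m * ?W) = card F * (B + m * ?W) + B + m * ?W"
      using insert.hyps by (simp add: algebra_simps)
    ultimately show ?case using T0 1 2 by linarith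
  qed
  from this[of UNIV] show ?thesis by (simp add: zF_def)
qed

section \<open>Isometries fixing the origin\<close>

text \<open>Fixing 0 makes the balls around 0 invariant, so that these maps preserve
  \<open>mean_time\<close>.\<close>

definition lattice_iso0 :: "(int ^ 'd::finite \<Rightarrow> int ^ 'd) \<Rightarrow> bool" where
  "lattice_iso0 \<phi> \<longleftrightarrow> bij \<phi> \<and> \<phi> 0 = 0 \<and> (\<forall>x y. l1 (\<phi> x - \<phi> y) = l1 (x - y))"

lemma lattice_iso0_auto: "lattice_iso0 \<phi> \<Longrightarrow> lattice_auto \<phi>"
  by (auto simp: lattice_iso0_def lattice_auto_def lattice_adj_iff_l1)

lemma lattice_iso0_l1: "lattice_iso0 \<phi> \<Longrightarrow> l1 (\<phi> x) = l1 x"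
  unfolding lattice_iso0_def by (metis diff_zero)

lemma lattice_iso0_ball:
  fixes \<phi> :: "int ^ 'd::finite \<Rightarrow> int ^ 'd"
  assumes "lattice_iso0 \<phi>"
  shows "\<phi> ` lball 0 m = lball 0 m"
proof
  show "\<phi> ` lball 0 m \<subseteq> lball 0 m" using lattice_iso0_l1[OF assms] by (auto simp: lball_def)
  show "lball 0 m \<subseteq> \<phi> ` lball 0 m"
  proof
    fix y :: "int ^ 'd" assume y: "y \<in> lball 0 m"
    have "surj \<phi>" using assms by (simp add: lattice_iso0_def bij_is_surj)
    then obtain x where "y = \<phi> x" by (rule surjE)
    then show "y \<in> \<phi> ` lball 0 m" using y lattice_iso0_l1[OF assms] by (auto simp: lball_def)
  qed
qed

lemma lattice_iso0_reflect:
  assumes "\<And>i. s i = 1 \<or> s i = (-1 :: int)"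
  shows "lattice_iso0 (\<lambda>x :: int ^ 'd::finite. \<chi> i. s i * x $ i)"
proof -
  let ?f = "\<lambda>x :: int ^ 'd. \<chi> i. s i * x $ i"
  have ss: "s i * s i = 1" "\<bar>s i\<bar> = 1" for i using assms[of i] by auto
  have "?f \<circ> ?f = id" by (simp add: fun_eq_iff vec_eq_iff ss flip: mult.assoc)
  then have "bij ?f" using o_bij by blast
  moreover have "l1 (?f x - ?f y) = l1 (x - y)" for x y
  proof -
    have "\<bar>s i * x $ i - s i * y $ i\<bar> = \<bar>x $ i - y $ i\<bar>" for i
      using ss(2)[of i] by (simp add: abs_mult flip: right_diff_distrib)
    then show ?thesis by (simp add: l1_def)
  qed
  ultimately show ?thesis by (simp add: lattice_iso0_def vec_eq_iff)
qed

lemma lattice_iso0_permute: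
  assumes "bij \<pi>"
  shows "lattice_iso0 (\<lambda>x :: int ^ 'd::finite. \<chi> i. x $ \<pi> i)"
proof -
  let ?f = "\<lambda>x :: int ^ 'd. \<chi> i. x $ \<pi> i" and ?g = "\<lambda>x :: int ^ 'd. \<chi> i. x $ inv \<pi> i"
  have "?g \<circ> ?f = id" "?f \<circ> ?g = id"
    using assms by (simp_all add: fun_eq_iff vec_eq_iff bij_is_surj surj_f_inv_f bij_is_inj inv_f_f)
  then have "bij ?f" using o_bij by blast
  moreover have "l1 (?f x - ?f y) = l1 (x - y)" for x y
    unfolding l1_def using sum.reindex_bij_betw[OF assms, of "\<lambda>i. nat \<bar>(x - y) $ i\<bar>"] by simp
  ultimately show ?thesis by (simp add: lattice_iso0_def vec_eq_iff)
qed

section \<open>Expected passage times, limit times and the time constant\<close>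

context fpp_field
begin

lemma W_local_cluster_le:
  assumes "e \<in> lattice_edges"
  shows "W r \<omega> e \<le> K + real (4 * CARD('d)) * K * (\<Sum>v\<in>e. real (card (local_cluster (bad \<omega>) r v)))"
proof -
  have "0 \<le> real (4 * CARD('d)) * K * (\<Sum>v\<in>e. real (card (local_cluster (bad \<omega>) r v)))"
    using K_pos by (intro mult_nonneg_nonneg sum_nonneg) auto
  moreover have "W r \<omega> e \<le> K \<or> W r \<omega> e = real (4 * CARD('d)) * K * (\<Sum>v\<in>e. real (card (local_cluster (bad \<omega>) r v)))"
    by (simp add: detour_weight_def)
  ultimately show ?thesis using K_pos by linarith
qed

lemma integrable_W: "e \<in> lattice_edges \<Longrightarrow> A \<in> events \<Longrightarrow> integrable M (\<lambda>\<omega>. W r \<omega> e * indicator A \<omega>)"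
proof (rule integrable_const_bound[where B = "detour_bound TYPE('d) K r"])
  assume e: "e \<in> lattice_edges" and A: "A \<in> events"
  have "0 \<le> detour_bound TYPE('d) K r" using detour_bound_pos[OF K_pos, of r] by (rule less_imp_le)
  then show "AE \<omega> in M. norm (W r \<omega> e * indicator A \<omega>) \<le> detour_bound TYPE('d) K r"
    using W_nonneg e detour_weight_le[OF e, of K r] K_pos
    by (intro AE_I2) (auto simp: nonneg_weight_def indicator_def)
  show "(\<lambda>\<omega>. W r \<omega> e * indicator A \<omega>) \<in> borel_measurable M"
    using measurable_w[OF e] A by measurable
qed

lemma expectation_W:
  assumes e: "e \<in> lattice_edges" and A: "A \<in> events"
  shows "expectation (\<lambda>\<omega>. W r \<omega> e * indicator A \<omega>) \<le>
    detour_bound TYPE('d) K \<rho> * prob A + 8 * CARD('d) * K * (1 / 2) ^ \<rho>"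
proof -
  let ?c = "real (4 * CARD('d)) * K"
  let ?X = "\<lambda>v \<omega>. real (card (local_cluster (bad \<omega>) r v)) * indicator A \<omega>"
  have iX: "integrable M (?X v)" for v
  proof (rule integrable_const_bound[where B = "real ((2 * r + 1) ^ CARD('d))"])
    show "AE \<omega> in M. norm (?X v \<omega>) \<le> real ((2 * r + 1) ^ CARD('d))"
      using card_local_cluster[of "bad \<omega>" r v for \<omega>]
      by (intro AE_I2) (auto simp: indicator_def simp del: of_nat_power)
    show "?X v \<in> borel_measurable M" using A measurable_cluster by measurable
  qed
  have iA: "integrable M (\<lambda>\<omega>. K * indicator A \<omega>)"
    using A by (intro integrable_mult_right integrable_real_indicator) (auto simp: emeasure_eq_measure)
  have iS: "integrable M (\<lambda>\<omega>. ?c * (\<Sum>v\<in>e. ?X v \<omega>))"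
    using iX by (intro integrable_mult_right Bochner_Integration.integrable_sum) auto
  have "expectation (\<lambda>\<omega>. W r \<omega> e * indicator A \<omega>) \<le> expectation (\<lambda>\<omega>. K * indicator A \<omega> + ?c * (\<Sum>v\<in>e. ?X v \<omega>))"
  proof (rule integral_mono[OF integrable_W[OF e A]])
    show "integrable M (\<lambda>\<omega>. K * indicator A \<omega> + ?c * (\<Sum>v\<in>e. ?X v \<omega>))"
      by (rule Bochner_Integration.integrable_add[OF iA iS])
    fix \<omega>
    show "W r \<omega> e * indicator A \<omega> \<le> K * indicator A \<omega> + ?c * (\<Sum>v\<in>e. ?X v \<omega>)"
      using W_local_cluster_le[OF e, of r \<omega>] by (cases "\<omega> \<in> A") auto
  qed
  also have "\<dots> = K * prob A + ?c * (\<Sum>v\<in>e. expectation (?X v))"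
    unfolding Bochner_Integration.integral_add[OF iA iS] using iX A
    by (simp add: Bochner_Integration.integral_sum)
  also have "\<dots> \<le> K * prob A + ?c * (\<Sum>v\<in>e. real ((2 * \<rho> + 1) ^ CARD('d)) * prob A + (1 / 2) ^ \<rho>)"
    using K_pos by (intro add_left_mono mult_left_mono sum_mono expectation_cluster[OF A]) auto
  also have "\<dots> = K * prob A + ?c * (2 * (real ((2 * \<rho> + 1) ^ CARD('d)) * prob A + (1 / 2) ^ \<rho>))"
    using finite_lattice_edge[OF e] by simp
  also have "\<dots> = detour_bound TYPE('d) K \<rho> * prob A + 8 * CARD('d) * K * (1 / 2) ^ \<rho>"
    by (simp add: detour_bound_def algebra_simps)
  finally show ?thesis .
qed

lemma expectation_cost:
  assumes A: "A \<in> events" and vs: "path_edges vs \<subseteq> lattice_edges"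
  shows "integrable M (\<lambda>\<omega>. cost (W r \<omega>) vs * indicator A \<omega>) \<and>
    expectation (\<lambda>\<omega>. cost (W r \<omega>) vs * indicator A \<omega>) \<le> real (length vs - 1) *
      (detour_bound TYPE('d) K \<rho> * prob A + 8 * CARD('d) * K * (1 / 2) ^ \<rho>)"
  using vs
proof (induction vs rule: induct_list012)
  case (3 x y vs)
  let ?B = "detour_bound TYPE('d) K \<rho> * prob A + 8 * CARD('d) * K * (1 / 2) ^ \<rho>"
  have e: "{x, y} \<in> lattice_edges" using 3(3) by simp
  have IH: "integrable M (\<lambda>\<omega>. cost (W r \<omega>) (y # vs) * indicator A \<omega>)"
    "expectation (\<lambda>\<omega>. cost (W r \<omega>) (y # vs) * indicator A \<omega>) \<le> real (length (y # vs) - 1) * ?B"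
    using 3(2,3) by auto
  have eq: "cost (W r \<omega>) (x # y # vs) * indicator A \<omega> =
      W r \<omega> {x, y} * indicator A \<omega> + cost (W r \<omega>) (y # vs) * indicator A \<omega>" for \<omega>
    by (simp add: distrib_right)
  have "expectation (\<lambda>\<omega>. cost (W r \<omega>) (x # y # vs) * indicator A \<omega>) \<le> ?B + real (length (y # vs) - 1) * ?B"
    unfolding eq Bochner_Integration.integral_add[OF integrable_W[OF e A] IH(1)]
    by (intro add_mono expectation_W[OF e A] IH(2))
  also have "\<dots> = real (length (x # y # vs) - 1) * ?B" by (simp add: algebra_simps)
  finally show ?case unfolding eq
    using Bochner_Integration.integrable_add[OF integrable_W[OF e A] IH(1)] by (simp add: eq)
qed (use K_pos in auto)

text \<open>A straight walk dominates the passage time, and its expected cost is bounded edge by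
  edge. The bound is uniform in the cut-off \<open>r\<close>, and on an unlikely event
  \<open>A\<close> it becomes small for a suitable \<open>\<rho>\<close>.\<close>

lemma expectation_T_on_event:
  assumes A: "A \<in> events" and m: "l1 u \<le> m"
  shows "expectation (\<lambda>\<omega>. ptime (lball 0 m) (W r \<omega>) 0 u * indicator A \<omega>) \<le>
    real (l1 u) * (detour_bound TYPE('d) K \<rho> * prob A + 8 * CARD('d) * K * (1 / 2) ^ \<rho>)"
proof -
  have m': "l1 (u - 0) \<le> m" using m by simp
  obtain vs where vs: "vs \<in> walks (lball 0 m) 0 u" "length vs = Suc (l1 (u - 0))"
    by (rule exists_straight_walk'[OF m'])
  have pe: "path_edges vs \<subseteq> lattice_edges" using vs(1) walk_path_edges by (auto simp: walks_def)
  note c = expectation_cost[OF A pe, of r \<rho>]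
  have "expectation (\<lambda>\<omega>. ptime (lball 0 m) (W r \<omega>) 0 u * indicator A \<omega>) \<le> expectation (\<lambda>\<omega>. cost (W r \<omega>) vs * indicator A \<omega>)"
  proof (rule integral_mono)
    show "integrable M (\<lambda>\<omega>. ptime (lball 0 m) (W r \<omega>) 0 u * indicator A \<omega>)"
      by (rule integrable_real_mult_indicator[OF A integrable_T[OF m']])
    show "integrable M (\<lambda>\<omega>. cost (W r \<omega>) vs * indicator A \<omega>)" using c by blast
    fix \<omega> assume "\<omega> \<in> space M"
    then show "ptime (lball 0 m) (W r \<omega>) 0 u * indicator A \<omega> \<le> cost (W r \<omega>) vs * indicator A \<omega>"
      using vs(1) by (intro mult_right_mono ptime_le W_nonneg) auto
  qed
  then show ?thesis using c vs(2) by simp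
qed

text \<open>The per-edge bound of \<open>expectation_T_on_event\<close> at \<open>\<rho> = 0\<close>
  and \<open>A = space M\<close>.\<close>

definition mean_bound :: real where
  "mean_bound = K + 16 * CARD('d) * K"

lemma mean_time_le: "l1 u \<le> m \<Longrightarrow> mean_time m r u \<le> real (l1 u) * mean_bound"
proof -
  assume m: "l1 u \<le> m"
  have "expectation (\<lambda>\<omega>. ptime (lball 0 m) (W r \<omega>) 0 u * indicator (space M) \<omega>) = mean_time m r u"
    unfolding mean_time_def by (intro Bochner_Integration.integral_cong) auto
  moreover have "detour_bound TYPE('d) K 0 * prob (space M) + 8 * CARD('d) * K * (1 / 2) ^ 0 = mean_bound"
    by (simp add: detour_bound_def mean_bound_def prob_space)
  ultimately show ?thesis
    using expectation_T_on_event[OF sets.top m, of r 0] by simp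
qed

lemma mean_time_nonneg: "l1 u \<le> m \<Longrightarrow> 0 \<le> mean_time m r u"
  unfolding mean_time_def using T_bounds(1)[of _ u 0 m r] by (intro integral_nonneg_AE AE_I2) simp

lemma mean_time_antimono:
  assumes "l1 u \<le> m" "m \<le> m'"
  shows "mean_time m' r u \<le> mean_time m r u"
  unfolding mean_time_def
proof (rule integral_mono)
  show "integrable M (\<lambda>\<omega>. ptime (lball 0 m') (W r \<omega>) 0 u)" "integrable M (\<lambda>\<omega>. ptime (lball 0 m) (W r \<omega>) 0 u)"
    using integrable_T[of u 0 m' r] integrable_T[of u 0 m r] assms by auto
  fix \<omega> assume "\<omega> \<in> space M"
  then show "ptime (lball 0 m') (W r \<omega>) 0 u \<le> ptime (lball 0 m) (W r \<omega>) 0 u"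
    using assms by (intro ptime_mono W_nonneg walks_lball_nonempty lball_mono) auto
qed

text \<open>\<open>mean_time\<close> increases with the cut-off and decreases with the ball, so both
  extrema are limits. The supremum over \<open>r\<close> stands inside because the cut-off
  \<open>rad n\<close> grows with the scale while the ball of a block is fixed.\<close>

definition limit_time :: "int ^ 'd \<Rightarrow> real" where
  "limit_time u = (INF m\<in>{l1 u..}. SUP r. mean_time m r u)"

lemma bdd_above_mean: "l1 u \<le> m \<Longrightarrow> bdd_above (range (\<lambda>r. mean_time m r u))"
  using mean_time_le by (intro bdd_aboveI[of _ "real (l1 u) * mean_bound"]) auto

lemma mean_le_SUP: "l1 u \<le> m \<Longrightarrow> mean_time m r u \<le> (SUP r. mean_time m r u)"
  by (rule cSUP_upper[OF _ bdd_above_mean]) auto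

lemma SUP_mean_nonneg: "l1 u \<le> m \<Longrightarrow> 0 \<le> (SUP r. mean_time m r u)"
  using mean_le_SUP[of u m 0] mean_time_nonneg[of u m 0] by linarith

lemma bdd_below_SUP: "bdd_below ((\<lambda>m. SUP r. mean_time m r u) ` {l1 u..})"
  using SUP_mean_nonneg by (intro bdd_belowI[of _ 0]) auto

lemma limit_time_nonneg: "0 \<le> limit_time u"
  unfolding limit_time_def using SUP_mean_nonneg by (intro cINF_greatest) auto

lemma limit_time_le:
  assumes "l1 u \<le> m" "\<And>r. mean_time m r u \<le> c"
  shows "limit_time u \<le> c"
proof -
  have "limit_time u \<le> (SUP r. mean_time m r u)"
    unfolding limit_time_def using assms(1) by (intro cINF_lower bdd_below_SUP) auto
  also have "\<dots> \<le> c" using assms(2) by (intro cSUP_least) auto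
  finally show ?thesis .
qed

lemma limit_time_approx:
  assumes "\<eta> > 0"
  obtains m where "l1 u \<le> m" "\<And>r. mean_time m r u \<le> limit_time u + \<eta>"
proof -
  have "\<exists>m\<in>{l1 u..}. (SUP r. mean_time m r u) < limit_time u + \<eta>"
    unfolding limit_time_def using assms by (subst cINF_less_iff[symmetric]) (auto intro: bdd_below_SUP)
  then obtain m where "l1 u \<le> m" "(SUP r. mean_time m r u) < limit_time u + \<eta>" by auto
  then show ?thesis using that[of m] mean_le_SUP[of u m] by (meson less_imp_le order_trans)
qed

text \<open>Travel goes to \<open>u\<close> inside a ball around 0 and on to \<open>u + v\<close>
  inside a ball around \<open>u\<close>; translation invariance identifies the mean of the second
  leg.\<close>

lemma limit_time_subadd: "limit_time (u + v) \<le> limit_time u + limit_time v"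
proof (rule field_le_epsilon)
  fix \<eta> :: real assume \<eta>: "\<eta> > 0"
  then have h: "\<eta> / 2 > 0" by simp
  obtain m1 where m1: "l1 u \<le> m1" "\<And>r. mean_time m1 r u \<le> limit_time u + \<eta> / 2"
    using limit_time_approx[OF h] by blast
  obtain m2 where m2: "l1 v \<le> m2" "\<And>r. mean_time m2 r v \<le> limit_time v + \<eta> / 2"
    using limit_time_approx[OF h] by blast
  define m where "m = max m1 (l1 u + m2)"
  have uv: "l1 (u + v) \<le> m" using l1_triangle[of u v] m2(1) by (simp add: m_def)
  have sub: "lball 0 m1 \<subseteq> lball 0 m" "lball u m2 \<subseteq> lball 0 m"
    by (auto intro!: lball_mono lball_subset simp: m_def)
  have "mean_time m r (u + v) \<le> mean_time m1 r u + mean_time m2 r v" for r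
  proof -
    have i: "integrable M (\<lambda>\<omega>. ptime (lball 0 m1) (W r \<omega>) 0 u)" "integrable M (\<lambda>\<omega>. ptime (lball u m2) (W r \<omega>) u (u + v))"
      "integrable M (\<lambda>\<omega>. ptime (lball 0 m) (W r \<omega>) 0 (u + v))"
      using integrable_T[of u 0 m1 r] integrable_T[of "u + v" u m2 r] integrable_T[of "u + v" 0 m r] m1 m2 uv by auto
    have "mean_time m r (u + v) \<le> expectation (\<lambda>\<omega>. ptime (lball 0 m1) (W r \<omega>) 0 u + ptime (lball u m2) (W r \<omega>) u (u + v))"
      unfolding mean_time_def
    proof (rule integral_mono[OF i(3) Bochner_Integration.integrable_add[OF i(1,2)]])
      fix \<omega> assume "\<omega> \<in> space M"
      then show "ptime (lball 0 m) (W r \<omega>) 0 (u + v) \<le> ptime (lball 0 m1) (W r \<omega>) 0 u + ptime (lball u m2) (W r \<omega>) u (u + v)"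
        using m1(1) m2(1) by (intro ptime_triangle W_nonneg sub walks_lball_nonempty) auto
    qed
    also have "\<dots> = mean_time m1 r u + mean_time m2 r v"
      unfolding Bochner_Integration.integral_add[OF i(1,2)] mean_time_shift by (simp add: mean_time_def)
    finally show ?thesis .
  qed
  then have "mean_time m r (u + v) \<le> limit_time u + limit_time v + \<eta>" for r
    using m1(2)[of r] m2(2)[of r] by (smt (verit) field_sum_of_halves)
  then show "limit_time (u + v) \<le> limit_time u + limit_time v + \<eta>" by (rule limit_time_le[OF uv])
qed

lemma mean_time_iso:
  assumes "lattice_iso0 \<phi>"
  shows "mean_time m r (\<phi> u) = mean_time m r u"
proof -
  have "\<phi> 0 = 0" using assms by (simp add: lattice_iso0_def)
  then show ?thesis
    using mean_time_auto[OF lattice_iso0_auto[OF assms], of m r u] lattice_iso0_ball[OF assms, of m]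
    by (simp add: mean_time_def)
qed

lemma limit_time_iso: "lattice_iso0 \<phi> \<Longrightarrow> limit_time (\<phi> u) = limit_time u"
  by (simp add: limit_time_def mean_time_iso lattice_iso0_l1)

lemma limit_time_0: "limit_time 0 = 0"
proof -
  have "mean_time 0 r 0 \<le> 0" for r using mean_time_le[of 0 0 r] by simp
  then have "limit_time 0 \<le> 0" by (intro limit_time_le[of 0 0]) auto
  then show ?thesis using limit_time_nonneg[of 0] by simp
qed

lemma limit_time_scale: "limit_time (int n *s u) \<le> n * limit_time u"
proof (induction n)
  case 0
  have "(int 0 *s u) = 0" by (simp add: vec_eq_iff)
  then show ?case by (simp add: limit_time_0)
next
  case (Suc n)
  have "int (Suc n) *s u = int n *s u + u" by (simp add: vec_eq_iff algebra_simps)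
  then have "limit_time (int (Suc n) *s u) \<le> limit_time (int n *s u) + limit_time u"
    using limit_time_subadd[of "int n *s u" u] by (simp only:)
  also have "\<dots> \<le> n * limit_time u + limit_time u" using Suc by simp
  finally show ?case by (simp add: algebra_simps)
qed

text \<open>By subadditivity of \<open>limit_time\<close> this infimum is the limit of the
  quotients, by Fekete's lemma.\<close>

definition time_constant :: "int ^ 'd \<Rightarrow> real" where
  "time_constant u = (INF n\<in>{1..}. limit_time (int n *s u) / real n)"

lemma time_constant_le: "1 \<le> n \<Longrightarrow> real n * time_constant u \<le> limit_time (int n *s u)"
proof -
  assume n: "1 \<le> n"
  have "time_constant u \<le> limit_time (int n *s u) / real n"
    unfolding time_constant_def using n limit_time_nonneg
    by (intro cINF_lower bdd_belowI2[of _ 0]) auto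
  then show ?thesis using n by (simp add: field_simps)
qed

lemma time_constant_greatest:
  "(\<And>n. 1 \<le> n \<Longrightarrow> real n * c \<le> limit_time (int n *s u)) \<Longrightarrow> c \<le> time_constant u"
  unfolding time_constant_def by (intro cINF_greatest) (auto simp: field_simps)

lemma time_constant_nonneg: "0 \<le> time_constant u"
  by (rule time_constant_greatest) (simp add: limit_time_nonneg)

lemma time_constant_approx:
  assumes "\<eta> > 0"
  obtains n where "1 \<le> n" "limit_time (int n *s u) \<le> real n * (time_constant u + \<eta>)"
proof -
  have "\<exists>n\<in>{1..}. limit_time (int n *s u) / real n < time_constant u + \<eta>"
    unfolding time_constant_def using assms limit_time_nonneg
    by (subst cINF_less_iff[symmetric]) (auto intro!: bdd_belowI2[of _ 0])
  then obtain n where "1 \<le> n" "limit_time (int n *s u) / real n < time_constant u + \<eta>" by auto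
  then show ?thesis using that[of n] by (simp add: field_simps)
qed

text \<open>An upper bound at \<open>n\<close> persists at multiples of \<open>n\<close> by
  \<open>limit_time_scale\<close>, so the product of the individual choices serves all
  vectors.\<close>

lemma time_constant_approx_finite:
  assumes "\<eta> > 0" "finite Z"
  obtains n where "1 \<le> n" "\<And>u. u \<in> Z \<Longrightarrow> limit_time (int n *s u) \<le> real n * (time_constant u + \<eta>)"
proof -
  have "\<exists>n\<ge>1. \<forall>u\<in>Z. limit_time (int n *s u) \<le> real n * (time_constant u + \<eta>)"
    using assms(2)
  proof induction
    case (insert v Z)
    then obtain n where n: "1 \<le> n" "\<And>u. u \<in> Z \<Longrightarrow> limit_time (int n *s u) \<le> real n * (time_constant u + \<eta>)" by blast
    obtain n' where n': "1 \<le> n'" "limit_time (int n' *s v) \<le> real n' * (time_constant v + \<eta>)"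
      using time_constant_approx[OF assms(1)] by blast
    have up: "limit_time (int (k * n) *s u) \<le> real (k * n) * (time_constant u + \<eta>)"
      if l: "limit_time (int n *s u) \<le> real n * (time_constant u + \<eta>)" for k n u
    proof -
      have "int (k * n) *s u = int k *s (int n *s u)" by (simp add: vec_eq_iff)
      then have "limit_time (int (k * n) *s u) \<le> real k * limit_time (int n *s u)"
        using limit_time_scale[of k "int n *s u"] by (simp only:)
      also have "\<dots> \<le> real k * (real n * (time_constant u + \<eta>))" using l by (intro mult_left_mono) auto
      finally show ?thesis by (simp add: mult.assoc)
    qed
    have "\<forall>u\<in>insert v Z. limit_time (int (n * n') *s u) \<le> real (n * n') * (time_constant u + \<eta>)"
      using up[of n' v n] up[of n _ n'] n n' by (auto simp: mult.commute)
    moreover have "1 \<le> n * n'" using n(1) n'(1) by (simp add: Suc_leI)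
    ultimately show ?case by blast
  qed auto
  then show ?thesis using that by blast
qed

end

section \<open>Events of high probability at large scales\<close>

lemma detour_bound_rad_le:
  assumes "0 \<le> K"
  shows "eventually (\<lambda>n. detour_bound TYPE('d::finite) K (rad n) \<le> real n) sequentially"
proof -
  have "eventually (\<lambda>n::nat. K + 8 * real CARD('d) * K * (2 * (ln (real n))\<^sup>2 + 1) ^ CARD('d) \<le> real n) sequentially"
    by real_asymp
  then show ?thesis
    by eventually_elim (rule order_trans[OF detour_bound_mono[OF assms rad_le]])
qed

text \<open>This is the error of \<open>expectation_T_on_event\<close> at
  \<open>\<rho> = rad n\<close>: \<open>detour_bound\<close> is polylogarithmic against 1 / n^2, and
  \<open>(1 / 2) ^ rad n\<close> is smaller still.\<close>

lemma exceptional_error_small: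
  assumes "0 \<le> K" "0 \<le> B" "0 \<le> c" "0 \<le> D" "0 < \<epsilon>"
  shows "eventually (\<lambda>n. B * (detour_bound TYPE('d::finite) K (rad n) * (c / real n ^ 2) + D * (1 / 2) ^ rad n) < \<epsilon>) sequentially"
proof -
  have "eventually (\<lambda>n::nat. B * ((K + 8 * real CARD('d) * K * (2 * (ln (real n))\<^sup>2 + 1) ^ CARD('d)) * (c / real n ^ 2)
      + D * (2 * (1 / 2) powr ((ln (real n))\<^sup>2))) < \<epsilon>) sequentially"
    using assms(5) by real_asymp
  then show ?thesis
  proof eventually_elim
    case (elim n)
    have "(1 / 2 :: real) ^ rad n = 2 * (1 / 2) powr real (Suc (rad n))" by (subst powr_realpow) auto
    also have "\<dots> \<le> 2 * (1 / 2) powr ((ln (real n))\<^sup>2)" by (intro mult_left_mono powr_mono'[OF rad_ge]) auto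
    finally have "B * (detour_bound TYPE('d) K (rad n) * (c / real n ^ 2) + D * (1 / 2) ^ rad n) \<le>
      B * ((K + 8 * real CARD('d) * K * (2 * (ln (real n))\<^sup>2 + 1) ^ CARD('d)) * (c / real n ^ 2)
      + D * (2 * (1 / 2) powr ((ln (real n))\<^sup>2)))"
      using assms by (intro mult_left_mono add_mono mult_right_mono detour_bound_mono rad_le) auto
    then show ?case using elim by linarith
  qed
qed

context fpp_field
begin

lemma blocks_event:
  "{\<omega> \<in> space M. \<exists>c\<in>lball 0 q. x \<le> (\<Sum>j\<in>J. ptime (S c j) (W r \<omega>) (a c j) (b c j))} \<in> events"
proof -
  have "{\<omega> \<in> space M. \<exists>c\<in>lball 0 q. x \<le> (\<Sum>j\<in>J. ptime (S c j) (W r \<omega>) (a c j) (b c j))} =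
      (\<Union>c\<in>lball 0 q. {\<omega> \<in> space M. x \<le> (\<Sum>j\<in>J. ptime (S c j) (W r \<omega>) (a c j) (b c j))})" by auto
  also have "\<dots> \<in> events" by (intro sets.finite_UN T_sum_event finite_lball)
  finally show ?thesis .
qed

lemma short_clusters_likely:
  "eventually (\<lambda>n. \<exists>E\<in>events. prob E \<le> 1 / real n ^ 2 \<and>
    (\<forall>\<omega>\<in>space M - E. \<forall>v\<in>lball 0 (Q * n). no_long_path (bad \<omega>) (rad n) v)) sequentially"
  using long_paths_unlikely[of Q]
proof eventually_elim
  case (elim n)
  let ?E = "{\<omega> \<in> space M. \<exists>v\<in>lball 0 (Q * n). \<not> no_long_path (bad \<omega>) (rad n) v}"
  have "?E = (\<Union>v\<in>lball 0 (Q * n). {\<omega> \<in> space M. \<not> no_long_path (bad \<omega>) (rad n) v})" by auto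
  also have "\<dots> \<in> events" by (intro sets.finite_UN long_path_event finite_lball)
  finally show ?case using elim by (intro bexI[of _ ?E]) auto
qed

text \<open>\<open>slow_blocks_unlikely\<close> is applied to the \<open>2 * CARD('d)\<close> signed
  axis directions, which gives the constant, and \<open>reach\<close> assembles fast blocks into a
  path to any \<open>s + z\<close>.\<close>

lemma reach_likely:
  assumes m: "1 \<le> m" "m \<le> m1" and a: "\<And>r i \<sigma>. \<sigma> = 1 \<or> \<sigma> = -1 \<Longrightarrow> mean_time m1 r (axis i (\<sigma> * int m)) \<le> a"
    and \<eta>: "\<eta> > 0" and k: "\<And>n. n \<le> m * k n"
  shows "eventually (\<lambda>n. \<exists>E\<in>events. prob E \<le> 2 * CARD('d) / real n ^ 2 \<and>
    (\<forall>\<omega>\<in>space M - E. \<forall>s z. lball s n \<subseteq> lball 0 (Q * n) \<longrightarrow> l1 z \<le> n \<longrightarrow>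
      ptime (lball s (n + m1)) (W (rad n) \<omega>) s (s + z) \<le> CARD('d) * (real (k n) * (a + \<eta>) + m * detour_bound TYPE('d) K (rad n)))) sequentially"
proof -
  let ?u = "\<lambda>p. axis (fst p) (snd p * int m) :: int ^ 'd"
  let ?I = "(UNIV :: 'd set) \<times> {1, -1 :: int}"
  let ?ev = "\<lambda>n p. {\<omega> \<in> space M. \<exists>c\<in>lball 0 (Q * n). real (k n) * (a + \<eta>) \<le>
      (\<Sum>j<k n. ptime (lball (c + int j *s ?u p) m1) (W (rad n) \<omega>) (c + int j *s ?u p) (c + int (Suc j) *s ?u p))}"
  have "eventually (\<lambda>n. \<forall>p\<in>?I. prob (?ev n p) \<le> 1 / real n ^ 2) sequentially"
  proof (rule eventually_ball_finite)
    show "\<forall>p\<in>?I. eventually (\<lambda>n. prob (?ev n p) \<le> 1 / real n ^ 2) sequentially"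
    proof
      fix p assume "p \<in> ?I"
      then have p: "snd p = 1 \<or> snd p = -1" by auto
      then have l: "l1 (?u p) = m" by (auto simp: l1_axis)
      show "eventually (\<lambda>n. prob (?ev n p) \<le> 1 / real n ^ 2) sequentially"
      proof (rule slow_blocks_unlikely[OF _ _ _ \<eta> m(1) k])
        show "?u p \<noteq> 0" using l m(1) by (metis l1_zero not_one_le_zero)
        show "l1 (?u p) \<le> m1" using l m(2) by simp
        show "mean_time m1 r (?u p) \<le> a" for r by (rule a[OF p])
      qed
    qed
  qed simp
  then show ?thesis
  proof eventually_elim
    case (elim n)
    let ?E = "\<Union>p\<in>?I. ?ev n p"
    have evs: "?ev n p \<in> events" for p by (rule blocks_event)
    have "prob ?E \<le> (\<Sum>p\<in>?I. prob (?ev n p))"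
      by (rule finite_measure_subadditive_finite) (use evs in auto)
    also have "\<dots> \<le> (\<Sum>p\<in>?I. 1 / real n ^ 2)" using elim by (intro sum_mono) auto
    also have "\<dots> = 2 * CARD('d) / real n ^ 2" by (simp add: card_cartesian_product)
    finally have pE: "prob ?E \<le> 2 * CARD('d) / real n ^ 2" .
    have "ptime (lball s (n + m1)) (W (rad n) \<omega>) s (s + z) \<le> CARD('d) * (real (k n) * (a + \<eta>) + m * detour_bound TYPE('d) K (rad n))"
      if \<omega>: "\<omega> \<in> space M - ?E" and s: "lball s n \<subseteq> lball 0 (Q * n)" and z: "l1 z \<le> n" for \<omega> s z
    proof (rule reach[OF nonneg_t _ m k _ z])
      show "\<omega> \<in> space M" using \<omega> by simp
      show "0 \<le> K" using K_pos by simp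
      fix c i and \<sigma> :: int assume c: "c \<in> lball s n" and \<sigma>: "\<sigma> = 1 \<or> \<sigma> = -1"
      have "(i, \<sigma>) \<in> ?I" using \<sigma> by auto
      then have "\<omega> \<notin> ?ev n (i, \<sigma>)" using \<omega> by blast
      then show "(\<Sum>j<k n. ptime (lball (c + int j *s axis i (\<sigma> * int m)) m1) (W (rad n) \<omega>)
         (c + int j *s axis i (\<sigma> * int m)) (c + int (Suc j) *s axis i (\<sigma> * int m))) \<le> real (k n) * (a + \<eta>)"
        using \<omega> c s by (auto simp: not_le intro: less_imp_le)
    qed
    then show ?case using pE evs by (intro bexI[of _ ?E]) (auto intro!: sets.finite_UN)
  qed
qed

text \<open>Where all clusters fit into the cut-off \<open>\<rho>\<close>, a larger cut-off changes
  nothing, and a smaller one lowers the weights. So estimates at the cut-off of the scale become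
  estimates for every \<open>r\<close>, as the supremum in \<open>limit_time\<close>
  demands.\<close>

lemma ptime_stable:
  assumes \<omega>: "\<omega> \<in> space M" and short: "\<And>v. v \<in> S \<Longrightarrow> no_long_path (bad \<omega>) \<rho> v" and ne: "walks S x y \<noteq> {}"
  shows "ptime S (W r \<omega>) x y \<le> ptime S (W \<rho> \<omega>) x y"
proof (rule ptime_mono[OF W_nonneg[OF \<omega>] ne _ order_refl])
  fix e assume e: "e \<in> lattice_edges" "e \<subseteq> S"
  show "W r \<omega> e \<le> W \<rho> \<omega> e"
  proof (cases "\<rho> \<le> r")
    case True
    then show ?thesis using detour_weight_stable[of e K "t \<omega>" \<rho> r] short e(2) by fastforce
  next
    case False
    then show ?thesis using K_pos by (intro detour_weight_mono) auto
  qed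
qed

text \<open>The crossing uses edges of weight 0, whose detour weight is 0 too; its ends are joined
  to 0 and to the block corner \<open>int h *s w\<close> by links of cost at most \<open>L\<close>.
  The slack \<open>A - 1\<close> and \<open>A + 1\<close> around \<open>A\<close> comes from
  \<open>block_dist\<close>.\<close>

lemma crossing_shortcut:
  assumes \<omega>: "\<omega> \<in> space M" and h: "1 \<le> h" and A: "1 \<le> A" and n: "n = CARD('d) * h"
    and cr: "crossing n (A * n) {e. \<tau> e \<omega> \<le> 0} 0"
    and links: "\<And>s z. lball s n \<subseteq> lball 0 ((A + 2) * n) \<Longrightarrow> l1 z \<le> n \<Longrightarrow>
      ptime (lball s (n + 1)) (W r \<omega>) s (s + z) \<le> L"
  shows "\<exists>w. (A - 1) * CARD('d) \<le> l1 w \<and> l1 w \<le> (A + 1) * CARD('d) \<and>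
    ptime (lball 0 ((A + 4) * n)) (W r \<omega>) 0 (int h *s w) \<le> 2 * L"
proof -
  let ?S = "lball (0 :: int ^ 'd) ((A + 4) * n)"
  have n1: "1 \<le> n" using h by (simp add: n Suc_le_eq)
  obtain x y where xy: "l1 x \<le> n" "l1 y = A * n" and oc: "oconn (lball 0 (A * n)) {e. \<tau> e \<omega> \<le> 0} x y"
    using cr by (auto simp: crossing_def)
  have "n \<le> A * n" using A by simp
  with xy(1) have "l1 x \<le> A * n" by (rule le_trans)
  then have "x \<in> lball 0 (A * n)" by (simp add: lball_def)
  then obtain vs where vs: "vs \<in> walks (lball 0 (A * n)) x y" "path_edges vs \<subseteq> {e. \<tau> e \<omega> \<le> 0}"
    using oconn_imp_walk[OF oc] by blast
  define w where "w = block h y"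
  have dist: "l1 (y - int h *s w) \<le> n" unfolding w_def n by (rule block_dist[OF h])
  have hw: "l1 (int h *s w) = h * l1 w" by (simp add: l1_scale)
  have up: "h * l1 w \<le> (A + 1) * n"
    using l1_diff_triangle[of "int h *s w" 0 y] dist xy(2) hw by (simp add: l1_minus_commute[of _ y])
  have low: "A * n \<le> h * l1 w + n"
    using l1_diff_triangle[of y 0 "int h *s w"] dist xy(2) hw by simp
  have "h * l1 w \<le> h * ((A + 1) * CARD('d))" using up by (simp add: n algebra_simps)
  then have w_up: "l1 w \<le> (A + 1) * CARD('d)" using h by simp
  have "h * ((A - 1) * CARD('d)) \<le> h * l1 w"
    using low by (simp add: n algebra_simps diff_mult_distrib)
  then have w_low: "(A - 1) * CARD('d) \<le> l1 w" using h by simp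
  have w: "nonneg_weight (W r \<omega>)" by (rule W_nonneg[OF \<omega>])
  have S1: "lball 0 (n + 1) \<subseteq> ?S" and S2: "lball (int h *s w) (n + 1) \<subseteq> ?S" and S3: "lball 0 (A * n) \<subseteq> ?S"
    using n1 up hw by (auto intro!: lball_mono lball_subset simp: algebra_simps)
  have 1: "ptime (lball 0 (n + 1)) (W r \<omega>) 0 x \<le> L"
    using links[of 0 x] xy(1) by (simp add: lball_mono)
  have 2: "ptime (lball (int h *s w) (n + 1)) (W r \<omega>) (int h *s w) y \<le> L"
    using links[of "int h *s w" "y - int h *s w"] dist up hw by (simp add: lball_subset algebra_simps)
  have ne1: "walks (lball 0 (n + 1)) 0 x \<noteq> {}" using xy(1) by (intro walks_lball_nonempty) simp
  have ne2: "walks (lball (int h *s w) (n + 1)) y (int h *s w) \<noteq> {}"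
    using walks_lball_nonempty[of y "int h *s w" "n + 1"] dist walks_rev by fastforce
  have ne3: "walks (lball 0 (A * n)) x y \<noteq> {}" using vs(1) by blast
  have "ptime (lball 0 (A * n)) (W r \<omega>) x y \<le> cost (W r \<omega>) vs" by (rule ptime_le[OF w vs(1)])
  also have "\<dots> \<le> real (length vs - 1) * 0"
    using vs(2) K_pos by (intro cost_le_length) (force simp: detour_weight_def)
  finally have 3: "ptime (lball 0 (A * n)) (W r \<omega>) x y \<le> 0" by simp
  have t1: "ptime ?S (W r \<omega>) 0 y \<le> ptime (lball 0 (n + 1)) (W r \<omega>) 0 x + ptime (lball 0 (A * n)) (W r \<omega>) x y"
    by (rule ptime_triangle[OF w S1 S3 ne1 ne3])
  have ne4: "walks ?S 0 y \<noteq> {}" using xy(2) by (intro walks_lball_nonempty) simp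
  have t2: "ptime ?S (W r \<omega>) 0 (int h *s w) \<le> ptime ?S (W r \<omega>) 0 y + ptime (lball (int h *s w) (n + 1)) (W r \<omega>) y (int h *s w)"
    by (rule ptime_triangle[OF w order_refl S2 ne4 ne2])
  have "ptime (lball (int h *s w) (n + 1)) (W r \<omega>) y (int h *s w) \<le> L" using 2 by (simp add: ptime_sym)
  then have "ptime ?S (W r \<omega>) 0 (int h *s w) \<le> 2 * L" using t1 t2 1 3 by linarith
  then show ?thesis using w_up w_low by blast
qed

text \<open>Two links of cost at most \<open>CARD('d) * n * (mean_bound + 2)\<close> each, where
  \<open>n = CARD('d) * h\<close>, divided by \<open>h\<close>. The summand 2 absorbs the
  fluctuation and the detour bound. The value does not depend on \<open>A\<close>.\<close>

definition short_const :: real where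
  "short_const = 2 * CARD('d) * CARD('d) * (mean_bound + 2)"

text \<open>Crossings have probability bounded below at all scales, whereas travel times from block to
  block concentrate around their limit. Hence in some direction the time constant is bounded,
  no matter how long the direction vector is.\<close>

lemma bounded_time_constant:
  fixes \<delta> :: real
  assumes A: "2 \<le> A" and \<delta>: "\<delta> > 0"
    and cr: "\<And>h. 1 \<le> h \<Longrightarrow> \<delta> \<le> prob {\<omega> \<in> space M. crossing (CARD('d) * h) (A * CARD('d) * h) {e. \<tau> e \<omega> \<le> 0} 0}"
  shows "\<exists>w. (A - 1) * CARD('d) \<le> l1 w \<and> time_constant w \<le> short_const + 1"
proof (rule ccontr)
  assume no: "\<not> ?thesis"
  let ?d = "CARD('d)"
  have d1: "1 \<le> ?d" by (simp add: Suc_leI)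
  \<comment> \<open>The block coordinates in which a crossing can end. Their number does not depend
    on the scale \<open>h\<close>, which makes the pigeonhole argument below uniform.\<close>
  define Z where "Z = {w :: int ^ 'd. (A - 1) * ?d \<le> l1 w \<and> l1 w \<le> (A + 1) * ?d}"
  have "Z \<subseteq> lball 0 ((A + 1) * ?d)" by (auto simp: Z_def lball_def)
  then have finZ: "finite Z" by (rule finite_subset) simp
  have big: "time_constant w > short_const + 1" if w: "w \<in> Z" for w
  proof -
    have "(A - 1) * ?d \<le> l1 w" using w by (simp add: Z_def)
    then have "\<not> time_constant w \<le> short_const + 1" using no by blast
    then show ?thesis by simp
  qed
  define z where "z = real (card Z) + 1"
  \<comment> \<open>Half of \<delta> is lost to exceptional events and the rest is shared among the
    members of \<open>Z\<close>. With \<eta> an eighth of \<delta>', the three \<eta> in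
    \<open>Y\<close> and the error 5 \<delta>' / 8 use up exactly the gain \<delta>' at the
    end.\<close>
  define \<delta>' where "\<delta>' = \<delta> / (2 * z)"
  define \<eta> where "\<eta> = \<delta>' / 8"
  \<comment> \<open>The constants of the three exceptional events: \<open>2 * CARD('d)\<close> for
    slow axis blocks, \<open>card Z\<close> for slow blocks in the candidate directions, and 1 for
    long bad paths.\<close>
  define C where "C = 2 * real ?d + z"
  have z1: "z \<ge> 1" by (simp add: z_def)
  have pos: "\<delta>' > 0" "\<eta> > 0" using \<delta> z1 by (auto simp: \<delta>'_def \<eta>_def)
  have Cpos: "C \<ge> 0" using z1 by (simp add: C_def)
  have mb: "0 \<le> mean_bound" using K_pos by (simp add: mean_bound_def)
  obtain m where m: "1 \<le> m" "\<And>u. u \<in> Z \<Longrightarrow> limit_time (int m *s u) \<le> real m * (time_constant u + \<eta>)"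
    using time_constant_approx_finite[OF pos(2) finZ] by blast
  have "\<exists>M'. \<forall>w\<in>Z. l1 (int m *s w) \<le> M' \<and> (\<forall>r. mean_time M' r (int m *s w) \<le> real m * (time_constant w + 2 * \<eta>))"
    using finZ m(2)
  proof (induction Z)
    case (insert w Z)
    then obtain M1 where M1: "\<forall>w\<in>Z. l1 (int m *s w) \<le> M1 \<and> (\<forall>r. mean_time M1 r (int m *s w) \<le> real m * (time_constant w + 2 * \<eta>))"
      by (metis insert_iff)
    have "0 < real m * \<eta>" using m(1) pos(2) by simp
    then obtain M2 where M2: "l1 (int m *s w) \<le> M2" "\<And>r. mean_time M2 r (int m *s w) \<le> limit_time (int m *s w) + real m * \<eta>"
      using limit_time_approx by blast
    have M2': "mean_time M2 r (int m *s w) \<le> real m * (time_constant w + 2 * \<eta>)" for r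
      using M2(2)[of r] insert.prems[of w] by (simp add: algebra_simps)
    have "l1 (int m *s v) \<le> max M1 M2 \<and> (\<forall>r. mean_time (max M1 M2) r (int m *s v) \<le> real m * (time_constant v + 2 * \<eta>))"
      if v: "v \<in> insert w Z" for v
    proof -
      have "(\<exists>M'\<in>{M1, M2}. l1 (int m *s v) \<le> M' \<and> (\<forall>r. mean_time M' r (int m *s v) \<le> real m * (time_constant v + 2 * \<eta>)))"
        using v M1 M2(1) M2' by blast
      then obtain M' where M': "M' \<in> {M1, M2}" "l1 (int m *s v) \<le> M'" "\<And>r. mean_time M' r (int m *s v) \<le> real m * (time_constant v + 2 * \<eta>)"
        by blast
      have le: "M' \<le> max M1 M2" using M'(1) by auto
      have "mean_time (max M1 M2) r (int m *s v) \<le> real m * (time_constant v + 2 * \<eta>)" for r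
        using mean_time_antimono[OF M'(2) le, of r] M'(3)[of r] by linarith
      then show ?thesis using M'(2) le by auto
    qed
    then show ?case by blast
  qed auto
  then obtain M' where M': "\<And>w. w \<in> Z \<Longrightarrow> l1 (int m *s w) \<le> M'"
    "\<And>w r. w \<in> Z \<Longrightarrow> mean_time M' r (int m *s w) \<le> real m * (time_constant w + 2 * \<eta>)" by blast
  \<comment> \<open>\<open>n\<close> divided by \<open>?d * m\<close>, rounded up; the scale chosen
    below is a multiple of \<open>?d * m\<close>, where the rounding is exact.\<close>
  define kk where "kk n = (n + ?d * m - 1) div (?d * m)" for n
  have dm: "1 \<le> ?d * m" using m(1) d1 by (simp add: Suc_leI)
  have kk: "n \<le> ?d * m * kk n" for n
  proof -
    have "n + ?d * m - 1 < ?d * m * kk n + ?d * m"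
      unfolding kk_def using dm by (metis div_mult_mod_eq mod_less_divisor mult.commute nat_add_left_cancel_less less_le_trans zero_less_one)
    then show ?thesis using dm by linarith
  qed
  have kk_eq: "kk (?d * m * k) = k" for k
  proof -
    have "(?d * m * k + (?d * m - 1)) div (?d * m) = k" using dm by (subst div_mult_self4) auto
    then show ?thesis using dm unfolding kk_def by (simp add: add_diff_assoc del: div_mult_self4)
  qed
  \<comment> \<open>The factor 0 confines the starting points to the origin: the chains of blocks
    towards the candidates all start there.\<close>
  let ?ev = "\<lambda>n w. {\<omega> \<in> space M. \<exists>c\<in>lball 0 (0 * n). real (kk n) * (real m * (time_constant w + 2 * \<eta>) + real m * \<eta>) \<le>
      (\<Sum>j<kk n. ptime (lball (c + int j *s (int m *s w)) M') (W (rad n) \<omega>) (c + int j *s (int m *s w)) (c + int (Suc j) *s (int m *s w)))}"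
  have e1: "eventually (\<lambda>n. \<exists>E\<in>events. prob E \<le> 2 * ?d / real n ^ 2 \<and>
    (\<forall>\<omega>\<in>space M - E. \<forall>s v. lball s n \<subseteq> lball 0 ((A + 2) * n) \<longrightarrow> l1 v \<le> n \<longrightarrow>
      ptime (lball s (n + 1)) (W (rad n) \<omega>) s (s + v) \<le> ?d * (real n * (mean_bound + 1) + real 1 * detour_bound TYPE('d) K (rad n)))) sequentially"
  proof (rule reach_likely)
    fix r i and \<sigma> :: int assume "\<sigma> = 1 \<or> \<sigma> = -1"
    then have "l1 (axis i (\<sigma> * int 1) :: int ^ 'd) = 1" by (auto simp: l1_axis)
    then show "mean_time 1 r (axis i (\<sigma> * int 1)) \<le> mean_bound"
      using mean_time_le[of "axis i (\<sigma> * int 1)" 1 r] by simp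
  qed auto
  have e2: "eventually (\<lambda>n. \<forall>w\<in>Z. prob (?ev n w) \<le> 1 / real n ^ 2) sequentially"
  proof (rule eventually_ball_finite[OF finZ], rule ballI)
    fix w assume w: "w \<in> Z"
    have "1 \<le> (A - 1) * ?d" using A d1 by (simp add: Suc_leI)
    moreover have "(A - 1) * ?d \<le> l1 w" using w by (simp add: Z_def)
    ultimately have "1 \<le> l1 w" by (rule le_trans)
    then have "1 \<le> l1 (int m *s w)" using m(1) by (simp add: l1_scale Suc_leI)
    then have ne: "int m *s w \<noteq> 0" by (metis l1_zero not_one_le_zero)
    have "0 < real m * \<eta>" using m(1) pos(2) by simp
    then show "eventually (\<lambda>n. prob (?ev n w) \<le> 1 / real n ^ 2) sequentially"
      using slow_blocks_unlikely[OF ne M'(1)[OF w] M'(2)[OF w] _ dm kk, of "real m * \<eta>" 0] by blast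
  qed
  have e3: "eventually (\<lambda>n. \<exists>E\<in>events. prob E \<le> 1 / real n ^ 2 \<and>
    (\<forall>\<omega>\<in>space M - E. \<forall>v\<in>lball 0 ((A + 4) * n). no_long_path (bad \<omega>) (rad n) v)) sequentially"
    by (rule short_clusters_likely)
  have e4: "eventually (\<lambda>n. detour_bound TYPE('d) K (rad n) \<le> real n) sequentially"
    using K_pos by (intro detour_bound_rad_le) simp
  have e5: "eventually (\<lambda>n. C / real n ^ 2 \<le> \<delta> / 2) sequentially" using \<delta> by real_asymp
  have e6: "eventually (\<lambda>n. real ((A + 1) * ?d) * (detour_bound TYPE('d) K (rad n) * (C / real n ^ 2) + 8 * ?d * K * (1 / 2) ^ rad n) < 5 * \<delta>' / 8) sequentially"
    using K_pos pos Cpos by (intro exceptional_error_small) auto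
  have e7: "eventually (\<lambda>n. M' + 1 \<le> n) sequentially" by (rule eventually_ge_at_top)
  obtain n0 where n0: "\<forall>n\<ge>n0. (\<exists>E\<in>events. prob E \<le> 2 * ?d / real n ^ 2 \<and>
    (\<forall>\<omega>\<in>space M - E. \<forall>s v. lball s n \<subseteq> lball 0 ((A + 2) * n) \<longrightarrow> l1 v \<le> n \<longrightarrow>
      ptime (lball s (n + 1)) (W (rad n) \<omega>) s (s + v) \<le> ?d * (real n * (mean_bound + 1) + real 1 * detour_bound TYPE('d) K (rad n)))) \<and>
    (\<forall>w\<in>Z. prob (?ev n w) \<le> 1 / real n ^ 2) \<and>
    (\<exists>E\<in>events. prob E \<le> 1 / real n ^ 2 \<and>
    (\<forall>\<omega>\<in>space M - E. \<forall>v\<in>lball 0 ((A + 4) * n). no_long_path (bad \<omega>) (rad n) v)) \<and>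
    detour_bound TYPE('d) K (rad n) \<le> real n \<and> C / real n ^ 2 \<le> \<delta> / 2 \<and>
    real ((A + 1) * ?d) * (detour_bound TYPE('d) K (rad n) * (C / real n ^ 2) + 8 * ?d * K * (1 / 2) ^ rad n) < 5 * \<delta>' / 8 \<and> M' + 1 \<le> n"
    using eventually_conj[OF e1 eventually_conj[OF e2 eventually_conj[OF e3 eventually_conj[OF e4 eventually_conj[OF e5 eventually_conj[OF e6 e7]]]]]]
    unfolding eventually_sequentially by (elim exE)
  define k where "k = Suc n0"
  \<comment> \<open>As \<open>h\<close> is a multiple of \<open>m\<close>, the point
    \<open>int h *s w\<close> is reached from 0 by exactly \<open>k\<close> steps
    \<open>int m *s w\<close>.\<close>
  define h where "h = m * k"
  define n where "n = ?d * h"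
  have n_eq: "n = ?d * m * k" by (simp add: n_def h_def)
  have "n0 \<le> k" by (simp add: k_def)
  also have "k \<le> n" using mult_le_mono1[OF dm, of k] by (simp add: n_eq)
  finally have nn0: "n0 \<le> n" .
  have h1: "1 \<le> h" using m(1) by (simp add: h_def k_def Suc_leI)
  have kkn: "kk n = k" unfolding n_eq by (rule kk_eq)
  note big_n = n0[rule_format, OF nn0]
  let ?r = "rad n" and ?S = "lball (0 :: int ^ 'd) ((A + 4) * n)"
  from big_n obtain E1 where E1: "E1 \<in> events" "prob E1 \<le> 2 * ?d / real n ^ 2"
    "\<And>\<omega> s v. \<omega> \<in> space M - E1 \<Longrightarrow> lball s n \<subseteq> lball 0 ((A + 2) * n) \<Longrightarrow> l1 v \<le> n \<Longrightarrow>
      ptime (lball s (n + 1)) (W ?r \<omega>) s (s + v) \<le> ?d * (real n * (mean_bound + 1) + real 1 * detour_bound TYPE('d) K ?r)" by blast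
  from big_n obtain E3 where E3: "E3 \<in> events" "prob E3 \<le> 1 / real n ^ 2"
    "\<And>\<omega> v. \<omega> \<in> space M - E3 \<Longrightarrow> v \<in> ?S \<Longrightarrow> no_long_path (bad \<omega>) ?r v" by blast
  have E2: "prob (?ev n w) \<le> 1 / real n ^ 2" if "w \<in> Z" for w using big_n that by blast
  have Wn: "detour_bound TYPE('d) K ?r \<le> real n" and C\<delta>: "C / real n ^ 2 \<le> \<delta> / 2" and M'n: "M' + 1 \<le> n"
    and err: "real ((A + 1) * ?d) * (detour_bound TYPE('d) K ?r * (C / real n ^ 2) + 8 * ?d * K * (1 / 2) ^ ?r) < 5 * \<delta>' / 8"
    using big_n by blast+
  define E2' where "E2' = (\<Union>w\<in>Z. ?ev n w)"
  have ev: "?ev n w \<in> events" for w by (rule blocks_event)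
  have E2'ev: "E2' \<in> events" unfolding E2'_def using finZ ev by (intro sets.finite_UN) auto
  have "prob E2' \<le> (\<Sum>w\<in>Z. prob (?ev n w))"
    unfolding E2'_def using finZ ev by (intro finite_measure_subadditive_finite) auto
  also have "\<dots> \<le> (\<Sum>w\<in>Z. 1 / real n ^ 2)" by (intro sum_mono E2)
  finally have pE2': "prob E2' \<le> real (card Z) / real n ^ 2" by simp
  define E where "E = E1 \<union> E2' \<union> E3"
  have E: "E \<in> events" using E1(1) E2'ev E3(1) by (simp add: E_def)
  have "prob E \<le> prob E1 + prob E2' + prob E3"
    unfolding E_def using E1(1) E2'ev E3(1) measure_Un_le[of "E1 \<union> E2'" M E3] measure_Un_le[of E1 M E2'] by simp
  also have "\<dots> \<le> 2 * ?d / real n ^ 2 + real (card Z) / real n ^ 2 + 1 / real n ^ 2"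
    using E1(2) E3(2) pE2' by simp
  also have "\<dots> = C / real n ^ 2" by (simp add: C_def z_def add_divide_distrib)
  finally have pE: "prob E \<le> C / real n ^ 2" .
  \<comment> \<open>A shortcut in direction \<open>w\<close>: by assumption the time constant of
    \<open>w\<close> lies well above \<open>short_const\<close>.\<close>
  define Aw where "Aw w = {\<omega> \<in> space M. ptime ?S (W ?r \<omega>) 0 (int h *s w) \<le> short_const * h} - E" for w
  have Aw: "Aw w \<in> events" for w
    unfolding Aw_def using E measurable_T[of ?S ?r 0 "int h *s w"] by measurable
  let ?X = "{\<omega> \<in> space M. crossing (?d * h) (A * ?d * h) {e. \<tau> e \<omega> \<le> 0} 0}"
  have X: "?X \<in> events"
  proof -
    have b: "Measurable.pred (borel :: real measure) (\<lambda>x. x \<le> 0)" by measurable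
    have "Measurable.pred M (\<lambda>\<omega>. crossing (?d * h) (A * ?d * h) {e. \<tau> e \<omega> \<le> 0} 0)"
      by (rule measurable_field[OF crossing_pred[where b = "\<lambda>x. x \<le> 0", OF b refl]]) auto
    then show ?thesis by (simp add: pred_def)
  qed
  have cover: "?X - E \<subseteq> (\<Union>w\<in>Z. Aw w)"
  proof
    fix \<omega> assume w: "\<omega> \<in> ?X - E"
    have "\<exists>w. (A - 1) * ?d \<le> l1 w \<and> l1 w \<le> (A + 1) * ?d \<and>
      ptime ?S (W ?r \<omega>) 0 (int h *s w) \<le> 2 * (?d * (real n * (mean_bound + 1) + real 1 * detour_bound TYPE('d) K ?r))"
    proof (rule crossing_shortcut[OF _ h1 _ n_def])
      show "crossing n (A * n) {e. \<tau> e \<omega> \<le> 0} 0" using w by (simp add: n_def mult.assoc)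
      show "ptime (lball s (n + 1)) (W ?r \<omega>) s (s + v) \<le> ?d * (real n * (mean_bound + 1) + real 1 * detour_bound TYPE('d) K ?r)"
        if "lball s n \<subseteq> lball 0 ((A + 2) * n)" "l1 v \<le> n" for s v
        by (rule E1(3)) (use w that in \<open>auto simp: E_def\<close>)
    qed (use w A in auto)
    then obtain w' where w': "w' \<in> Z" "ptime ?S (W ?r \<omega>) 0 (int h *s w') \<le> 2 * (?d * (real n * (mean_bound + 1) + real 1 * detour_bound TYPE('d) K ?r))"
      by (auto simp: Z_def)
    note w'(2)
    also have "2 * (?d * (real n * (mean_bound + 1) + real 1 * detour_bound TYPE('d) K ?r)) \<le> 2 * (?d * (real n * (mean_bound + 1) + real n))"
      using Wn by (intro mult_left_mono) auto
    also have "\<dots> = short_const * h" by (simp add: short_const_def n_def algebra_simps)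
    finally show "\<omega> \<in> (\<Union>w\<in>Z. Aw w)" using w w'(1) by (auto simp: Aw_def)
  qed
  have "\<delta> \<le> prob ?X" by (rule cr[OF h1])
  also have "prob ?X \<le> prob (?X - E) + prob E"
  proof -
    have "prob ?X \<le> prob ((?X - E) \<union> E)" using X E by (intro finite_measure_mono) auto
    also have "\<dots> \<le> prob (?X - E) + prob E" using X E by (intro measure_Un_le) auto
    finally show ?thesis .
  qed
  also have "prob (?X - E) \<le> prob (\<Union>w\<in>Z. Aw w)"
    using cover Aw finZ by (intro finite_measure_mono sets.finite_UN) auto
  also have "\<dots> \<le> (\<Sum>w\<in>Z. prob (Aw w))" using finZ Aw by (intro finite_measure_subadditive_finite) auto
  finally have sum: "\<delta> / 2 \<le> (\<Sum>w\<in>Z. prob (Aw w))" using pE C\<delta> by linarith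
  have "\<exists>w\<in>Z. \<delta>' \<le> prob (Aw w)"
  proof (rule ccontr)
    assume "\<not> ?thesis"
    then have "(\<Sum>w\<in>Z. prob (Aw w)) \<le> (\<Sum>w\<in>Z. \<delta>')" by (intro sum_mono) (auto simp: not_le intro: less_imp_le)
    also have "\<dots> = (z - 1) * \<delta>'" by (simp add: z_def)
    also have "\<dots> < z * \<delta>'" using pos by (simp add: algebra_simps)
    also have "\<dots> = \<delta> / 2" using z1 by (simp add: \<delta>'_def)
    finally show False using sum by simp
  qed
  then obtain w where wZ: "w \<in> Z" and pw: "\<delta>' \<le> prob (Aw w)" by blast
  \<comment> \<open>The level that the chain of \<open>k\<close> blocks stays below off
    \<open>E\<close>. By the assumption on the time constant it exceeds the level of
    \<open>Aw w\<close> by at least \<open>h\<close>.\<close>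
  define Y where "Y = real h * (time_constant w + 3 * \<eta>)"
  have Y0: "0 \<le> Y" using time_constant_nonneg[of w] pos by (simp add: Y_def)
  have YC: "real h \<le> Y - short_const * h"
  proof -
    have "real h * 1 \<le> real h * (time_constant w + 3 * \<eta> - short_const)"
      using big[OF wZ] pos by (intro mult_left_mono) auto
    then show ?thesis by (simp add: Y_def algebra_simps)
  qed
  have hw: "l1 (int h *s w) \<le> (A + 1) * n"
  proof -
    have "h * l1 w \<le> h * ((A + 1) * ?d)" using wZ by (intro mult_le_mono2) (simp add: Z_def)
    then show ?thesis by (simp add: l1_scale n_def algebra_simps)
  qed
  have hwS: "l1 (int h *s w) \<le> (A + 4) * n" using hw by (simp add: algebra_simps)
  have hwS': "l1 (int h *s w - 0) \<le> (A + 4) * n" using hwS by simp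
  have Wpos: "0 < detour_bound TYPE('d) K ?r" by (rule detour_bound_pos[OF K_pos])
  let ?T = "\<lambda>r \<omega>. ptime ?S (W r \<omega>) 0 (int h *s w)"
  have chain: "?T ?r \<omega> \<le> Y" if \<omega>: "\<omega> \<in> space M - E" for \<omega>
  proof -
    let ?p = "\<lambda>j. 0 + int j *s (int m *s w)"
    have "walks ?S (?p 0) (?p k) \<noteq> {} \<and>
      ptime ?S (W ?r \<omega>) (?p 0) (?p k) \<le> (\<Sum>j<k. ptime (lball (?p j) M') (W ?r \<omega>) (?p j) (?p (Suc j)))"
    proof (rule chain_blocks[OF W_nonneg, of _ ?p])
      show "\<omega> \<in> space M" using \<omega> by simp
      show "?p 0 \<in> ?S" by simp
      fix j assume j: "j < k"
      have "j * (m * l1 w) \<le> k * (m * ((A + 1) * ?d))"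
        using j wZ by (intro mult_le_mono) (auto simp: Z_def)
      also have "\<dots> = (A + 1) * n" by (simp add: n_eq algebra_simps)
      finally have "l1 (?p j - 0) + M' \<le> (A + 4) * n" using M'n by (simp add: l1_scale nat_mult_distrib algebra_simps)
      then show "lball (?p j) M' \<subseteq> ?S" by (rule lball_subset)
      have "?p (Suc j) - ?p j = int m *s w" by (simp add: vec_eq_iff algebra_simps)
      then show "l1 (?p (Suc j) - ?p j) \<le> M'" using M'(1)[OF wZ] by simp
    qed
    moreover have "?p 0 = 0" "?p k = int h *s w" by (simp_all add: vec_eq_iff h_def)
    moreover have "(\<Sum>j<k. ptime (lball (?p j) M') (W ?r \<omega>) (?p j) (?p (Suc j))) \<le> Y"
    proof -
      have "\<omega> \<notin> ?ev n w" using \<omega> wZ by (auto simp: E_def E2'_def)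
      moreover have "(0 :: int ^ 'd) \<in> lball 0 (0 * n)" by simp
      ultimately have "\<not> real (kk n) * (real m * (time_constant w + 2 * \<eta>) + real m * \<eta>) \<le>
        (\<Sum>j<kk n. ptime (lball (?p j) M') (W ?r \<omega>) (?p j) (?p (Suc j)))" using \<omega> by blast
      moreover have "real k * (real m * (time_constant w + 2 * \<eta>) + real m * \<eta>) = Y"
        by (simp add: Y_def h_def algebra_simps)
      ultimately show ?thesis unfolding kkn by linarith
    qed
    ultimately show ?thesis by simp
  qed
  have ne: "walks ?S 0 (int h *s w) \<noteq> {}" by (rule walks_lball_nonempty[OF hwS'])
  \<comment> \<open>The mean is at most \<open>Y\<close>, less a gain of at least \<open>h\<close>
    on an event of probability at least \<delta>', plus the contribution of \<open>E\<close>, which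
    the straight walk controls. The result falls below \<open>h * time_constant w\<close>, a lower
    bound for \<open>limit_time (int h *s w)\<close>.\<close>
  have "mean_time ((A + 4) * n) r (int h *s w) \<le> Y - real h * \<delta>' +
      real h * (real ((A + 1) * ?d) * (detour_bound TYPE('d) K ?r * (C / real n ^ 2) + 8 * ?d * K * (1 / 2) ^ ?r))" for r
  proof -
    have stab: "?T r \<omega> \<le> ?T ?r \<omega>" if "\<omega> \<in> space M - E" for \<omega>
      by (rule ptime_stable[OF _ E3(3) ne]) (use that in \<open>auto simp: E_def\<close>)
    have iT: "integrable M (?T r)" by (rule integrable_T[OF hwS'])
    have iE: "integrable M (\<lambda>\<omega>. ?T r \<omega> * indicator E \<omega>)" by (rule integrable_real_mult_indicator[OF E iT])
    have iA: "integrable M (\<lambda>\<omega>. (Y - short_const * h) * indicator (Aw w) \<omega>)"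
      using Aw[of w] by (intro integrable_mult_right integrable_real_indicator) (auto simp: emeasure_eq_measure)
    have iY: "integrable M (\<lambda>\<omega>. Y - (Y - short_const * h) * indicator (Aw w) \<omega>)"
      by (rule Bochner_Integration.integrable_diff[OF _ iA]) simp
    have "mean_time ((A + 4) * n) r (int h *s w) \<le>
        expectation (\<lambda>\<omega>. (Y - (Y - short_const * h) * indicator (Aw w) \<omega>) + ?T r \<omega> * indicator E \<omega>)"
      unfolding mean_time_def
    proof (rule integral_mono[OF iT Bochner_Integration.integrable_add[OF iY iE]])
      fix \<omega> assume \<omega>: "\<omega> \<in> space M"
      show "?T r \<omega> \<le> (Y - (Y - short_const * h) * indicator (Aw w) \<omega>) + ?T r \<omega> * indicator E \<omega>"
      proof (cases "\<omega> \<in> E")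
        case True
        then show ?thesis using Y0 by (simp add: Aw_def)
      next
        case False
        then have "?T r \<omega> \<le> Y" "\<omega> \<in> Aw w \<Longrightarrow> ?T r \<omega> \<le> short_const * h"
          using stab[of \<omega>] chain[of \<omega>] \<omega> by (auto simp: Aw_def)
        then show ?thesis using False by (cases "\<omega> \<in> Aw w") auto
      qed
    qed
    also have "\<dots> = Y - (Y - short_const * h) * prob (Aw w) + expectation (\<lambda>\<omega>. ?T r \<omega> * indicator E \<omega>)"
      unfolding Bochner_Integration.integral_add[OF iY iE]
      using iA Aw[of w] by (subst Bochner_Integration.integral_diff) (auto simp: prob_space)
    also have "\<dots> \<le> Y - real h * \<delta>' + expectation (\<lambda>\<omega>. ?T r \<omega> * indicator E \<omega>)"
      using mult_mono[OF YC pw] YC pos by simp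
    also have "expectation (\<lambda>\<omega>. ?T r \<omega> * indicator E \<omega>) \<le>
        real (l1 (int h *s w)) * (detour_bound TYPE('d) K ?r * prob E + 8 * ?d * K * (1 / 2) ^ ?r)"
      by (rule expectation_T_on_event[OF E hwS])
    also have "\<dots> \<le> real ((A + 1) * n) * (detour_bound TYPE('d) K ?r * (C / real n ^ 2) + 8 * ?d * K * (1 / 2) ^ ?r)"
    proof (rule mult_mono)
      show "detour_bound TYPE('d) K ?r * prob E + 8 * ?d * K * (1 / 2) ^ ?r \<le> detour_bound TYPE('d) K ?r * (C / real n ^ 2) + 8 * ?d * K * (1 / 2) ^ ?r"
        using pE Wpos by (intro add_right_mono mult_left_mono) auto
      show "0 \<le> detour_bound TYPE('d) K ?r * prob E + 8 * ?d * K * (1 / 2) ^ ?r"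
        using Wpos K_pos by (intro add_nonneg_nonneg mult_nonneg_nonneg) auto
    qed (use hw in \<open>auto simp del: of_nat_mult\<close>)
    also have "\<dots> = real h * (real ((A + 1) * ?d) * (detour_bound TYPE('d) K ?r * (C / real n ^ 2) + 8 * ?d * K * (1 / 2) ^ ?r))"
      by (simp add: n_def algebra_simps)
    finally show ?thesis by simp
  qed
  then have "limit_time (int h *s w) \<le> Y - real h * \<delta>' +
      real h * (real ((A + 1) * ?d) * (detour_bound TYPE('d) K ?r * (C / real n ^ 2) + 8 * ?d * K * (1 / 2) ^ ?r))"
    by (rule limit_time_le[OF hwS])
  also have "\<dots> < Y - real h * \<delta>' + real h * (5 * \<delta>' / 8)"
    by (intro add_strict_left_mono mult_strict_left_mono err) (use h1 in simp)
  finally have "real h * time_constant w < Y - real h * \<delta>' + real h * (5 * \<delta>' / 8)"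
    using time_constant_le[OF h1, of w] by linarith
  also have "\<dots> = real h * time_constant w" by (simp add: Y_def \<eta>_def algebra_simps)
  finally show False by simp
qed

end

section \<open>Vanishing of the time constant on the axes, and its consequences\<close>

context fpp_field
begin

lemma limit_time_axis_abs: "limit_time (axis i c) = limit_time (axis i \<bar>c\<bar>)"
proof -
  have "lattice_iso0 (\<lambda>x :: int ^ 'd. \<chi> k. (if c \<ge> 0 then 1 else -1) * x $ k)"
    by (rule lattice_iso0_reflect) auto
  from limit_time_iso[OF this, of "axis i c"]
  have "limit_time (\<chi> k. (if c \<ge> 0 then 1 else -1) * axis i c $ k) = limit_time (axis i c)" .
  moreover have "(\<chi> k. (if c \<ge> 0 then 1 else -1) * axis i c $ k) = axis i \<bar>c\<bar>"
    by (auto simp: vec_eq_iff axis_def)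
  ultimately show ?thesis by simp
qed

lemma swap_axis:
  fixes i j :: 'd
  shows "\<exists>\<phi>. lattice_iso0 \<phi> \<and> (\<forall>c. \<phi> (axis i c) = (axis j c :: int ^ 'd))"
proof -
  let ?\<pi> = "\<lambda>k. if k = i then j else if k = j then i else k"
  have "?\<pi> \<circ> ?\<pi> = id" by auto
  then have "bij ?\<pi>" using o_bij by blast
  then have "lattice_iso0 (\<lambda>x :: int ^ 'd. \<chi> k. x $ ?\<pi> k)" by (rule lattice_iso0_permute)
  moreover have "(\<chi> k. axis i c $ ?\<pi> k) = (axis j c :: int ^ 'd)" for c
    by (auto simp: vec_eq_iff axis_def)
  ultimately show ?thesis by (intro exI[of _ "\<lambda>x. \<chi> k. x $ ?\<pi> k"]) auto
qed

lemma scale_axis: "int n *s axis i 1 = (axis i (int n) :: int ^ 'd)"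
  by (simp add: vec_eq_iff axis_def)

lemma time_constant_axis_eq: "time_constant (axis i 1) = time_constant (axis j 1)"
proof -
  obtain \<phi> :: "int ^ 'd \<Rightarrow> int ^ 'd" where \<phi>: "lattice_iso0 \<phi>" "\<And>c. \<phi> (axis i c) = axis j c"
    using swap_axis[of i j] by blast
  have "limit_time (axis j c) = limit_time (axis i c)" for c
    using limit_time_iso[OF \<phi>(1), of "axis i c"] \<phi>(2) by simp
  then show ?thesis by (simp add: time_constant_def scale_axis)
qed

text \<open>The average of \<open>u\<close> and its reflection in the \<open>i\<close>-th axis lies on that axis.\<close>

lemma time_constant_component: "of_int \<bar>w $ i\<bar> * time_constant (axis i 1) \<le> time_constant w"
proof (rule time_constant_greatest)
  fix n :: nat assume n: "1 \<le> n"
  let ?s = "\<lambda>k. if k = i then 1 else -1 :: int"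
  let ?u = "int n *s w"
  define q where "q = nat \<bar>w $ i\<bar>"
  have iso: "lattice_iso0 (\<lambda>x :: int ^ 'd. \<chi> k. ?s k * x $ k)" by (rule lattice_iso0_reflect) auto
  have "axis i (2 * (int n * w $ i)) = ?u + (\<chi> k. ?s k * ?u $ k)"
    by (simp add: vec_eq_iff axis_def)
  then have "limit_time (axis i (2 * (int n * w $ i))) \<le> limit_time ?u + limit_time (\<chi> k. ?s k * ?u $ k)"
    using limit_time_subadd[of ?u "\<chi> k. ?s k * ?u $ k"] by simp
  also have "limit_time (\<chi> k. ?s k * ?u $ k) = limit_time ?u" by (rule limit_time_iso[OF iso])
  finally have le: "limit_time (axis i (2 * (int n * w $ i))) \<le> 2 * limit_time ?u" by simp
  have "limit_time (axis i (2 * (int n * w $ i))) = limit_time (int (2 * n * q) *s axis i 1)"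
    unfolding scale_axis by (subst limit_time_axis_abs) (simp add: abs_mult q_def mult.assoc)
  moreover have "real (2 * n * q) * time_constant (axis i 1) \<le> limit_time (int (2 * n * q) *s axis i 1)"
  proof (cases "q = 0")
    case True
    then show ?thesis using limit_time_nonneg by simp
  next
    case False
    then show ?thesis using n by (intro time_constant_le) (simp add: Suc_leI)
  qed
  ultimately have "real (2 * n * q) * time_constant (axis i 1) \<le> 2 * limit_time ?u" using le by simp
  moreover have "real_of_int \<bar>w $ i\<bar> = real q" by (simp add: q_def)
  ultimately show "real n * (of_int \<bar>w $ i\<bar> * time_constant (axis i 1)) \<le> limit_time ?u"
    by (simp add: mult.assoc)
qed

text \<open>A vector of norm at least \<open>B * CARD('d)\<close> has a coordinate of size at least
  \<open>B\<close>, so \<open>B\<close> times the axis constant stays below a bound that does not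
  depend on \<open>B\<close>.\<close>

lemma time_constant_zero:
  assumes cr: "\<And>A. 1 \<le> A \<Longrightarrow> 0 < \<delta> A"
    "\<And>A h. 1 \<le> A \<Longrightarrow> 1 \<le> h \<Longrightarrow> \<delta> A \<le> prob {\<omega> \<in> space M. crossing (CARD('d) * h) (A * CARD('d) * h) {e. \<tau> e \<omega> \<le> 0} 0}"
  shows "time_constant (axis i 1) = 0"
proof -
  let ?c = "time_constant (axis i 1)"
  have bound: "real B * ?c \<le> short_const + 1" if B: "1 \<le> B" for B :: nat
  proof -
    have A: "2 \<le> B + 1" "1 \<le> B + 1" using B by auto
    obtain w where w: "(B + 1 - 1) * CARD('d) \<le> l1 w" "time_constant w \<le> short_const + 1"
      using bounded_time_constant[OF A(1) cr(1)[OF A(2)] cr(2)[OF A(2)]] by blast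
    have "\<exists>k. B \<le> nat \<bar>w $ k\<bar>"
    proof (rule ccontr)
      assume "\<not> ?thesis"
      then have "l1 w < (\<Sum>k\<in>(UNIV :: 'd set). B)" unfolding l1_def by (intro sum_strict_mono) (auto simp: not_le)
      then show False using w(1) by (simp add: mult.commute)
    qed
    then obtain k where k: "B \<le> nat \<bar>w $ k\<bar>" ..
    have "real B * ?c = real B * time_constant (axis k 1)" using time_constant_axis_eq[of i k] by simp
    also have "\<dots> \<le> of_int \<bar>w $ k\<bar> * time_constant (axis k 1)"
      using k time_constant_nonneg by (intro mult_right_mono) linarith+
    also have "\<dots> \<le> time_constant w" by (rule time_constant_component)
    finally show ?thesis using w(2) by simp
  qed
  have "?c \<le> 0"
  proof (rule ccontr)
    assume c: "\<not> ?c \<le> 0"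
    obtain B :: nat where "(short_const + 1) / ?c < real B" using reals_Archimedean2 by blast
    then have "short_const + 1 < real (Suc B) * ?c" using c by (simp add: field_simps)
    then show False using bound[of "Suc B"] by simp
  qed
  then show ?thesis using time_constant_nonneg[of "axis i 1"] by simp
qed

text \<open>One axis is treated, and swaps and reflections carry the estimate to all signed
  directions with the same \<open>m\<close> and \<open>m1\<close>.\<close>

lemma fast_blocks:
  fixes \<eta> :: real
  assumes zero: "\<And>i. time_constant (axis i 1) = 0" and \<eta>: "\<eta> > 0"
  obtains m m1 where "1 \<le> m" "m \<le> m1"
    "\<And>r i \<sigma>. \<sigma> = 1 \<or> \<sigma> = -1 \<Longrightarrow> mean_time m1 r (axis i (\<sigma> * int m)) \<le> \<eta> * m"
proof -
  fix i0 :: 'd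
  have h: "\<eta> / 2 > 0" using \<eta> by simp
  obtain m where m: "1 \<le> m" "limit_time (int m *s axis i0 1) \<le> real m * (time_constant (axis i0 1) + \<eta> / 2)"
    using time_constant_approx[OF h] by blast
  obtain m1 where m1: "l1 (int m *s axis i0 1 :: int ^ 'd) \<le> m1"
    "\<And>r. mean_time m1 r (int m *s axis i0 1) \<le> limit_time (int m *s axis i0 1) + \<eta> / 2"
    using limit_time_approx[OF h] by blast
  have "\<eta> / 2 \<le> real m * (\<eta> / 2)" using m(1) \<eta> by simp
  then have base: "mean_time m1 r (axis i0 (int m)) \<le> \<eta> * m" for r
    using m1(2)[of r] m(2) zero[of i0] unfolding scale_axis by (simp add: field_simps)
  have "mean_time m1 r (axis i (\<sigma> * int m)) \<le> \<eta> * m" if \<sigma>: "\<sigma> = 1 \<or> \<sigma> = -1" for r i and \<sigma> :: int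
  proof -
    obtain \<phi> :: "int ^ 'd \<Rightarrow> int ^ 'd" where \<phi>: "lattice_iso0 \<phi>" "\<And>c. \<phi> (axis i0 c) = axis i c"
      using swap_axis[of i0 i] by blast
    have iso: "lattice_iso0 (\<lambda>x :: int ^ 'd. \<chi> k. \<sigma> * x $ k)" by (rule lattice_iso0_reflect) (use \<sigma> in auto)
    have "(\<chi> k. \<sigma> * axis i (int m) $ k) = axis i (\<sigma> * int m)" by (simp add: vec_eq_iff axis_def)
    then have "mean_time m1 r (axis i (\<sigma> * int m)) = mean_time m1 r (axis i (int m))"
      using mean_time_iso[OF iso, of m1 r "axis i (int m)"] by simp
    also have "\<dots> = mean_time m1 r (axis i0 (int m))"
      using mean_time_iso[OF \<phi>(1), of m1 r "axis i0 (int m)"] \<phi>(2) by simp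
    finally show ?thesis using base by simp
  qed
  moreover have "m \<le> m1" using m1(1) by (simp add: scale_axis l1_axis)
  ultimately show ?thesis using that m(1) by blast
qed

text \<open>One exceptional event of probability of order 1 / n^2 covers all endpoints with
  \<open>l1 x = n\<close> at once. The radius \<open>4 * n\<close> eventually exceeds both
  \<open>n + m1\<close>, needed by \<open>reach_likely\<close>, and the radius that
  \<open>heavy_edges_bound\<close> asks for.\<close>

lemma good_scales:
  fixes \<eta> :: real
  assumes zero: "\<And>i. time_constant (axis i 1) = 0" and \<eta>: "\<eta> > 0"
  shows "\<exists>m\<ge>1. AE \<omega> in M. eventually (\<lambda>n.
    (\<forall>v\<in>lball 0 (4 * n). no_long_path (bad \<omega>) (rad n) v) \<and>
    (\<forall>x. l1 x = n \<longrightarrow> ptime (lball 0 (4 * n)) (W (rad n) \<omega>) 0 x \<le>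
      CARD('d) * (real (n div m + 1) * (2 * \<eta> * m) + m * detour_bound TYPE('d) K (rad n)))) sequentially"
proof -
  obtain m m1 where m: "1 \<le> m" "m \<le> m1"
    "\<And>r i \<sigma>. \<sigma> = 1 \<or> \<sigma> = -1 \<Longrightarrow> mean_time m1 r (axis i (\<sigma> * int m)) \<le> \<eta> * m"
    using fast_blocks[OF zero \<eta>] by blast
  have \<eta>m: "0 < \<eta> * m" using \<eta> m(1) by simp
  have kk: "n \<le> m * (n div m + 1)" for n
  proof -
    have "n = m * (n div m) + n mod m" "n mod m < m" using m(1) by simp_all
    moreover have "m * (n div m + 1) = m * (n div m) + m" by simp
    ultimately show ?thesis by linarith
  qed
  let ?P = "\<lambda>n \<omega>. (\<forall>v\<in>lball 0 (4 * n). no_long_path (bad \<omega>) (rad n) v) \<and>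
    (\<forall>x. l1 x = n \<longrightarrow> ptime (lball 0 (4 * n)) (W (rad n) \<omega>) 0 x \<le>
      CARD('d) * (real (n div m + 1) * (2 * \<eta> * m) + m * detour_bound TYPE('d) K (rad n)))"
  let ?C = "2 * real CARD('d) + 1"
  have "eventually (\<lambda>n. \<exists>E\<in>events. prob E \<le> 2 * CARD('d) / real n ^ 2 \<and>
    (\<forall>\<omega>\<in>space M - E. \<forall>s z. lball s n \<subseteq> lball 0 (1 * n) \<longrightarrow> l1 z \<le> n \<longrightarrow>
      ptime (lball s (n + m1)) (W (rad n) \<omega>) s (s + z) \<le>
        CARD('d) * (real (n div m + 1) * (\<eta> * m + \<eta> * m) + m * detour_bound TYPE('d) K (rad n)))) sequentially"
    by (rule reach_likely[OF m(1,2) _ \<eta>m kk]) (rule m(3))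
  then have "eventually (\<lambda>n. \<exists>E\<in>events. prob E \<le> ?C / real n ^ 2 \<and> (\<forall>\<omega>\<in>space M - E. ?P n \<omega>)) sequentially"
    using short_clusters_likely[of 4] eventually_ge_at_top[of m1]
  proof eventually_elim
    case (elim n)
    obtain E1 where E1: "E1 \<in> events" "prob E1 \<le> 2 * CARD('d) / real n ^ 2"
      "\<And>\<omega> s z. \<omega> \<in> space M - E1 \<Longrightarrow> lball s n \<subseteq> lball 0 (1 * n) \<Longrightarrow> l1 z \<le> n \<Longrightarrow>
      ptime (lball s (n + m1)) (W (rad n) \<omega>) s (s + z) \<le> CARD('d) * (real (n div m + 1) * (\<eta> * m + \<eta> * m) + m * detour_bound TYPE('d) K (rad n))"
      using elim(1) by blast
    obtain E2 where E2: "E2 \<in> events" "prob E2 \<le> 1 / real n ^ 2"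
      "\<And>\<omega> v. \<omega> \<in> space M - E2 \<Longrightarrow> v \<in> lball 0 (4 * n) \<Longrightarrow> no_long_path (bad \<omega>) (rad n) v"
      using elim(2) by blast
    have "prob (E1 \<union> E2) \<le> prob E1 + prob E2" using E1(1) E2(1) by (rule measure_Un_le)
    also have "\<dots> \<le> 2 * CARD('d) / real n ^ 2 + 1 / real n ^ 2" using E1(2) E2(2) by (rule add_mono)
    also have "\<dots> = ?C / real n ^ 2" by (simp add: add_divide_distrib)
    finally have pE: "prob (E1 \<union> E2) \<le> ?C / real n ^ 2" .
    have "?P n \<omega>" if \<omega>: "\<omega> \<in> space M - (E1 \<union> E2)" for \<omega>
    proof (intro conjI ballI allI impI)
      fix v :: "int ^ 'd" assume "v \<in> lball 0 (4 * n)"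
      then show "no_long_path (bad \<omega>) (rad n) v" using E2(3) \<omega> by blast
    next
      fix x :: "int ^ 'd" assume x: "l1 x = n"
      have sub: "lball 0 (n + m1) \<subseteq> lball (0 :: int ^ 'd) (4 * n)" using elim(3) by (intro lball_mono) simp
      have "ptime (lball 0 (4 * n)) (W (rad n) \<omega>) 0 x \<le> ptime (lball 0 (n + m1)) (W (rad n) \<omega>) 0 x"
        using \<omega> x by (intro ptime_mono W_nonneg walks_lball_nonempty sub) auto
      also have "\<dots> \<le> CARD('d) * (real (n div m + 1) * (\<eta> * m + \<eta> * m) + m * detour_bound TYPE('d) K (rad n))"
        using E1(3)[of \<omega> 0 x] \<omega> x by simp
      also have "\<dots> = CARD('d) * (real (n div m + 1) * (2 * \<eta> * m) + m * detour_bound TYPE('d) K (rad n))" by simp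
      finally show "ptime (lball 0 (4 * n)) (W (rad n) \<omega>) 0 x \<le>
        CARD('d) * (real (n div m + 1) * (2 * \<eta> * m) + m * detour_bound TYPE('d) K (rad n))" .
    qed
    then show ?case using pE E1(1) E2(1) by (intro bexI[of _ "E1 \<union> E2"]) auto
  qed
  then obtain n0 where n0: "\<And>n. n0 \<le> n \<Longrightarrow> \<exists>E\<in>events. prob E \<le> ?C / real n ^ 2 \<and> (\<forall>\<omega>\<in>space M - E. ?P n \<omega>)"
    unfolding eventually_sequentially by blast
  \<comment> \<open>The Borel-Cantelli lemma wants a full sequence of events; below
    \<open>n0\<close> the empty event stands in.\<close>
  have "\<forall>n. \<exists>E. E \<in> events \<and> (n0 \<le> n \<longrightarrow> prob E \<le> ?C / real n ^ 2 \<and> (\<forall>\<omega>\<in>space M - E. ?P n \<omega>))"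
    using n0 sets.empty_sets by blast
  then obtain E where E: "\<And>n. E n \<in> events" "\<And>n. n0 \<le> n \<Longrightarrow> prob (E n) \<le> ?C / real n ^ 2"
    "\<And>n \<omega>. n0 \<le> n \<Longrightarrow> \<omega> \<in> space M - E n \<Longrightarrow> ?P n \<omega>"
    by (subst (asm) choice_iff) blast
  have "summable (\<lambda>n. ?C * inverse (real n ^ 2))"
    by (intro summable_mult inverse_power_summable) simp
  then have "summable (\<lambda>n. prob (E n))"
    by (rule summable_comparison_test'[where N = n0]) (use E(2) in \<open>simp add: divide_inverse\<close>)
  then have "AE \<omega> in M. eventually (\<lambda>n. \<omega> \<in> space M - E n) sequentially"
    by (intro borel_cantelli_AE1 E(1)) (auto simp: emeasure_eq_measure)
  then have "AE \<omega> in M. eventually (\<lambda>n. ?P n \<omega>) sequentially"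
  proof (rule AE_mp, intro AE_I2 impI)
    fix \<omega> assume "eventually (\<lambda>n. \<omega> \<in> space M - E n) sequentially"
    then show "eventually (\<lambda>n. ?P n \<omega>) sequentially" using eventually_ge_at_top[of n0]
      by eventually_elim (rule E(3))
  qed
  then show ?thesis using m(1) by blast
qed

text \<open>The three summands on the right come, in this order, from the ends of the geodesic,
  which have polylogarithmic length, from straight connections and incomplete blocks, and from the
  travel time through \<open>n div m\<close> blocks in each coordinate direction. The quantifier
  over \<epsilon> stands inside the almost sure statement, so a single null set serves all
  \<epsilon>.\<close>

lemma few_heavy_edges:
  fixes \<eta> :: real
  assumes zero: "\<And>i. time_constant (axis i 1) = 0" and \<eta>: "\<eta> > 0"
  shows "AE \<omega> in M. eventually (\<lambda>n. \<forall>x \<gamma>. \<forall>\<epsilon>::real. l1 x = n \<longrightarrow> \<gamma> \<in> geodesics (t \<omega>) 0 x \<longrightarrow> 0 \<le> \<epsilon> \<longrightarrow>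
    \<epsilon> * card {e \<in> \<gamma>. \<epsilon> < t \<omega> e} \<le> n * \<eta> * (\<epsilon> + 1 + 2 * CARD('d))) sequentially"
proof -
  obtain m where m: "1 \<le> m" and good: "AE \<omega> in M. eventually (\<lambda>n.
    (\<forall>v\<in>lball 0 (4 * n). no_long_path (bad \<omega>) (rad n) v) \<and>
    (\<forall>x. l1 x = n \<longrightarrow> ptime (lball 0 (4 * n)) (W (rad n) \<omega>) 0 x \<le>
      CARD('d) * (real (n div m + 1) * (2 * \<eta> * m) + m * detour_bound TYPE('d) K (rad n)))) sequentially"
    using good_scales[OF zero \<eta>] by blast
  let ?d = "real CARD('d)" and ?D = "\<lambda>n. detour_bound TYPE('d) K (rad n)"
  have e1: "eventually (\<lambda>n::nat. 2 * (4 * (ln (real n))\<^sup>2 + 1) ^ CARD('d) \<le> real n * \<eta>) sequentially"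
    using \<eta> by real_asymp
  have e2: "eventually (\<lambda>n::nat. (2 * (2 * (ln (real n))\<^sup>2 + 1) + ?d * real m) * (K + 8 * ?d * K * (2 * (ln (real n))\<^sup>2 + 1) ^ CARD('d))
      + ?d * (2 * \<eta> * real m) \<le> real n * \<eta>) sequentially"
    using \<eta> by real_asymp
  have e3: "eventually (\<lambda>n::nat. 4 * (ln (real n))\<^sup>2 + 2 < real n) sequentially" by real_asymp
  have e4: "eventually (\<lambda>n::nat. 1 \<le> n) sequentially" by (rule eventually_ge_at_top)
  from good show ?thesis
  proof (rule AE_mp, intro AE_I2 impI)
    fix \<omega> assume \<omega>: "\<omega> \<in> space M" and ev: "eventually (\<lambda>n.
      (\<forall>v\<in>lball 0 (4 * n). no_long_path (bad \<omega>) (rad n) v) \<and>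
      (\<forall>x. l1 x = n \<longrightarrow> ptime (lball 0 (4 * n)) (W (rad n) \<omega>) 0 x \<le>
      CARD('d) * (real (n div m + 1) * (2 * \<eta> * m) + m * detour_bound TYPE('d) K (rad n)))) sequentially"
    from ev e1 e2 e3 e4 show "eventually (\<lambda>n. \<forall>x \<gamma>. \<forall>\<epsilon>::real. l1 x = n \<longrightarrow> \<gamma> \<in> geodesics (t \<omega>) 0 x \<longrightarrow> 0 \<le> \<epsilon> \<longrightarrow>
      \<epsilon> * card {e \<in> \<gamma>. \<epsilon> < t \<omega> e} \<le> n * \<eta> * (\<epsilon> + 1 + 2 * CARD('d))) sequentially"
    proof eventually_elim
      case (elim n)
      let ?r = "rad n"
      have r: "real ?r \<le> (ln (real n))\<^sup>2" by (rule rad_le)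
      have D0: "0 \<le> ?D n" using detour_bound_pos[OF K_pos] by (rule less_imp_le)
      have D: "?D n \<le> K + 8 * ?d * K * (2 * (ln (real n))\<^sup>2 + 1) ^ CARD('d)"
        using K_pos by (intro detour_bound_mono r) simp
      have rn: "4 * ?r + 2 < n" using r elim(4) by linarith
      have q1: "2 * real ((4 * ?r + 1) ^ CARD('d)) \<le> real n * \<eta>"
      proof -
        have "real ((4 * ?r + 1) ^ CARD('d)) \<le> (4 * (ln (real n))\<^sup>2 + 1) ^ CARD('d)"
          unfolding of_nat_power using r by (intro power_mono) auto
        then show ?thesis using elim(2) by linarith
      qed
      have q2: "2 * real (2 * ?r + 1) * ?D n + ?d * (real m * ?D n + 2 * \<eta> * real m) \<le> real n * \<eta>"
      proof -
        have "2 * real (2 * ?r + 1) * ?D n + ?d * (real m * ?D n + 2 * \<eta> * real m) =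
            (2 * real (2 * ?r + 1) + ?d * real m) * ?D n + ?d * (2 * \<eta> * real m)" by (simp add: algebra_simps)
        also have "\<dots> \<le> (2 * (2 * (ln (real n))\<^sup>2 + 1) + ?d * real m) * (K + 8 * ?d * K * (2 * (ln (real n))\<^sup>2 + 1) ^ CARD('d))
            + ?d * (2 * \<eta> * real m)"
          using r D D0 by (intro add_mono mult_mono order_refl) auto
        finally show ?thesis using elim(3) by linarith
      qed
      have q3: "real (n div m) * (2 * \<eta> * m) \<le> 2 * \<eta> * n"
      proof -
        have "n div m * m \<le> n" by (rule div_times_less_eq_dividend)
        then have "real (n div m) * real m \<le> real n" by (simp flip: of_nat_mult)
        then have "2 * \<eta> * (real (n div m) * real m) \<le> 2 * \<eta> * real n" using \<eta> by (intro mult_left_mono) auto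
        then show ?thesis by (simp add: mult_ac)
      qed
      show ?case
      proof (intro allI impI)
        fix x \<gamma> and \<epsilon> :: real assume x: "l1 x = n" and geo: "\<gamma> \<in> geodesics (t \<omega>) 0 x" and \<epsilon>: "0 \<le> \<epsilon>"
        have "\<epsilon> * card {e \<in> \<gamma>. \<epsilon> < t \<omega> e} \<le> 2 * \<epsilon> * (4 * real ?r + 1) ^ CARD('d)
           + 2 * (2 * real ?r + 1) * ?D n + ptime (lball 0 (4 * n)) (W ?r \<omega>) 0 x"
        proof (rule heavy_edges_bound[OF dim nonneg_t[OF \<omega>] _ _ _ _ order_refl _ geo \<epsilon>])
          show "0 \<le> K" using K_pos by simp
          show "no_long_path (bad \<omega>) ?r v" if "v \<in> lball 0 (4 * n)" for v using elim(1) that by blast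
          show "4 * ?r + 2 < l1 x" "l1 x + 2 * ?r + 1 \<le> 4 * n" using x rn by auto
          show "walks (lball 0 (4 * n)) 0 x \<noteq> {}" using x by (intro walks_lball_nonempty) simp
        qed
        also have "ptime (lball 0 (4 * n)) (W ?r \<omega>) 0 x \<le> ?d * (real (n div m + 1) * (2 * \<eta> * m) + m * ?D n)"
          using elim(1) x by blast
        also have "\<dots> = ?d * (real (n div m) * (2 * \<eta> * m)) + ?d * (real m * ?D n + 2 * \<eta> * real m)"
          by (simp add: algebra_simps)
        also have "?d * (real (n div m) * (2 * \<eta> * m)) \<le> ?d * (2 * \<eta> * n)" using q3 by (intro mult_left_mono) auto
        finally have main: "\<epsilon> * card {e \<in> \<gamma>. \<epsilon> < t \<omega> e} \<le> \<epsilon> * (2 * real ((4 * ?r + 1) ^ CARD('d)))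
           + (2 * real (2 * ?r + 1) * ?D n + ?d * (real m * ?D n + 2 * \<eta> * real m)) + ?d * (2 * \<eta> * n)"
          by (simp add: algebra_simps)
        have "\<epsilon> * (2 * real ((4 * ?r + 1) ^ CARD('d))) \<le> \<epsilon> * (real n * \<eta>)" using q1 \<epsilon> by (rule mult_left_mono)
        then have "\<epsilon> * card {e \<in> \<gamma>. \<epsilon> < t \<omega> e} \<le> \<epsilon> * (real n * \<eta>) + real n * \<eta> + ?d * (2 * \<eta> * n)"
          using main q2 by linarith
        also have "\<dots> = n * \<eta> * (\<epsilon> + 1 + 2 * CARD('d))" by (simp add: algebra_simps)
        finally show "\<epsilon> * card {e \<in> \<gamma>. \<epsilon> < t \<omega> e} \<le> n * \<eta> * (\<epsilon> + 1 + 2 * CARD('d))" .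
      qed
    qed
  qed
qed

end

section \<open>Weak convergence of the empirical measures\<close>

lemma lattice_norm_le_l1: "lattice_norm x \<le> real (l1 x)"
proof -
  have "lattice_norm x \<le> (\<Sum>i\<in>UNIV. \<bar>(\<chi> i. real_of_int (x $ i)) $ i\<bar>)"
    unfolding lattice_norm_def by (rule norm_le_l1_cart)
  also have "\<dots> = real (l1 x)" by (simp add: l1_def)
  finally show ?thesis .
qed

lemma geodesic_facts:
  assumes "\<gamma> \<in> geodesics w 0 x"
  shows "finite \<gamma>" "\<gamma> \<subseteq> lattice_edges" "l1 x \<le> card \<gamma>"
proof -
  obtain vs where vs: "saw 0 x vs" "\<gamma> = path_edges vs" using assms by (auto simp: geodesics_def saw_paths_def)
  show "finite \<gamma>" by (simp add: vs finite_path_edges)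
  show "\<gamma> \<subseteq> lattice_edges" using vs walk_path_edges by (auto simp: saw_def)
  have "vs \<in> walks UNIV 0 x" using vs(1) by (simp add: saw_def walks_def)
  from walks_length[OF this] show "l1 x \<le> card \<gamma>"
    using card_path_edges_distinct[of vs] vs by (simp add: saw_def)
qed

text \<open>Distribution functions have to converge only where the limit is continuous. Below 0 all
  of them vanish, and above 0 the missing mass is the fraction of heavier edges.\<close>

lemma weak_conv_empirical_zero:
  fixes w :: "(int ^ 'd::finite) set \<Rightarrow> real"
  assumes fin: "\<And>k. finite (\<gamma> k)" and nonneg: "\<And>k e. e \<in> \<gamma> k \<Longrightarrow> 0 \<le> w e"
    and ne: "eventually (\<lambda>k. \<gamma> k \<noteq> {}) sequentially"
    and heavy: "\<And>\<epsilon>. 0 < \<epsilon> \<Longrightarrow> (\<lambda>k. card {e \<in> \<gamma> k. \<epsilon> < w e} / card (\<gamma> k)) \<longlonglongrightarrow> 0"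
  shows "weak_conv_m (\<lambda>k. empirical_measure w (\<gamma> k)) (return borel 0)"
  unfolding weak_conv_m_def weak_conv_def
proof (intro allI impI)
  fix x :: real
  let ?F = "cdf (return borel (0 :: real))"
  have F: "?F y = (if 0 \<le> y then 1 else 0)" for y by (simp add: cdf_def2 measure_return indicator_def)
  have emp: "cdf (empirical_measure w (\<gamma> k)) x = (1 / card (\<gamma> k)) * card {e \<in> \<gamma> k. w e \<le> x}" for k
  proof -
    have "(\<Sum>e\<in>\<gamma> k. measure (return borel (w e)) {..x}) = (\<Sum>e\<in>\<gamma> k. if w e \<le> x then 1 else 0)"
      by (intro sum.cong refl) (simp add: measure_return indicator_def)
    also have "\<dots> = card {e \<in> \<gamma> k. w e \<le> x}"
      using fin[of k] by (simp add: sum.If_cases Int_def conj_commute)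
    finally show ?thesis using measure_empirical_measure[OF fin[of k], of "{..x}" w] by (simp add: cdf_def2)
  qed
  assume cont: "isCont ?F x"
  consider "x < 0" | "x = 0" | "x > 0" by linarith
  then show "(\<lambda>k. cdf (empirical_measure w (\<gamma> k)) x) \<longlonglongrightarrow> ?F x"
  proof cases
    case 1
    then have *: "{e \<in> \<gamma> k. w e \<le> x} = {}" for k using nonneg by fastforce
    have "cdf (empirical_measure w (\<gamma> k)) x = 0" for k unfolding emp * by simp
    then show ?thesis using 1 by (simp add: F)
  next
    case 2
    \<comment> \<open>The point 0 is the jump of the limit, so nothing has to converge there:
      continuity would force 0 = 1.\<close>
    have z: "(\<lambda>n. - inverse (real (Suc n))) \<longlonglongrightarrow> 0"
      using tendsto_minus[OF LIMSEQ_inverse_real_of_nat] by simp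
    have neg: "- inverse (real (Suc n)) < 0" for n by simp
    have "(\<lambda>n. ?F (- inverse (real (Suc n)))) \<longlonglongrightarrow> ?F 0"
      by (rule isCont_tendsto_compose[OF cont[unfolded 2] z])
    moreover have "?F (- inverse (real (Suc n))) = 0" for n using neg[of n] unfolding F by (simp only: not_le[symmetric] if_False)
    ultimately have "(\<lambda>n::nat. 0 :: real) \<longlonglongrightarrow> 1" by (simp only: F order_refl if_True)
    then have "(1 :: real) = 0" by (rule LIMSEQ_unique[OF _ tendsto_const])
    then show ?thesis by simp
  next
    case 3
    have "eventually (\<lambda>k. 1 - card {e \<in> \<gamma> k. x < w e} / card (\<gamma> k) = cdf (empirical_measure w (\<gamma> k)) x) sequentially"
      using ne
    proof eventually_elim
      case (elim k)
      have "\<gamma> k = {e \<in> \<gamma> k. w e \<le> x} \<union> {e \<in> \<gamma> k. x < w e}" by auto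
      moreover have "card ({e \<in> \<gamma> k. w e \<le> x} \<union> {e \<in> \<gamma> k. x < w e}) = card {e \<in> \<gamma> k. w e \<le> x} + card {e \<in> \<gamma> k. x < w e}"
        using fin[of k] by (intro card_Un_disjoint) auto
      ultimately have "real (card (\<gamma> k)) = card {e \<in> \<gamma> k. w e \<le> x} + card {e \<in> \<gamma> k. x < w e}" by simp
      moreover have "real (card (\<gamma> k)) > 0" using elim fin[of k] by (simp add: card_gt_0_iff)
      ultimately show ?case by (simp add: emp field_simps)
    qed
    moreover have "(\<lambda>k. 1 - card {e \<in> \<gamma> k. x < w e} / card (\<gamma> k)) \<longlonglongrightarrow> 1 - 0"
      by (intro tendsto_diff tendsto_const heavy 3)
    ultimately have "(\<lambda>k. cdf (empirical_measure w (\<gamma> k)) x) \<longlonglongrightarrow> 1 - 0" by (rule Lim_transform_eventually[rotated])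
    then show ?thesis using 3 by (simp add: F)
  qed
qed

theorem theorem1p6:
  fixes M :: "'w measure"
    and \<tau> :: "(int ^ 'd::finite) set \<Rightarrow> 'w \<Rightarrow> real"
    and F :: "real \<Rightarrow> real"
  assumes "CARD('d) \<ge> 2"
    and "prob_space M" and "complete_measure M"
    and "prob_space.indep_vars M (\<lambda>_. borel) \<tau> lattice_edges"
    and "\<And>e e'. e \<in> lattice_edges \<Longrightarrow> e' \<in> lattice_edges \<Longrightarrow>
           distr M borel (\<tau> e) = distr M borel (\<tau> e')"
    and "\<And>e \<omega>. e \<in> lattice_edges \<Longrightarrow> \<omega> \<in> space M \<Longrightarrow> 0 \<le> \<tau> e \<omega>"
    and "\<And>e t. e \<in> lattice_edges \<Longrightarrow> F t = measure M {\<omega> \<in> space M. \<tau> e \<omega> \<le> t}"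
    and "F 0 \<ge> critical_prob TYPE('d)"
  shows "AE \<omega> in M. \<forall>x :: nat \<Rightarrow> int ^ 'd.
           filterlim (\<lambda>k. lattice_norm (x k)) at_top sequentially \<longrightarrow>
           (\<forall>\<gamma>. (\<forall>k. \<gamma> k \<in> geodesics (\<lambda>e. \<tau> e \<omega>) 0 (x k)) \<longrightarrow>
              weak_conv_m (\<lambda>k. empirical_measure (\<lambda>e. \<tau> e \<omega>) (\<gamma> k)) (return borel 0))"
proof -
  interpret iid_field M "borel :: real measure" \<tau>
    by (intro iid_field.intro iid_field_axioms.intro assms(2,4)) (rule assms(5))
  obtain e0 :: "(int ^ 'd) set" where e0: "e0 \<in> lattice_edges" using lattice_edges_nonempty by blast
  interpret D: real_distribution "distr M borel (\<tau> e0)"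
    by (rule real_distribution_distr) (rule measurable_X[OF e0])
  \<comment> \<open>The bound on the probability of a heavy edge that \<open>K_small\<close> asks
    for; \<open>F\<close> tends to 1 at infinity, so some \<open>K\<close> meets it.\<close>
  define q where "q = (1 / (4 * real CARD('d))) ^ (2 ^ CARD('d)) / (2 * real CARD('d))"
  have q: "q > 0" by (simp add: q_def)
  have "cdf (distr M borel (\<tau> e0)) x = F x" for x
  proof -
    have "cdf (distr M borel (\<tau> e0)) x = prob (\<tau> e0 -` {..x} \<inter> space M)"
      unfolding cdf_def2 by (rule measure_distr[OF measurable_X[OF e0]]) simp
    also have "\<tau> e0 -` {..x} \<inter> space M = {\<omega> \<in> space M. \<tau> e0 \<omega> \<le> x}" by auto
    finally show ?thesis using assms(7)[OF e0] by simp
  qed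
  then have "cdf (distr M borel (\<tau> e0)) = F" by (rule ext)
  then have "(F \<longlongrightarrow> 1) at_top" using D.cdf_lim_at_top_prob by (simp only:)
  then have "eventually (\<lambda>x. 1 - q < F x) at_top" by (rule order_tendstoD(1)) (use q in simp)
  then have "eventually (\<lambda>x. 1 - q < F x \<and> x > 0) at_top" by (intro eventually_conj eventually_gt_at_top)
  then obtain K where K: "1 - q < F K" "K > 0" by (metis (mono_tags, lifting) eventually_happens' trivial_limit_at_top_linorder)
  interpret fpp_field M \<tau> K
  proof
    fix e :: "(int ^ 'd) set" assume e: "e \<in> lattice_edges"
    have "{\<omega> \<in> space M. K < \<tau> e \<omega>} = space M - {\<omega> \<in> space M. \<tau> e \<omega> \<le> K}" by auto
    moreover have "{\<omega> \<in> space M. \<tau> e \<omega> \<le> K} \<in> events" using measurable_X[OF e] by measurable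
    ultimately have "prob {\<omega> \<in> space M. K < \<tau> e \<omega>} = 1 - F K" using assms(7)[OF e, of K] by (simp add: prob_compl)
    then have "prob {\<omega> \<in> space M. K < \<tau> e \<omega>} \<le> q" using K(1) by simp
    then have "2 * real CARD('d) * prob {\<omega> \<in> space M. K < \<tau> e \<omega>} \<le> 2 * real CARD('d) * q" by (intro mult_left_mono) auto
    then show "real (2 * CARD('d)) * prob {\<omega> \<in> space M. K < \<tau> e \<omega>} \<le> (1 / real (4 * CARD('d))) ^ 2 ^ CARD('d)"
      by (simp add: q_def)
  qed (use assms(1,6) K(2) in auto)
  let ?\<delta> = "\<lambda>A. (1 / (4 * real CARD('d))) ^ ((2 * A * CARD('d) + 1) ^ CARD('d))"
  have cr: "?\<delta> A \<le> prob {\<omega> \<in> space M. crossing (CARD('d) * h) (A * CARD('d) * h) {e. \<tau> e \<omega> \<le> 0} 0}"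
    if "1 \<le> A" "1 \<le> h" for A h
  proof -
    have b: "Measurable.pred (borel :: real measure) (\<lambda>x. x \<le> 0)" by measurable
    show ?thesis
      using crossing_probability_lower_bound[where b = "\<lambda>x. x \<le> 0", OF iid_field_axioms b _ assms(8) that(2,1)] assms(7)
      by simp
  qed
  have zero: "time_constant (axis i 1) = 0" for i
    by (rule time_constant_zero[of ?\<delta>]) (use cr in auto)
  \<comment> \<open>The choices \<eta> = 1 / (j + 1) keep the number of null sets countable.\<close>
  have "AE \<omega> in M. \<forall>j::nat. eventually (\<lambda>n. \<forall>x \<gamma>. \<forall>\<epsilon>::real. l1 x = n \<longrightarrow> \<gamma> \<in> geodesics (t \<omega>) 0 x \<longrightarrow> 0 \<le> \<epsilon> \<longrightarrow>
      \<epsilon> * card {e \<in> \<gamma>. \<epsilon> < t \<omega> e} \<le> n * (1 / Suc j) * (\<epsilon> + 1 + 2 * CARD('d))) sequentially"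
    unfolding AE_all_countable by (intro allI few_heavy_edges zero) simp
  then show ?thesis
  proof (rule AE_mp, intro AE_I2 impI allI)
    fix \<omega> x \<gamma>
    assume \<omega>: "\<omega> \<in> space M"
      and heavy: "\<forall>j::nat. eventually (\<lambda>n. \<forall>x \<gamma>. \<forall>\<epsilon>::real. l1 x = n \<longrightarrow> \<gamma> \<in> geodesics (t \<omega>) 0 x \<longrightarrow> 0 \<le> \<epsilon> \<longrightarrow>
      \<epsilon> * card {e \<in> \<gamma>. \<epsilon> < t \<omega> e} \<le> n * (1 / Suc j) * (\<epsilon> + 1 + 2 * CARD('d))) sequentially"
      and x: "filterlim (\<lambda>k. lattice_norm (x k)) at_top sequentially"
      and geo: "\<forall>k. \<gamma> k \<in> geodesics (t \<omega>) 0 (x k)"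
    have "filterlim (\<lambda>k. real (l1 (x k))) at_top sequentially"
      by (rule filterlim_at_top_mono[OF x]) (simp add: lattice_norm_le_l1)
    then have real_lim: "\<forall>Z. eventually (\<lambda>k. Z \<le> real (l1 (x k))) sequentially"
      unfolding filterlim_at_top .
    \<comment> \<open>\<open>few_heavy_edges\<close> is indexed by the scale, so it is read along
      \<open>l1 (x k)\<close>, which tends to infinity.\<close>
    have lim: "filterlim (\<lambda>k. l1 (x k)) at_top sequentially"
      unfolding filterlim_at_top
    proof
      fix Z :: nat
      show "eventually (\<lambda>k. Z \<le> l1 (x k)) sequentially" using real_lim[rule_format, of "real Z"] by simp
    qed
    note gf = geodesic_facts[OF geo[rule_format]]
    have ne: "eventually (\<lambda>k. 1 \<le> l1 (x k)) sequentially"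
      using filterlim_at_top[THEN iffD1, OF lim] by blast
    show "weak_conv_m (\<lambda>k. empirical_measure (t \<omega>) (\<gamma> k)) (return borel 0)"
    proof (rule weak_conv_empirical_zero)
      show "finite (\<gamma> k)" for k by (rule gf(1))
      show "0 \<le> t \<omega> e" if "e \<in> \<gamma> k" for k e using gf(2)[of k] that assms(6)[OF _ \<omega>] by blast
      show "eventually (\<lambda>k. \<gamma> k \<noteq> {}) sequentially"
        using ne
      proof eventually_elim
        case (elim k)
        then show ?case using gf(3)[of k] by auto
      qed
      fix \<epsilon> :: real assume \<epsilon>: "0 < \<epsilon>"
      let ?B = "\<epsilon> + 1 + 2 * real CARD('d)"
      show "(\<lambda>k. card {e \<in> \<gamma> k. \<epsilon> < t \<omega> e} / card (\<gamma> k)) \<longlonglongrightarrow> 0"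
      proof (rule LIMSEQ_I)
        fix r :: real assume r: "0 < r"
        have B: "?B > 0" using \<epsilon> by simp
        \<comment> \<open>With \<eta> = 1 / (j + 1) the bound of \<open>few_heavy_edges\<close>,
          divided by \<epsilon>, is less than \<open>r\<close> times \<open>l1 (x k)\<close>, and a
          geodesic to \<open>x k\<close> has at least \<open>l1 (x k)\<close> edges.\<close>
        obtain j :: nat where j: "?B / (\<epsilon> * r) < real (Suc j)"
          using reals_Archimedean2[of "?B / (\<epsilon> * r)"] by (metis less_trans of_nat_less_iff lessI)
        have "eventually (\<lambda>k. \<forall>y \<gamma>. \<forall>\<epsilon>::real. l1 y = l1 (x k) \<longrightarrow> \<gamma> \<in> geodesics (t \<omega>) 0 y \<longrightarrow> 0 \<le> \<epsilon> \<longrightarrow>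
          \<epsilon> * card {e \<in> \<gamma>. \<epsilon> < t \<omega> e} \<le> l1 (x k) * (1 / Suc j) * (\<epsilon> + 1 + 2 * CARD('d))) sequentially"
          using eventually_compose_filterlim[OF heavy[rule_format, of j] lim] .
        with ne have "eventually (\<lambda>k. norm (card {e \<in> \<gamma> k. \<epsilon> < t \<omega> e} / card (\<gamma> k) - 0) < r) sequentially"
        proof eventually_elim
          case (elim k)
          let ?c = "real (card {e \<in> \<gamma> k. \<epsilon> < t \<omega> e})"
          have c0: "0 < real (card (\<gamma> k))" using gf(3)[of k] elim(1) by simp
          have "\<epsilon> * ?c \<le> l1 (x k) * (1 / Suc j) * ?B" using elim(2) geo \<epsilon> by simp
          also have "\<dots> \<le> card (\<gamma> k) * (1 / Suc j) * ?B"
            using gf(3)[of k] B by (intro mult_right_mono) auto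
          also have "\<dots> < card (\<gamma> k) * (\<epsilon> * r)"
          proof -
            have "?B < real (Suc j) * (\<epsilon> * r)" using j \<epsilon> r by (simp add: pos_divide_less_eq)
            then have "(1 / Suc j) * ?B < \<epsilon> * r" by (simp add: pos_divide_less_eq mult.commute)
            then show ?thesis using c0 by (simp only: mult.assoc mult_less_cancel_left_pos)
          qed
          finally have "\<epsilon> * ?c < \<epsilon> * (card (\<gamma> k) * r)" by (simp add: mult_ac)
          then have "?c < card (\<gamma> k) * r" using \<epsilon> by simp
          then show ?case using c0 by (simp add: pos_divide_less_eq mult.commute)
        qed
        then show "\<exists>no. \<forall>k\<ge>no. norm (card {e \<in> \<gamma> k. \<epsilon> < t \<omega> e} / card (\<gamma> k) - 0) < r"
          unfolding eventually_sequentially .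
      qed
    qed
  qed
qed

end
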